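(* Assume that the pair $(-A-A_{\rm rc},\mathcal Z)$ is detectable, that the pair $(-A-A_{\rm rc},U_M^\diamond)$ is stabilizable, and that the pair $(-A-A_{\rm rc},Q)$ is detectable. Let $\mathfrak I_S\in L^\infty(\mathbb R_+,\mathcal L(\mathbb R^S,H))$, $C_{\mathrm o,1}\ge1$ and $\mu_1>0$ be such that every solution of $\dot z+Az+A_{\rm rc}z=\mathfrak I_S\mathcal Z z$, $z(0)=z_0\in H$, satisfies $$|z(t)|_H\le C_{\mathrm o,1}\,e^{-\mu_1(t-s)}|z(s)|_H\quad\text{for all } t\ge s\ge0 .$$ Let $\theta\in(0,1)$ and $T\ge\tau>0$ be such that, for every $(t_{\rm in},y_{\rm in})\in[0,+\infty)\times H$, the optimal state $y_T^*(\cdot;t_{\rm in},y_{\rm in})$ satisfies $$\min_{t\in[t_{\rm in},t_{\rm in}+T]}|y_T^*(t;t_{\rm in},y_{\rm in})|_H\le\theta|y_{\rm in}|_H\quad\text{and}\quad \max\operatorname*{argmin}_{t\in[t_{\rm in},t_{\rm in}+T]}|y_T^*(t;t_{\rm in},y_{\rm in})|_H>t_{\rm in}+\tau .$$ Let $\mu_2<\min\{\mu_1,T^{-1}\log(\theta^{-1})\}$. Then there are constants $D_1\ge1$ and $D_2>0$ such that, for every initial state $y_0\in H$ and every guess $\widehat y_0\in H$, the state $y_{\rm orh}$ associated with the input $u_{\rm orh}$ constructed by the output based receding horizon algorithm (with parameters $T$, $\tau$, output operator $\mathcal Z$, output injection operator $\mathfrak I_S$, guess $\widehat y_0$ and $T_\infty=\infty$),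 together with the estimate error $z=\widehat y-y_{\rm orh}$, satisfies $$|(y_{\rm orh}(t),z(t))|_{H\times H}\le D_1e^{-\mu_2t}\,|(y_{\rm orh}(0),z(0))|_{H\times H}\quad\text{for all } t\ge0,$$ and the control input satisfies $|u_{\rm orh}|_{L^2(\mathbb R_+,\mathbb R^M)}\le D_2\,|(y_{\rm orh}(0),z(0))|_{H\times H}$. Moreover, in the case $\mu_1\ne T^{-1}\log(\theta^{-1})$ one can take $\mu_2=\min\{\mu_1,T^{-1}\log(\theta^{-1})\}$.
   Context: $|\cdot|_X$ denotes the norm of a normed space $X$; $\mathcal L(X,Y)$ is the space of bounded linear operators; $\mathbb R_+=(0,+\infty)$, $\mathbb N=\{0,1,2,\dots\}$. For an open interval $I$, $W(I,V,V')=\{y\in L^2(I,V)\mid \dot y\in L^2(I,V')\}$. Spaces and operators. $H$ is a real separable Hilbert space identified with its dual, $H=H'$, and $V\subseteq H$ is a real separable Hilbert space, the inclusion being dense, continuous and compact (so $V\subseteq H\subseteq V'$). The operator $A\in\mathcal L(V,V')$ is symmetric and $(y,z)\mapsto\langle Ay,z\rangle_{V',V}$ is a complete scalar product in $V$. For almost every $t>0$, $A_{\rm rc}(t)\in\mathcal L(H,V')+\mathcal L(V,H)$, and $|A_{\rm rc}|_{L^\infty(\mathbb R_+,\mathcal L(H,V')+\mathcal L(V,H))}<+\infty$. Given actuators $\Phi_1,\dots,\Phi_M\in H$, the control operator $U_M^\diamond\in\mathcal L(\mathbb R^M,H)$ is $U_M^\diamond u=\sum_{j=1}^Mu_j\Phi_j$.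 Given $S$ sensors, the output operator is $\mathcal Z\in\mathcal L(V,\mathbb R^S)$. The state-penalization operator is $Q\in\mathcal L(V,H_Q)$, with $H_Q$ a Hilbert space. Stability notions. For $\mathfrak A\in L^\infty(\mathbb R_+,\mathcal L(V,V'))$ for which the weak solutions of $\dot y=\mathfrak A y$ are, on bounded time intervals, in $L^2$ with values in $V$ with $\dot y$ in $L^2$ with values in $V'$ (hence continuous in $H$), $\mathfrak A$ is called exponentially stable if there are $\varrho\ge1$, $\mu>0$ such that every weak solution satisfies $|y(t)|_H\le\varrho e^{-\mu(t-s)}|y(s)|_H$ for all $t\ge s\ge0$ and every state $y(s)\in H$ at time $s$. Let $\mathcal H_1,\mathcal H_2$ be Hilbert spaces. A pair $(\mathfrak A,\mathfrak B)$ with $\mathfrak B\in L^\infty(\mathbb R_+,\mathcal L(\mathcal H_1,H))$ is stabilizable if there is $\mathfrak K\in L^\infty(\mathbb R_+,\mathcal L(V,\mathcal H_1))$ such that $\mathfrak A+\mathfrak B\mathfrak K$ is exponentially stable. A pair $(\mathfrak A,\mathfrak C)$ with $\mathfrak C\in L^\infty(\mathbb R_+,\mathcal L(V,\mathcal H_2))$ is detectable if there is $\mathfrak L\in L^\infty(\mathbb R_+,\mathcal L(\mathcal H_2,H))$ such that $\mathfrak A+\mathfrak L\mathfrak C$ is exponentially stable. Finite time-horizon problem. For $t_{\rm in}\ge0$, $T>0$, $y_{\rm in}\in H$, the pair $(y_T^*,u_T^* )(\cdot;t_{\rm in},y_{\rm in})$ is the unique minimizer of $$\mathcal J_T(y,u;t_{\rm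 in},y_{\rm in})=\tfrac12\int_{t_{\rm in}}^{t_{\rm in}+T}|Qy(t)|_{H_Q}^2+|u(t)|_{\mathbb R^M}^2\,dt$$ over all $(y,u)\in W((t_{\rm in},t_{\rm in}+T),V,V')\times L^2((t_{\rm in},t_{\rm in}+T),\mathbb R^M)$ satisfying $\dot y+Ay+A_{\rm rc}y=U_M^\diamond u$ and $y(t_{\rm in})=y_{\rm in}$. Output based receding horizon algorithm (with $T_\infty=\infty$). Set $t_0=0$, $\widehat y(0)=\widehat y_0$. For $n=0,1,2,\dots$: with $t_{\rm in}=t_n$ and $y_{\rm in}=\widehat y(t_n)$, compute $(y_T^*,u_T^* )(\cdot;t_n,\widehat y(t_n))$ on $[t_n,t_n+T]$; set $$t_{n+1}=\max\operatorname*{argmin}_{t\in[t_n+\tau,t_n+T]}|y_T^*(t;t_n,\widehat y(t_n))|_H;$$ set $u_{\rm orh}=u_T^*(\cdot;t_n,\widehat y(t_n))$ on $(t_n,t_{n+1})$; let the true state evolve on $[t_n,t_{n+1}]$ by $$\dot y_{\rm orh}+Ay_{\rm orh}+A_{\rm rc}y_{\rm orh}=U_M^\diamond u_{\rm orh},\qquad y_{\rm orh}(0)=y_0,$$ and, using the output $w_{\rm orh}=\mathcal Zy_{\rm orh}$, let the estimate evolve on $[t_n,t_{n+1}]$ by the observer $$\dot{\widehat y}+A\widehat y+A_{\rm rc}\widehat y=U_M^\diamond u_{\rm orh}+\mathfrak I_S(\mathcal Z\widehat y-w_{\rm orh}),\qquad\widehat y(0)=\widehat y_0 .$$ *)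

theory Defs
  imports "HOL-Analysis.Analysis"
begin

section \<open>Bochner spaces on subsets of the real line\<close>

text \<open>
  Strong (Bochner) measurability, taken with respect to a subspace \<open>X\<close> carrying its own norm \<open>N\<close>.
  The Borel measurability of the library is not the right notion for the nonseparable
  spaces of operators below.
\<close>

definition strongly_measurable_in ::
  "'b::real_vector set \<Rightarrow> ('b \<Rightarrow> real) \<Rightarrow> real set \<Rightarrow> (real \<Rightarrow> 'b) \<Rightarrow> bool" where
  "strongly_measurable_in X N I f \<longleftrightarrow>
    (\<exists>s. (\<forall>n::nat. simple_function (lebesgue_on I) (s n) \<and> s n ` I \<subseteq> X) \<and>
         (AE t in lebesgue_on I. f t \<in> X \<and> (\<lambda>n. N (s n t - f t)) \<longlonglongrightarrow> 0))"

definition Linf_in ::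
  "'b::real_vector set \<Rightarrow> ('b \<Rightarrow> real) \<Rightarrow> real set \<Rightarrow> (real \<Rightarrow> 'b) \<Rightarrow> bool" where
  "Linf_in X N I f \<longleftrightarrow>
    strongly_measurable_in X N I f \<and> (\<exists>C. AE t in lebesgue_on I. N (f t) \<le> C)"

definition Linf_on :: "real set \<Rightarrow> (real \<Rightarrow> 'b::real_normed_vector) \<Rightarrow> bool" where
  "Linf_on I f \<longleftrightarrow> Linf_in UNIV norm I f"

definition L2_on :: "real set \<Rightarrow> (real \<Rightarrow> 'b::real_normed_vector) \<Rightarrow> bool" where
  "L2_on I f \<longleftrightarrow>
    strongly_measurable_in UNIV norm I f \<and> integrable (lebesgue_on I) (\<lambda>t. (norm (f t))\<^sup>2)"

definition L2_norm_on :: "real set \<Rightarrow> (real \<Rightarrow> 'b::real_normed_vector) \<Rightarrow> real" where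
  "L2_norm_on I f = sqrt (LINT t|lebesgue_on I. (norm (f t))\<^sup>2)"


section \<open>The triple \<open>V \<subseteq> H \<subseteq> V'\<close>\<close>

text \<open>
  \<open>V\<close> is a type of its own, embedded in \<open>H\<close> by a map \<open>\<iota>\<close>; \<open>V'\<close> is the type
  of bounded linear functionals on \<open>V\<close>.
\<close>

definition gelfand_embedding ::
  "('v::{real_inner,banach} \<Rightarrow>\<^sub>L 'h::{real_inner,banach}) \<Rightarrow> bool" where
  "gelfand_embedding \<iota> \<longleftrightarrow>
    inj (blinfun_apply \<iota>) \<and> closure (range (blinfun_apply \<iota>)) = UNIV \<and>
    compact (closure (blinfun_apply \<iota> ` cball 0 1))"

text \<open>The inclusion of \<open>H = H'\<close> in \<open>V'\<close>.\<close>

definition dual_incl ::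
  "('v::real_inner \<Rightarrow>\<^sub>L 'h::real_inner) \<Rightarrow> 'h \<Rightarrow>\<^sub>L ('v \<Rightarrow>\<^sub>L real)" where
  "dual_incl \<iota> = Blinfun (\<lambda>h. blinfun_inner_right h o\<^sub>L \<iota>)"

lemma dual_incl_apply [simp]: "blinfun_apply (dual_incl \<iota> h) v = h \<bullet> blinfun_apply \<iota> v"
proof -
  have "bounded_linear (\<lambda>h. blinfun_inner_right h o\<^sub>L \<iota>)"
    by (intro bounded_linear_intros)
  then show ?thesis
    by (simp add: dual_incl_def bounded_linear_Blinfun_apply)
qed

text \<open>
  The element of \<open>V\<close> that \<open>y t\<close> is when it lies in \<open>V\<close>; arbitrary otherwise, which
  in what follows concerns only a null set of times.
\<close>

definition in_V :: "('v::real_inner \<Rightarrow>\<^sub>L 'h::real_inner) \<Rightarrow> (real \<Rightarrow> 'h) \<Rightarrow> real \<Rightarrow> 'v" where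
  "in_V \<iota> y t = inv (blinfun_apply \<iota>) (y t)"

definition complete_scalar_product ::
  "('v::{real_inner,banach} \<Rightarrow>\<^sub>L ('v \<Rightarrow>\<^sub>L real)) \<Rightarrow> bool" where
  "complete_scalar_product A \<longleftrightarrow>
    (\<forall>y z. A y z = A z y) \<and> (\<forall>y. y \<noteq> 0 \<longrightarrow> A y y > 0) \<and>
    (\<forall>x :: nat \<Rightarrow> 'v.
      (\<forall>e>0. \<exists>N. \<forall>m\<ge>N. \<forall>n\<ge>N. sqrt (A (x m - x n) (x m - x n)) < e) \<longrightarrow>
      (\<exists>l. (\<lambda>n. sqrt (A (x n - l) (x n - l))) \<longlonglongrightarrow> 0))"

text \<open>
  The sum \<open>L(H,V') + L(V,H)\<close> as a subspace of \<open>L(V,V')\<close>, with the usual norm of a sum of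
  Banach spaces.
\<close>

definition rc_space ::
  "('v::real_inner \<Rightarrow>\<^sub>L 'h::real_inner) \<Rightarrow> ('v \<Rightarrow>\<^sub>L ('v \<Rightarrow>\<^sub>L real)) set" where
  "rc_space \<iota> = {(B1 o\<^sub>L \<iota>) + (dual_incl \<iota> o\<^sub>L B2) |(B1 :: 'h \<Rightarrow>\<^sub>L ('v \<Rightarrow>\<^sub>L real)) (B2 :: 'v \<Rightarrow>\<^sub>L 'h). True}"

definition rc_norm ::
  "('v::real_inner \<Rightarrow>\<^sub>L 'h::real_inner) \<Rightarrow> ('v \<Rightarrow>\<^sub>L ('v \<Rightarrow>\<^sub>L real)) \<Rightarrow> real" where
  "rc_norm \<iota> B =
    Inf {norm B1 + norm B2 |(B1 :: 'h \<Rightarrow>\<^sub>L ('v \<Rightarrow>\<^sub>L real)) (B2 :: 'v \<Rightarrow>\<^sub>L 'h).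
      B = (B1 o\<^sub>L \<iota>) + (dual_incl \<iota> o\<^sub>L B2)}"


section \<open>Weak solutions\<close>

definition test_function :: "real set \<Rightarrow> (real \<Rightarrow> real) \<Rightarrow> bool" where
  "test_function I \<phi> \<longleftrightarrow>
    (\<forall>n. (deriv ^^ n) \<phi> differentiable_on UNIV) \<and>
    compact (closure {t. \<phi> t \<noteq> 0}) \<and> closure {t. \<phi> t \<noteq> 0} \<subseteq> I"

text \<open>
  \<open>y\<close> belongs to \<open>W((a,b),V,V')\<close> and \<open>g\<close> is its derivative. Elements of \<open>W\<close> are represented
  by their continuous \<open>H\<close>-valued versions on \<open>[a,b]\<close>, so that their values at single times make
  sense. The distributional derivative is the one of \<open>V'\<close>-valued functions, the equality in \<open>V'\<close>
  being evaluated at each \<open>w\<close> in \<open>V\<close>.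
\<close>

definition W_deriv ::
  "('v::{real_inner,banach} \<Rightarrow>\<^sub>L 'h::{real_inner,banach}) \<Rightarrow> real \<Rightarrow> real \<Rightarrow>
    (real \<Rightarrow> 'h) \<Rightarrow> (real \<Rightarrow> ('v \<Rightarrow>\<^sub>L real)) \<Rightarrow> bool" where
  "W_deriv \<iota> a b y g \<longleftrightarrow>
    continuous_on {a..b} y \<and>
    (AE t in lebesgue_on {a<..<b}. y t \<in> range (blinfun_apply \<iota>)) \<and>
    L2_on {a<..<b} (in_V \<iota> y) \<and> L2_on {a<..<b} g \<and>
    (\<forall>\<phi> w. test_function {a<..<b} \<phi> \<longrightarrow>
      (LINT t|lebesgue_on {a<..<b}. deriv \<phi> t * (y t \<bullet> \<iota> w)) =
      - (LINT t|lebesgue_on {a<..<b}. \<phi> t * g t w))"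

text \<open>\<open>y\<close> is a weak solution of \<open>y' = \<AA> y + f\<close> on \<open>[a,b]\<close>, respectively on \<open>[s,\<infinity>)\<close> with \<open>f = 0\<close>.\<close>

definition weak_solution_on ::
  "('v::{real_inner,banach} \<Rightarrow>\<^sub>L 'h::{real_inner,banach}) \<Rightarrow> real \<Rightarrow> real \<Rightarrow>
    (real \<Rightarrow> ('v \<Rightarrow>\<^sub>L ('v \<Rightarrow>\<^sub>L real))) \<Rightarrow> (real \<Rightarrow> ('v \<Rightarrow>\<^sub>L real)) \<Rightarrow> (real \<Rightarrow> 'h) \<Rightarrow> bool" where
  "weak_solution_on \<iota> a b \<AA> f y \<longleftrightarrow>
    (\<exists>g. W_deriv \<iota> a b y g \<and>
      (AE t in lebesgue_on {a<..<b}. g t = \<AA> t (in_V \<iota> y t) + f t))"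

definition weak_solution_from ::
  "('v::{real_inner,banach} \<Rightarrow>\<^sub>L 'h::{real_inner,banach}) \<Rightarrow> real \<Rightarrow>
    (real \<Rightarrow> ('v \<Rightarrow>\<^sub>L ('v \<Rightarrow>\<^sub>L real))) \<Rightarrow> (real \<Rightarrow> 'h) \<Rightarrow> bool" where
  "weak_solution_from \<iota> s \<AA> y \<longleftrightarrow> (\<forall>b>s. weak_solution_on \<iota> s b \<AA> (\<lambda>t. 0) y)"


section \<open>Stability notions\<close>

text \<open>
  The first two conjuncts delimit the operators for which exponential stability is considered:
  each state \<open>h\<close> at each time \<open>s\<close> is the origin of a weak solution with the regularity of \<open>W\<close> on
  bounded time intervals.
\<close>

definition exponentially_stable ::
  "('v::{real_inner,banach} \<Rightarrow>\<^sub>L 'h::{real_inner,banach}) \<Rightarrow>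
    (real \<Rightarrow> ('v \<Rightarrow>\<^sub>L ('v \<Rightarrow>\<^sub>L real))) \<Rightarrow> bool" where
  "exponentially_stable \<iota> \<AA> \<longleftrightarrow>
    Linf_on {0<..} \<AA> \<and>
    (\<forall>s\<ge>0. \<forall>h. \<exists>y. weak_solution_from \<iota> s \<AA> y \<and> y s = h) \<and>
    (\<exists>\<rho>\<ge>1. \<exists>\<mu>>0. \<forall>s\<ge>0. \<forall>y. weak_solution_from \<iota> s \<AA> y \<longrightarrow>
      (\<forall>t\<ge>s. norm (y t) \<le> \<rho> * exp (- \<mu> * (t - s)) * norm (y s)))"

definition stabilizable ::
  "('v::{real_inner,banach} \<Rightarrow>\<^sub>L 'h::{real_inner,banach}) \<Rightarrow>
    (real \<Rightarrow> ('v \<Rightarrow>\<^sub>L ('v \<Rightarrow>\<^sub>L real))) \<Rightarrow> (real \<Rightarrow> ('k::{real_inner,banach} \<Rightarrow>\<^sub>L 'h)) \<Rightarrow> bool" where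
  "stabilizable \<iota> \<AA> \<BB> \<longleftrightarrow>
    Linf_on {0<..} \<BB> \<and>
    (\<exists>K :: real \<Rightarrow> ('v \<Rightarrow>\<^sub>L 'k). Linf_on {0<..} K \<and>
      exponentially_stable \<iota> (\<lambda>t. \<AA> t + (dual_incl \<iota> o\<^sub>L \<BB> t o\<^sub>L K t)))"

definition detectable ::
  "('v::{real_inner,banach} \<Rightarrow>\<^sub>L 'h::{real_inner,banach}) \<Rightarrow>
    (real \<Rightarrow> ('v \<Rightarrow>\<^sub>L ('v \<Rightarrow>\<^sub>L real))) \<Rightarrow> (real \<Rightarrow> ('v \<Rightarrow>\<^sub>L 'k::{real_inner,banach})) \<Rightarrow> bool" where
  "detectable \<iota> \<AA> \<CC> \<longleftrightarrow>
    Linf_on {0<..} \<CC> \<and>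
    (\<exists>L :: real \<Rightarrow> ('k \<Rightarrow>\<^sub>L 'h). Linf_on {0<..} L \<and>
      exponentially_stable \<iota> (\<lambda>t. \<AA> t + (dual_incl \<iota> o\<^sub>L L t o\<^sub>L \<CC> t)))"


section \<open>The finite time-horizon problem\<close>

definition control_op :: "('m::finite \<Rightarrow> 'h::real_inner) \<Rightarrow> (real^'m) \<Rightarrow>\<^sub>L 'h" where
  "control_op \<Phi> = Blinfun (\<lambda>u. \<Sum>j\<in>UNIV. (u $ j) *\<^sub>R \<Phi> j)"

lemma control_op_apply [simp]:
  fixes \<Phi> :: "'m::finite \<Rightarrow> 'h::real_inner"
  shows "blinfun_apply (control_op \<Phi>) u = (\<Sum>j\<in>UNIV. (u $ j) *\<^sub>R \<Phi> j)"
proof -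
  have "bounded_linear (\<lambda>u :: real^'m. \<Sum>j\<in>UNIV. (u $ j) *\<^sub>R \<Phi> j)"
    by (intro bounded_linear_sum bounded_linear_scaleR_const bounded_linear_vec_nth)
  then show ?thesis
    by (simp add: control_op_def bounded_linear_Blinfun_apply)
qed

definition admissible_pair ::
  "('v::{real_inner,banach} \<Rightarrow>\<^sub>L 'h::{real_inner,banach}) \<Rightarrow>
    ('v \<Rightarrow>\<^sub>L ('v \<Rightarrow>\<^sub>L real)) \<Rightarrow> (real \<Rightarrow> ('v \<Rightarrow>\<^sub>L ('v \<Rightarrow>\<^sub>L real))) \<Rightarrow> ('m::finite \<Rightarrow> 'h) \<Rightarrow>
    real \<Rightarrow> real \<Rightarrow> 'h \<Rightarrow> (real \<Rightarrow> 'h) \<Rightarrow> (real \<Rightarrow> real^'m) \<Rightarrow> bool" where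
  "admissible_pair \<iota> A Arc \<Phi> T t_in y_in y u \<longleftrightarrow>
    L2_on {t_in<..<t_in + T} u \<and>
    weak_solution_on \<iota> t_in (t_in + T) (\<lambda>t. - A - Arc t)
      (\<lambda>t. dual_incl \<iota> (control_op \<Phi> (u t))) y \<and>
    y t_in = y_in"

definition cost ::
  "('v::{real_inner,banach} \<Rightarrow>\<^sub>L 'h::{real_inner,banach}) \<Rightarrow> ('v \<Rightarrow>\<^sub>L 'q::{real_inner,banach}) \<Rightarrow>
    real \<Rightarrow> real \<Rightarrow> (real \<Rightarrow> 'h) \<Rightarrow> (real \<Rightarrow> real^'m::finite) \<Rightarrow> real" where
  "cost \<iota> Q T t_in y u =
    1/2 * (LINT t|lebesgue_on {t_in<..<t_in + T}. (norm (Q (in_V \<iota> y t)))\<^sup>2 + (norm (u t))\<^sup>2)"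

definition optimal_pair ::
  "('v::{real_inner,banach} \<Rightarrow>\<^sub>L 'h::{real_inner,banach}) \<Rightarrow>
    ('v \<Rightarrow>\<^sub>L ('v \<Rightarrow>\<^sub>L real)) \<Rightarrow> (real \<Rightarrow> ('v \<Rightarrow>\<^sub>L ('v \<Rightarrow>\<^sub>L real))) \<Rightarrow> ('m::finite \<Rightarrow> 'h) \<Rightarrow>
    ('v \<Rightarrow>\<^sub>L 'q::{real_inner,banach}) \<Rightarrow>
    real \<Rightarrow> real \<Rightarrow> 'h \<Rightarrow> (real \<Rightarrow> 'h) \<Rightarrow> (real \<Rightarrow> real^'m) \<Rightarrow> bool" where
  "optimal_pair \<iota> A Arc \<Phi> Q T t_in y_in y u \<longleftrightarrow>
    admissible_pair \<iota> A Arc \<Phi> T t_in y_in y u \<and>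
    (\<forall>y' u'. admissible_pair \<iota> A Arc \<Phi> T t_in y_in y' u' \<longrightarrow>
      cost \<iota> Q T t_in y u \<le> cost \<iota> Q T t_in y' u')"


section \<open>The output based receding horizon algorithm\<close>

definition max_argmin :: "(real \<Rightarrow> real) \<Rightarrow> real set \<Rightarrow> real" where
  "max_argmin f S = (GREATEST t. is_arg_min f (\<lambda>t. t \<in> S) t)"

text \<open>
  \<open>y\<close>, \<open>yh\<close> and \<open>u\<close> are the true state, the estimate and the input produced by the algorithm
  with initial state \<open>y0\<close> and guess \<open>yh0\<close>; \<open>ts\<close> is the sequence of concatenation times.
\<close>

definition orh_run ::
  "('v::{real_inner,banach} \<Rightarrow>\<^sub>L 'h::{real_inner,banach}) \<Rightarrow>
    ('v \<Rightarrow>\<^sub>L ('v \<Rightarrow>\<^sub>L real)) \<Rightarrow> (real \<Rightarrow> ('v \<Rightarrow>\<^sub>L ('v \<Rightarrow>\<^sub>L real))) \<Rightarrow> ('m::finite \<Rightarrow> 'h) \<Rightarrow>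
    ('v \<Rightarrow>\<^sub>L 'q::{real_inner,banach}) \<Rightarrow>
    ('v \<Rightarrow>\<^sub>L (real^'s::finite)) \<Rightarrow> (real \<Rightarrow> ((real^'s) \<Rightarrow>\<^sub>L 'h)) \<Rightarrow> real \<Rightarrow> real \<Rightarrow> 'h \<Rightarrow> 'h \<Rightarrow>
    (real \<Rightarrow> 'h) \<Rightarrow> (real \<Rightarrow> 'h) \<Rightarrow> (real \<Rightarrow> real^'m) \<Rightarrow> bool" where
  "orh_run \<iota> A Arc \<Phi> Q Z Inj T \<tau> y0 yh0 y yh u \<longleftrightarrow>
    y 0 = y0 \<and> yh 0 = yh0 \<and>
    (\<exists>ts :: nat \<Rightarrow> real. ts 0 = 0 \<and>
      (\<forall>n. (\<exists>y_opt u_opt.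
              optimal_pair \<iota> A Arc \<Phi> Q T (ts n) (yh (ts n)) y_opt u_opt \<and>
              ts (Suc n) = max_argmin (\<lambda>t. norm (y_opt t)) {ts n + \<tau>..ts n + T} \<and>
              (\<forall>t\<in>{ts n<..<ts (Suc n)}. u t = u_opt t)) \<and>
           weak_solution_on \<iota> (ts n) (ts (Suc n)) (\<lambda>t. - A - Arc t)
             (\<lambda>t. dual_incl \<iota> (control_op \<Phi> (u t))) y \<and>
           weak_solution_on \<iota> (ts n) (ts (Suc n)) (\<lambda>t. - A - Arc t)
             (\<lambda>t. dual_incl \<iota> (control_op \<Phi> (u t)
                + Inj t (Z (in_V \<iota> yh t) - Z (in_V \<iota> y t)))) yh))"

end

theory Submission
  imports Defs
begin

text \<open>
  Put \<open>\<kappa> = T\<inverse> log \<theta>\<inverse>\<close>. One step of the algorithm leads from time \<open>t\<close> to time \<open>t'\<close>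
  and from the estimate \<open>yh(t)\<close> to \<open>yh(t') = y\<^sub>T(t') + e(t')\<close>, where \<open>y\<^sub>T\<close> is the optimal
  prediction and \<open>e\<close> the deviation of the estimate from it. The choice of \<open>t'\<close> makes the first summand at most \<open>\<theta> |yh(t)|\<close>, which is at most
  \<open>exp (- \<kappa> (t' - t)) |yh(t)|\<close> because a step is no longer than \<open>T\<close>
  (\<open>horizon_contraction\<close>). Prediction and estimate start at the same state and receive the
  same input, so \<open>e\<close> is driven by the output injection alone and is controlled by the error
  \<open>z(t)\<close> (\<open>estimate_deviation_bound\<close>). The error itself does not see the input
  (\<open>observer_error_solution\<close>): glued over all steps it is a solution of the stable homogeneous
  observer equation and decays with rate \<open>\<mu>\<^sub>1\<close>. Hence \<open>|yh(t)|\<close> obeys a contraction of rate \<open>\<kappa>\<close>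
  perturbed by a term of rate \<open>\<mu>\<^sub>1\<close>, and it decays with the smaller of the two rates unless they
  coincide (\<open>perturbed_contraction_decay\<close>); a slightly smaller \<open>\<mu>\<^sub>1\<close> avoids the coincidence.
  Between \<open>t\<close> and \<open>t'\<close> the state and the input are bounded by their size at \<open>t\<close>: a stabilizing
  feedback is a competitor of uniformly bounded cost in the finite horizon problem
  (\<open>optimal_pair_bounds\<close>), and the resulting geometric series bounds the input in \<open>L\<^sup>2\<close>.

  All the estimates rest on one energy estimate, uniform in the position of the time interval
  (\<open>forced_energy_estimate\<close>). It needs coercivity of \<open>A\<close>, which follows from completeness of its
  scalar product by a uniform boundedness argument (\<open>complete_scalar_product_coercive\<close>), and
  the identity \<open>|y(b)|\<^sup>2 - |y(a)|\<^sup>2 = 2 \<integral> \<langle>y', y\<rangle>\<close> for the functions in \<open>W\<close> (\<open>energy_identity\<close>). For the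
  latter, distributional derivatives are first rewritten as integral identities
  (\<open>W_deriv_iff_integral\<close>). Then \<open>y\<close> is smoothed in space, not in time, by operators from \<open>H\<close> to \<open>V\<close>
  that are symmetric in \<open>H\<close> (\<open>smoothing_operators\<close>): the smoothed path is continuous with
  values in \<open>V\<close>, where the identity is a limit of Riemann sums.
\<close>

section \<open>Hilbert spaces: representation, iteration, coercivity\<close>

text \<open>
  A minimising sequence of \<open>x \<bullet> x - 2 * f x\<close> is Cauchy by the parallelogram law, and the first
  variation at its limit is the asserted equation.
\<close>

lemma riesz_representation:
  fixes f :: "'a::{real_inner,banach} \<Rightarrow>\<^sub>L real"
  shows "\<exists>x. \<forall>w. f w = x \<bullet> w"
proof -
  define \<phi> where "\<phi> x = x \<bullet> x - 2 * f x" for x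
  have "- (norm f)\<^sup>2 \<le> \<phi> x" for x
  proof -
    have "f x \<le> norm f * norm x" using norm_blinfun[of f x] by simp
    then show ?thesis
      using sum_squares_bound[of "norm f" "norm x"] by (simp add: \<phi>_def flip: power2_norm_eq_inner)
  qed
  then have bdd: "bdd_below (range \<phi>)" unfolding bdd_below_def by blast
  define m where "m = Inf (range \<phi>)"
  have m: "m \<le> \<phi> x" for x unfolding m_def by (rule cInf_lower[OF _ bdd]) simp
  have "\<exists>x. \<phi> x < m + 1 / real (Suc n)" for n
  proof -
    have "Inf (range \<phi>) < m + 1 / real (Suc n)" by (simp add: m_def)
    from cInf_lessD[OF _ this] show ?thesis by auto
  qed
  then obtain X where X: "\<And>n. \<phi> (X n) < m + 1 / real (Suc n)" by metis
  have close: "(norm (x - y))\<^sup>2 \<le> 2 * (\<phi> x - m) + 2 * (\<phi> y - m)" for x y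
  proof -
    have mid: "\<phi> ((1 / 2) *\<^sub>R (x + y)) = (x \<bullet> x + 2 * (x \<bullet> y) + y \<bullet> y) / 4 - (f x + f y)"
      by (simp add: \<phi>_def blinfun.scaleR_right blinfun.add_right inner_simps inner_commute add_divide_distrib)
    have "(norm (x - y))\<^sup>2 = x \<bullet> x - 2 * (x \<bullet> y) + y \<bullet> y"
      by (simp add: power2_norm_eq_inner inner_simps inner_commute)
    then show ?thesis
      using m[of "(1 / 2) *\<^sub>R (x + y)", unfolded mid] by (simp add: \<phi>_def field_simps)
  qed
  have "Cauchy X"
  proof (rule CauchyI)
    fix e :: real assume e: "e > 0"
    then obtain N where N: "1 / real (Suc N) < e\<^sup>2 / 4"
      using reals_Archimedean[of "e\<^sup>2 / 4"] by (auto simp: inverse_eq_divide)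
    have small: "4 * (\<phi> (X n) - m) < e\<^sup>2" if "n \<ge> N" for n
    proof -
      have "1 / real (Suc n) \<le> 1 / real (Suc N)" using that by (auto simp: field_simps)
      then have "\<phi> (X n) - m < e\<^sup>2 / 4" using X[of n] N by linarith
      then show ?thesis by simp
    qed
    have "norm (X i - X j) < e" if "i \<ge> N" "j \<ge> N" for i j
    proof -
      have "(norm (X i - X j))\<^sup>2 < e\<^sup>2"
        using close[of "X i" "X j"] small[OF that(1)] small[OF that(2)] by linarith
      then show ?thesis using e by (simp add: power_less_imp_less_base)
    qed
    then show "\<exists>M. \<forall>i\<ge>M. \<forall>j\<ge>M. norm (X i - X j) < e" by blast
  qed
  then obtain x where x: "X \<longlonglongrightarrow> x" using Cauchy_convergent_iff convergent_def by blast
  have "\<phi> x \<le> m"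
  proof (rule LIMSEQ_le)
    show "(\<lambda>n. \<phi> (X n)) \<longlonglongrightarrow> \<phi> x" unfolding \<phi>_def by (intro tendsto_intros x)
    show "(\<lambda>n. m + 1 / real (Suc n)) \<longlonglongrightarrow> m"
      using tendsto_add[OF tendsto_const LIMSEQ_Suc[OF lim_1_over_n], of m] by simp
    show "\<exists>N. \<forall>n\<ge>N. \<phi> (X n) \<le> m + 1 / real (Suc n)" using X by (auto intro: less_imp_le)
  qed
  have "f w = x \<bullet> w" for w
  proof -
    define b where "b = x \<bullet> w - f w"
    define c where "c = w \<bullet> w + 1"
    have c: "c > 0" by (simp add: c_def add_nonneg_pos)
    have "\<phi> (x + s *\<^sub>R w) = \<phi> x + 2 * s * b + s\<^sup>2 * (w \<bullet> w)" for s
      by (simp add: \<phi>_def b_def blinfun.add_right blinfun.scaleR_right inner_simps inner_commute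
          power2_eq_square algebra_simps)
    then have "0 \<le> 2 * s * b + s\<^sup>2 * (w \<bullet> w)" for s
      using m[of "x + s *\<^sub>R w"] \<open>\<phi> x \<le> m\<close> by simp
    from this[of "- b / c"] have "0 \<le> 2 * (- b / c) * b + (- b / c)\<^sup>2 * (c - 1)" by (simp add: c_def)
    also have "\<dots> \<le> 2 * (- b / c) * b + (- b / c)\<^sup>2 * c"
      by (intro add_left_mono mult_left_mono) auto
    also have "\<dots> = - (b\<^sup>2 / c)" using c by (simp add: power2_eq_square field_simps)
    finally have "b\<^sup>2 \<le> 0" using c by (simp add: divide_le_0_iff)
    then show ?thesis by (simp add: b_def)
  qed
  then show ?thesis by blast
qed

lemma bounded_form_representation:
  fixes A :: "'b::real_normed_vector \<Rightarrow>\<^sub>L ('v::{real_inner,banach} \<Rightarrow>\<^sub>L real)"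
  shows "\<exists>T :: 'b \<Rightarrow>\<^sub>L 'v. \<forall>z w. A z w = T z \<bullet> w"
proof -
  have "\<forall>z. \<exists>x. \<forall>w. A z w = x \<bullet> w" using riesz_representation by blast
  then obtain G where G: "\<And>z w. A z w = G z \<bullet> w" by metis
  have "bounded_linear G"
  proof (rule bounded_linear_intro[where K = "norm A"])
    show "G (x + y) = G x + G y" for x y
      by (rule vector_eq_rdot[THEN iffD1])
        (auto simp: inner_add_left blinfun.bilinear_simps simp flip: G)
    show "G (r *\<^sub>R x) = r *\<^sub>R G x" for r x
      by (rule vector_eq_rdot[THEN iffD1]) (auto simp: blinfun.bilinear_simps simp flip: G)
    show "norm (G y) \<le> norm y * norm A" for y
    proof -
      have "(norm (G y))\<^sup>2 = A y (G y)" by (simp add: power2_norm_eq_inner G)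
      also have "\<dots> \<le> norm (A y) * norm (G y)" using norm_blinfun[of "A y" "G y"] by simp
      also have "\<dots> \<le> (norm A * norm y) * norm (G y)" by (intro mult_right_mono norm_blinfun) auto
      finally have "norm (G y) * norm (G y) \<le> (norm y * norm A) * norm (G y)"
        by (simp add: power2_eq_square mult_ac)
      then show ?thesis by (cases "G y = 0") (auto simp: mult_le_cancel_right)
    qed
  qed
  then show ?thesis using G by (intro exI[of _ "Blinfun G"]) (simp add: bounded_linear_Blinfun_apply)
qed

lemma ex_adjoint:
  fixes f :: "'a::{real_inner,banach} \<Rightarrow>\<^sub>L 'b::real_inner"
  shows "\<exists>g :: 'b \<Rightarrow>\<^sub>L 'a. \<forall>x y. g y \<bullet> x = y \<bullet> f x"
  using bounded_form_representation[of "dual_incl f"] by auto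

text \<open>
  As \<open>S\<close> is self-adjoint, the inner product of \<open>S\<^sup>m x\<close> and \<open>S\<^sup>n x\<close> depends on \<open>m + n\<close> only. So the
  squared distance of two even powers is a second difference of the decreasing sequence
  \<open>|S\<^sup>n x|\<^sup>2\<close>, and the even powers converge. Their limit is fixed by \<open>S\<^sup>2\<close>, and positivity excludes
  the eigenvalue \<open>-1\<close>.
\<close>

lemma tendsto_power_contraction_zero:
  fixes S :: "'a::{real_inner,banach} \<Rightarrow>\<^sub>L 'a"
  assumes sym: "\<And>x y. S x \<bullet> y = x \<bullet> S y"
    and pos: "\<And>x. S x \<bullet> x \<ge> 0"
    and contr: "\<And>x. norm (S x) \<le> norm x"
    and fix0: "\<And>x. S x = x \<Longrightarrow> x = 0"
  shows "(\<lambda>n. (blinfun_apply S ^^ n) x) \<longlonglongrightarrow> 0"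
proof -
  define p where "p n = (blinfun_apply S ^^ n) x" for n
  have pS: "p (Suc n) = S (p n)" for n by (simp add: p_def)
  have ip: "p (m + k) \<bullet> p n = p m \<bullet> p (k + n)" for m n k
  proof (induction k arbitrary: n)
    case (Suc k)
    have "p (m + Suc k) \<bullet> p n = p (m + k) \<bullet> p (Suc n)" by (simp add: pS sym)
    then show ?case by (simp add: Suc)
  qed simp
  define b where "b n = (norm (p n))\<^sup>2" for n
  have dec: "norm (p (Suc n)) \<le> norm (p n)" for n by (simp add: pS contr)
  have decb: "decseq b"
    unfolding b_def by (intro decseq_SucI power_mono dec) simp
  then obtain l where l: "b \<longlonglongrightarrow> l"
    using decseq_convergent[OF decb, of 0] by (metis b_def zero_le_power2)
  have diff: "(norm (p (2 * m) - p (2 * n)))\<^sup>2 = b (2 * m) + b (2 * n) - 2 * b (m + n)" for m n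
  proof -
    have "p (2 * m) \<bullet> p (2 * n) = p (m + n) \<bullet> p (m + n)"
    proof (cases "m \<le> n")
      case True
      then show ?thesis using ip[of "2 * m" "n - m" "m + n"] by (simp add: mult_2 add.commute)
    next
      case False
      then show ?thesis using ip[of "m + n" "m - n" "2 * n"] by (simp add: mult_2 add.commute)
    qed
    then show ?thesis
      by (simp add: b_def power2_norm_eq_inner inner_diff inner_commute)
  qed
  have "Cauchy (\<lambda>n. p (2 * n))"
  proof (rule CauchyI)
    fix e :: real assume e: "e > 0"
    then obtain N where N: "\<And>n. n \<ge> N \<Longrightarrow> \<bar>b n - l\<bar> < e\<^sup>2 / 4"
      using LIMSEQ_D[OF l, of "e\<^sup>2 / 4"] by auto
    have "norm (p (2 * m) - p (2 * n)) < e" if "N \<le> m" "N \<le> n" for m n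
    proof -
      have "\<bar>b (2 * m) - l\<bar> < e\<^sup>2 / 4" "\<bar>b (2 * n) - l\<bar> < e\<^sup>2 / 4" "\<bar>b (m + n) - l\<bar> < e\<^sup>2 / 4"
        using that by (intro N; simp)+
      then have "(norm (p (2 * m) - p (2 * n)))\<^sup>2 < e\<^sup>2" unfolding diff by linarith
      then show ?thesis using e by (simp add: power_less_imp_less_base)
    qed
    then show "\<exists>M. \<forall>m\<ge>M. \<forall>n\<ge>M. norm (p (2 * m) - p (2 * n)) < e" by blast
  qed
  then obtain q where q: "(\<lambda>n. p (2 * n)) \<longlonglongrightarrow> q" using Cauchy_convergent_iff convergent_def by blast
  have "(\<lambda>n. S (S (p (2 * n)))) \<longlonglongrightarrow> S (S q)" by (intro tendsto_intros q)
  moreover have "(\<lambda>n. S (S (p (2 * n)))) \<longlonglongrightarrow> q"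
    using LIMSEQ_Suc[OF q] by (simp add: pS)
  ultimately have SS: "S (S q) = q" using LIMSEQ_unique by blast
  then have "S q + q = 0" by (intro fix0) (simp add: blinfun.add_right)
  then have "S q = - q" by (simp add: eq_neg_iff_add_eq_0)
  then have "q \<bullet> q = 0" using pos[of q] inner_ge_zero[of q] by (intro antisym) simp_all
  then have "q = 0" by simp
  with q have "(\<lambda>n. norm (p (2 * n))) \<longlonglongrightarrow> 0" by (simp add: tendsto_norm_zero)
  then have "(\<lambda>n. (norm (p (2 * n)))\<^sup>2) \<longlonglongrightarrow> 0" using tendsto_power[of "\<lambda>n. norm (p (2 * n))" 0 sequentially 2] by simp
  moreover have "(\<lambda>n. b (2 * n)) \<longlonglongrightarrow> l"
    using LIMSEQ_subseq_LIMSEQ[OF l, of "\<lambda>n. 2 * n"] by (simp add: strict_mono_def o_def)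
  ultimately have "l = 0" unfolding b_def using LIMSEQ_unique by blast
  then have "(\<lambda>n. sqrt (b n)) \<longlonglongrightarrow> sqrt 0" using l by (intro tendsto_real_sqrt) auto
  then have "(\<lambda>n. norm (p n)) \<longlonglongrightarrow> 0" by (simp add: b_def)
  then show ?thesis by (simp add: p_def tendsto_norm_zero_iff)
qed

text \<open>
  The powers of \<open>1 - c N\<close> are the residuals of Landweber's iteration for the equation \<open>N x = y\<close>.
  As \<open>1 - (1 - c N)\<^sup>n\<close> is \<open>N\<close> times a polynomial in \<open>N\<close>, the lemma approximates every vector by
  images under \<open>N\<close> with explicit preimages; it takes the place of the spectral theorem below.
\<close>

lemma landweber_iteration:
  fixes N :: "'a::{real_inner,banach} \<Rightarrow>\<^sub>L 'a"
  assumes sym: "\<And>x y. N x \<bullet> y = x \<bullet> N y"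
    and c: "c > 0" and bound: "\<And>x. c * (norm (N x))\<^sup>2 \<le> N x \<bullet> x"
    and ker: "\<And>x. N x = 0 \<Longrightarrow> x = 0"
  shows "(\<lambda>n. (blinfun_apply (id_blinfun - c *\<^sub>R N) ^^ n) x) \<longlonglongrightarrow> 0"
    and "norm ((blinfun_apply (id_blinfun - c *\<^sub>R N) ^^ n) x) \<le> norm x"
proof -
  let ?S = "id_blinfun - c *\<^sub>R N"
  have S: "?S x = x - c *\<^sub>R N x" for x
    by (simp add: blinfun.diff_left blinfun.scaleR_left)
  have nonneg: "0 \<le> N x \<bullet> x" for x
    using bound[of x] c by (meson mult_nonneg_nonneg order_trans less_imp_le zero_le_power2)
  have Nle: "c * (N x \<bullet> x) \<le> (norm x)\<^sup>2" for x
  proof -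
    have "c * (norm (N x))\<^sup>2 \<le> norm (N x) * norm x"
      using bound[of x] norm_cauchy_schwarz[of "N x" x] by linarith
    then have "c * norm (N x) \<le> norm x"
      by (cases "N x = 0") (auto simp: power2_eq_square mult_le_cancel_right)
    then have "c * norm (N x) * norm x \<le> norm x * norm x" by (intro mult_right_mono) auto
    moreover have "c * (N x \<bullet> x) \<le> c * (norm (N x) * norm x)"
      using c norm_cauchy_schwarz by (intro mult_left_mono) auto
    ultimately show ?thesis by (simp add: power2_eq_square mult_ac)
  qed
  have contr: "norm (?S x) \<le> norm x" for x
  proof -
    have "(norm (?S x))\<^sup>2 = (norm x)\<^sup>2 - 2 * (c * (N x \<bullet> x)) + c * (c * (norm (N x))\<^sup>2)"
      by (simp add: S power2_norm_eq_inner inner_diff inner_commute algebra_simps)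
    also have "\<dots> \<le> (norm x)\<^sup>2 - 2 * (c * (N x \<bullet> x)) + c * (N x \<bullet> x)"
      using bound c by (intro add_left_mono mult_left_mono) auto
    also have "\<dots> \<le> (norm x)\<^sup>2" using nonneg c by simp
    finally show ?thesis by (rule power2_le_imp_le) simp
  qed
  show "(\<lambda>n. (blinfun_apply ?S ^^ n) x) \<longlonglongrightarrow> 0"
  proof (rule tendsto_power_contraction_zero)
    show "?S x \<bullet> y = x \<bullet> ?S y" for x y by (simp add: S inner_diff sym)
    show "?S x \<bullet> x \<ge> 0" for x using Nle[of x] by (simp add: S inner_diff power2_norm_eq_inner)
    show "x = 0" if "?S x = x" for x using that c ker by (simp add: S)
  qed (rule contr)
  show "norm ((blinfun_apply ?S ^^ n) x) \<le> norm x"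
    by (induction n) (auto intro: order_trans[OF contr])
qed

text \<open>
  Landweber's iteration for the normal equation of \<open>f\<close>, whose operator \<open>g o\<^sub>L f\<close> is symmetric
  and nonnegative because \<open>g\<close> is the adjoint of \<open>f\<close>.
\<close>

lemma landweber_normal_equation:
  fixes f :: "'a::{real_inner,banach} \<Rightarrow>\<^sub>L 'b::real_inner" and g :: "'b \<Rightarrow>\<^sub>L 'a"
  assumes g: "\<And>x y. g y \<bullet> x = y \<bullet> f x" and c: "c > 0" "c * (norm g)\<^sup>2 \<le> 1"
    and inj: "\<And>x. f x = 0 \<Longrightarrow> x = 0"
  defines "S \<equiv> id_blinfun - c *\<^sub>R (g o\<^sub>L f)"
  shows "(\<lambda>n. (blinfun_apply S ^^ n) x) \<longlonglongrightarrow> 0" and "norm ((blinfun_apply S ^^ n) x) \<le> norm x"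
    and "S x \<bullet> y = x \<bullet> S y"
proof -
  have sym: "(g o\<^sub>L f) x \<bullet> y = x \<bullet> (g o\<^sub>L f) y" for x y
    using g[of "f x" y] g[of "f y" x] by (simp add: inner_commute)
  have bound: "c * (norm ((g o\<^sub>L f) x))\<^sup>2 \<le> (g o\<^sub>L f) x \<bullet> x" for x
  proof -
    have "(norm (g (f x)))\<^sup>2 \<le> (norm g * norm (f x))\<^sup>2" by (intro power_mono norm_blinfun) simp
    then have "c * (norm (g (f x)))\<^sup>2 \<le> (c * (norm g)\<^sup>2) * (norm (f x))\<^sup>2"
      using c by (simp add: power_mult_distrib)
    also have "\<dots> \<le> 1 * (norm (f x))\<^sup>2" by (intro mult_right_mono c) simp
    finally show ?thesis by (simp add: g power2_norm_eq_inner)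
  qed
  have ker: "x = 0" if "(g o\<^sub>L f) x = 0" for x
    using g[of "f x" x] that inj[of x] by simp
  show "(\<lambda>n. (blinfun_apply S ^^ n) x) \<longlonglongrightarrow> 0" "norm ((blinfun_apply S ^^ n) x) \<le> norm x"
    unfolding S_def using landweber_iteration[of "g o\<^sub>L f" c, OF sym c(1) bound ker] by blast+
  show "S x \<bullet> y = x \<bullet> S y"
    using sym[of x y] by (simp add: S_def blinfun.bilinear_simps inner_diff)
qed

text \<open>
  \<open>B n\<close> is the \<open>n\<close>-th Landweber iterate for \<open>\<iota>\<close>. With \<open>J\<close> the adjoint of \<open>\<iota>\<close>, the residuals of \<open>B n\<close> are the
  powers of \<open>1 - c \<iota> J\<close> on \<open>H\<close> and of \<open>1 - c J \<iota>\<close> on \<open>V\<close>, which both tend to zero. These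
  operators turn a path that is continuous in \<open>H\<close> into one that is continuous in \<open>V\<close>.
\<close>

lemma smoothing_operators:
  fixes \<iota> :: "'v::{real_inner,banach} \<Rightarrow>\<^sub>L 'h::{real_inner,banach}"
  assumes inj: "inj (blinfun_apply \<iota>)" and dense: "closure (range (blinfun_apply \<iota>)) = UNIV"
  shows "\<exists>B :: nat \<Rightarrow> 'h \<Rightarrow>\<^sub>L 'v. (\<forall>n h k. h \<bullet> \<iota> (B n k) = \<iota> (B n h) \<bullet> k) \<and>
    (\<forall>h. (\<lambda>n. \<iota> (B n h)) \<longlonglongrightarrow> h) \<and> (\<forall>v. (\<lambda>n. B n (\<iota> v)) \<longlonglongrightarrow> v) \<and>
    (\<forall>n v. norm (B n (\<iota> v)) \<le> 2 * norm v)"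
proof -
  obtain J :: "'h \<Rightarrow>\<^sub>L 'v" where J: "\<And>x y. J y \<bullet> x = y \<bullet> \<iota> x" using ex_adjoint by blast
  then have J': "\<iota> x \<bullet> y = x \<bullet> J y" for x y by (metis inner_commute)
  define c where "c = 1 / ((norm \<iota>)\<^sup>2 + (norm J)\<^sup>2 + 1)"
  have den: "(norm \<iota>)\<^sup>2 + (norm J)\<^sup>2 + 1 > 0" by (simp add: add_nonneg_pos)
  have c: "c > 0" "c * (norm J)\<^sup>2 \<le> 1" "c * (norm \<iota>)\<^sup>2 \<le> 1" using den by (simp_all add: c_def)
  have i0: "x = 0" if "\<iota> x = 0" for x
    using inj that by (metis blinfun.zero_right injD)
  have J0: "y = 0" if "J y = 0" for y
  proof -
    have *: "y \<bullet> \<iota> x = 0" for x using J[of y x] that by simp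
    have "closed {z. y \<bullet> z = 0}" by (intro closed_Collect_eq continuous_intros)
    moreover have "range (blinfun_apply \<iota>) \<subseteq> {z. y \<bullet> z = 0}" using * by auto
    ultimately have "closure (range (blinfun_apply \<iota>)) \<subseteq> {z. y \<bullet> z = 0}"
      by (simp add: closure_minimal)
    then have "y \<in> {z. y \<bullet> z = 0}" using dense by blast
    then show ?thesis by simp
  qed
  define S where "S = id_blinfun - c *\<^sub>R (J o\<^sub>L \<iota>)"
  define R where "R = id_blinfun - c *\<^sub>R (\<iota> o\<^sub>L J)"
  note S0 = landweber_normal_equation[where f = \<iota> and g = J, OF J c(1,2) i0, folded S_def]
    and R0 = landweber_normal_equation[where f = J and g = \<iota>, OF J' c(1,3) J0, folded R_def]
  define B :: "nat \<Rightarrow> 'h \<Rightarrow>\<^sub>L 'v" where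
    "B = rec_nat 0 (\<lambda>_ b. b + c *\<^sub>R (J - (J o\<^sub>L \<iota> o\<^sub>L b)))"
  have B0: "B 0 = 0" and BS: "B (Suc n) = B n + c *\<^sub>R (J - (J o\<^sub>L \<iota> o\<^sub>L B n))" for n
    by (simp_all add: B_def)
  have \<iota>B: "\<iota> (B n h) = h - (blinfun_apply R ^^ n) h" for n h
  proof (induction n)
    case (Suc n)
    have "\<iota> (B (Suc n) h) = \<iota> (B n h) + c *\<^sub>R \<iota> (J (h - \<iota> (B n h)))"
      by (simp add: BS blinfun.bilinear_simps)
    also have "\<dots> = h - (blinfun_apply R ^^ Suc n) h"
      unfolding Suc by (simp add: R_def blinfun.bilinear_simps)
    finally show ?case .
  qed (simp add: B0)
  have B\<iota>: "B n (\<iota> v) = v - (blinfun_apply S ^^ n) v" for n v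
  proof (induction n)
    case (Suc n)
    have "B (Suc n) (\<iota> v) = B n (\<iota> v) + c *\<^sub>R J (\<iota> (v - B n (\<iota> v)))"
      by (simp add: BS blinfun.bilinear_simps)
    also have "\<dots> = v - (blinfun_apply S ^^ Suc n) v"
      unfolding Suc by (simp add: S_def blinfun.bilinear_simps)
    finally show ?case .
  qed (simp add: B0)
  have symR: "(blinfun_apply R ^^ n) h \<bullet> k = h \<bullet> (blinfun_apply R ^^ n) k" for n h k
  proof (induction n arbitrary: k)
    case (Suc n)
    have "(blinfun_apply R ^^ Suc n) h \<bullet> k = h \<bullet> (blinfun_apply R ^^ n) (R k)"
      using Suc[of "R k"] R0(3) by simp
    then show ?case by (simp add: funpow_swap1)
  qed simp
  show ?thesis
  proof (intro exI[of _ B] conjI allI)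
    show "h \<bullet> \<iota> (B n k) = \<iota> (B n h) \<bullet> k" for n h k
      by (simp add: \<iota>B inner_diff symR)
    show "(\<lambda>n. \<iota> (B n h)) \<longlonglongrightarrow> h" for h
      unfolding \<iota>B using tendsto_diff[OF tendsto_const R0(1), of h h] by simp
    show "(\<lambda>n. B n (\<iota> v)) \<longlonglongrightarrow> v" for v
      unfolding B\<iota> using tendsto_diff[OF tendsto_const S0(1), of v v] by simp
    show "norm (B n (\<iota> v)) \<le> 2 * norm v" for n v
      unfolding B\<iota> using norm_triangle_ineq4[of v "(blinfun_apply S ^^ n) v"] S0(2)[of n v] by simp
  qed
qed


text \<open>
  This is the bounded inverse theorem for the identity map from \<open>V\<close> to \<open>V\<close> with the energy norm.
  The functionals \<open>A z\<close> with \<open>norm (A z) \<le> 1\<close> are bounded at each point \<open>x\<close> by \<open>norm x\<close>, so they are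
  uniformly bounded in the dual of the energy norm. This uniform boundedness is proved by a
  gliding hump: otherwise there are vectors \<open>\<eta> n\<close> of energy norm \<open>1\<close> for which \<open>A (\<eta> n)\<close> is so
  small in the dual of \<open>V\<close> that no point of \<open>V\<close> can be the energy limit of a series of terms
  \<open>\<plusminus> \<eta> n / 3 ^ n\<close> with suitably chosen signs. The bound obtained for the functionals is
  carried over to vectors by Landweber's iteration, which approximates each \<open>y\<close> by representers of functionals \<open>A z\<close>.
\<close>

lemma complete_scalar_product_coercive:
  fixes A :: "'v::{real_inner,banach} \<Rightarrow>\<^sub>L ('v \<Rightarrow>\<^sub>L real)"
  assumes "complete_scalar_product A"
  shows "\<exists>c>0. \<forall>v. c * (norm v)\<^sup>2 \<le> A v v"
proof -
  have sym: "A x y = A y x" for x y using assms unfolding complete_scalar_product_def by blast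
  have pos: "x \<noteq> 0 \<Longrightarrow> 0 < A x x" for x using assms unfolding complete_scalar_product_def by blast
  have nn: "0 \<le> A x x" for x using pos[of x] by (cases "x = 0") auto
  define na where "na x = sqrt (A x x)" for x
  have na_nn: "0 \<le> na x" and na_sq: "(na x)\<^sup>2 = A x x" for x using nn by (simp_all add: na_def)
  have complete: "\<exists>l. (\<lambda>n. na (x n - l)) \<longlonglongrightarrow> 0"
    if "\<forall>e>0. \<exists>N. \<forall>m\<ge>N. \<forall>n\<ge>N. na (x m - x n) < e" for x :: "nat \<Rightarrow> 'v"
    using assms that unfolding complete_scalar_product_def na_def by blast
  have CS: "\<bar>A x y\<bar> \<le> na x * na y" for x y
  proof (cases "y = 0")
    case False
    define s where "s = A x y / A y y"
    have p: "A y y > 0" using False pos by simp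
    have "0 \<le> A (x - s *\<^sub>R y) (x - s *\<^sub>R y)" by (rule nn)
    also have "\<dots> = A x x - 2 * s * A x y + s * s * A y y"
      by (simp add: blinfun.bilinear_simps sym[of y x] algebra_simps)
    also have "\<dots> = A x x - (A x y)\<^sup>2 / A y y"
      using p by (simp add: s_def power2_eq_square field_simps)
    finally have "(A x y)\<^sup>2 \<le> A x x * A y y" using p by (simp add: field_simps)
    then have "\<bar>A x y\<bar>\<^sup>2 \<le> (na x * na y)\<^sup>2" by (simp add: power_mult_distrib na_sq)
    then show ?thesis by (rule power2_le_imp_le) (simp add: na_nn)
  qed (simp add: na_def)
  have tri: "na (x + y) \<le> na x + na y" for x y
  proof (rule power2_le_imp_le)
    have "(na (x + y))\<^sup>2 = A x x + 2 * A x y + A y y"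
      by (simp add: na_sq blinfun.bilinear_simps sym[of y x])
    also have "\<dots> \<le> A x x + 2 * (na x * na y) + A y y" using CS[of x y] by simp
    also have "\<dots> = (na x + na y)\<^sup>2" by (simp add: power2_sum na_sq)
    finally show "(na (x + y))\<^sup>2 \<le> (na x + na y)\<^sup>2" .
  qed (simp add: na_nn)
  have na_scale: "na (r *\<^sub>R x) = \<bar>r\<bar> * na x" for r x
    by (simp add: na_def blinfun.bilinear_simps real_sqrt_mult flip: mult.assoc)
  have na_minus: "na (x - y) = na (y - x)" for x y
    using na_scale[of "-1" "x - y"] by simp

  have "\<exists>K. \<forall>z. na z \<le> K * norm (A z)"
  proof (rule ccontr)
    assume "\<not> ?thesis"
    then have "\<forall>n. \<exists>z. na z > 4 ^ n * norm (A z)" by (auto simp: not_le)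
    then obtain Z where Z: "\<And>n. na (Z n) > 4 ^ n * norm (A (Z n))" by metis
    have Zp: "na (Z n) > 0" for n
      by (rule le_less_trans[OF _ Z]) simp
    define \<eta> where "\<eta> n = inverse (na (Z n)) *\<^sub>R Z n" for n
    have \<eta>1: "na (\<eta> n) = 1" for n using Zp[of n] by (simp add: \<eta>_def na_scale)
    have small: "\<bar>A (\<eta> n) x\<bar> \<le> norm x / 4 ^ n" for n x
    proof -
      have "\<bar>A (Z n) x\<bar> \<le> norm (A (Z n)) * norm x" using norm_blinfun[of "A (Z n)" x] by simp
      also have "\<dots> \<le> (na (Z n) / 4 ^ n) * norm x"
        using Z[of n] by (intro mult_right_mono) (auto simp: field_simps)
      finally show ?thesis
        using Zp[of n] by (simp add: \<eta>_def blinfun.bilinear_simps abs_mult field_simps)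
    qed
    \<comment> \<open>The sign keeps each new term from cancelling what the earlier terms contribute to \<open>A (\<eta> n)\<close>.\<close>
    define X where "X = rec_nat 0
      (\<lambda>n x. x + ((if A (\<eta> n) x \<ge> 0 then 1 else - 1) * (1 / 3 ^ n)) *\<^sub>R \<eta> n)"
    define \<sigma> :: "nat \<Rightarrow> real" where "\<sigma> n = (if A (\<eta> n) (X n) \<ge> 0 then 1 else - 1)" for n
    have XS: "X (Suc n) = X n + (\<sigma> n * (1 / 3 ^ n)) *\<^sub>R \<eta> n" for n by (simp add: X_def \<sigma>_def)
    have low: "1 / 3 ^ n \<le> \<bar>A (\<eta> n) (X (Suc n))\<bar>" for n
    proof -
      have "A (\<eta> n) (\<eta> n) = 1" using \<eta>1[of n] na_sq[of "\<eta> n"] by simp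
      then have "A (\<eta> n) (X (Suc n)) = A (\<eta> n) (X n) + \<sigma> n * (1 / 3 ^ n)"
        by (simp add: XS blinfun.bilinear_simps)
      then show ?thesis by (auto simp: \<sigma>_def abs_if)
    qed
    have step: "na (X (n + k) - X n) \<le> 3 / 2 * (1 / 3 ^ n - 1 / 3 ^ (n + k))" for n k
    proof (induction k)
      case (Suc k)
      have "na (X (n + Suc k) - X n) = na ((X (n + k) - X n) + (\<sigma> (n + k) * (1 / 3 ^ (n + k))) *\<^sub>R \<eta> (n + k))"
        by (simp add: XS algebra_simps)
      also have "\<dots> \<le> na (X (n + k) - X n) + 1 / 3 ^ (n + k)"
        by (rule order_trans[OF tri]) (simp add: na_scale \<eta>1 abs_mult \<sigma>_def)
      also have "\<dots> \<le> 3 / 2 * (1 / 3 ^ n - 1 / 3 ^ (n + k)) + 1 / 3 ^ (n + k)" using Suc by simp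
      also have "\<dots> = 3 / 2 * (1 / 3 ^ n - 1 / 3 ^ (n + Suc k))" by (simp add: field_simps)
      finally show ?case .
    qed (simp add: na_def)
    have near: "na (X m - X n) \<le> 3 / 2 * (1 / 3 ^ n)" if "n \<le> m" for m n
    proof -
      have "na (X m - X n) \<le> 3 / 2 * (1 / 3 ^ n - 1 / 3 ^ m)" using step[of n "m - n"] that by simp
      also have "\<dots> \<le> 3 / 2 * (1 / 3 ^ n)" by simp
      finally show ?thesis .
    qed
    have "\<exists>l. (\<lambda>n. na (X n - l)) \<longlonglongrightarrow> 0"
    proof (rule complete, intro allI impI)
      fix e :: real assume e: "e > 0"
      have "(\<lambda>n. (1 / 3) ^ n) \<longlonglongrightarrow> (0 :: real)" by (rule LIMSEQ_realpow_zero) auto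
      then obtain N where N: "(1 / 3 :: real) ^ N < e / 3"
        using e LIMSEQ_D[of "\<lambda>n. (1 / 3 :: real) ^ n" 0 "e / 3"] by auto
      have "na (X m - X n) < e" if "N \<le> m" "N \<le> n" for m n
      proof -
        have "na (X m - X n) \<le> na (X m - X N) + na (X N - X n)"
          using tri[of "X m - X N" "X N - X n"] by simp
        also have "\<dots> \<le> 3 / 2 * (1 / 3 ^ N) + 3 / 2 * (1 / 3 ^ N)"
          using near[of N m] near[of N n] that na_minus[of "X N" "X n"] by (intro add_mono) auto
        also have "\<dots> < e" using N by (simp add: power_one_over)
        finally show ?thesis .
      qed
      then show "\<exists>N. \<forall>m\<ge>N. \<forall>n\<ge>N. na (X m - X n) < e" by blast
    qed
    then obtain l where l: "(\<lambda>n. na (X n - l)) \<longlonglongrightarrow> 0" by blast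
    have tail: "na (l - X n) \<le> 3 / 2 * (1 / 3 ^ n)" for n
    proof (rule LIMSEQ_le_const)
      show "(\<lambda>m. na (X m - l) + 3 / 2 * (1 / 3 ^ n)) \<longlonglongrightarrow> 3 / 2 * (1 / 3 ^ n)"
        using tendsto_add[OF l tendsto_const[of "3 / 2 * (1 / 3 ^ n)"]] by simp
      have "na (l - X n) \<le> na (X m - l) + 3 / 2 * (1 / 3 ^ n)" if "n \<le> m" for m
        using tri[of "l - X m" "X m - X n"] near[OF that] na_minus[of l "X m"] by simp
      then show "\<exists>N. \<forall>m\<ge>N. na (l - X n) \<le> na (X m - l) + 3 / 2 * (1 / 3 ^ n)" by blast
    qed
    \<comment> \<open>The tail of the series beyond the \<open>n\<close>-th term has at most half the energy norm of that term.\<close>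
    have "(4 / 3) ^ n \<le> 2 * norm l" for n
    proof -
      have "1 / 3 ^ n \<le> \<bar>A (\<eta> n) (X (Suc n))\<bar>" by (rule low)
      also have "\<dots> \<le> \<bar>A (\<eta> n) l\<bar> + \<bar>A (\<eta> n) (l - X (Suc n))\<bar>" by (simp add: blinfun.diff_right)
      also have "\<bar>A (\<eta> n) (l - X (Suc n))\<bar> \<le> 1 * (3 / 2 * (1 / 3 ^ Suc n))"
        by (rule order_trans[OF CS]) (unfold \<eta>1, intro mult_left_mono tail, simp)
      finally have "1 / 2 * (1 / 3 ^ n) \<le> \<bar>A (\<eta> n) l\<bar>" by simp
      also have "\<dots> \<le> norm l / 4 ^ n" by (rule small)
      finally show ?thesis by (simp add: field_simps)
    qed
    moreover obtain n where "2 * norm l < (4 / 3) ^ n" using real_arch_pow[of "4 / 3"] by auto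
    ultimately show False using not_less by blast
  qed
  then obtain K0 where K0: "\<And>z. na z \<le> K0 * norm (A z)" by blast
  define K where "K = \<bar>K0\<bar> + 1"
  have Kp: "K > 0" by (simp add: K_def)
  have K: "na z \<le> K * norm (A z)" for z
    by (rule order_trans[OF K0]) (auto intro!: mult_right_mono simp: K_def)

  obtain T :: "'v \<Rightarrow>\<^sub>L 'v" where T: "\<And>z w. A z w = T z \<bullet> w" using bounded_form_representation by blast
  have AT: "norm (A z) \<le> norm (T z)" for z
  proof (rule norm_blinfun_bound)
    show "norm (A z w) \<le> norm (T z) * norm w" for w
      unfolding T by (simp add: Cauchy_Schwarz_ineq2)
  qed simp
  define c where "c = 1 / (norm A + 1)"
  have nA: "norm A + 1 > 0" by (simp add: add_nonneg_pos)
  have c: "c > 0" using nA by (simp add: c_def)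
  have symT: "T x \<bullet> y = x \<bullet> T y" for x y by (metis T inner_commute sym)
  have boundT: "c * (norm (T x))\<^sup>2 \<le> T x \<bullet> x" for x
  proof (cases "T x = 0")
    case False
    have "(norm (T x))\<^sup>2 = \<bar>A x (T x)\<bar>" by (simp add: T power2_norm_eq_inner)
    also have "\<dots> \<le> na x * na (T x)" by (rule CS)
    finally have "((norm (T x))\<^sup>2)\<^sup>2 \<le> (na x * na (T x))\<^sup>2" by (intro power_mono) auto
    also have "\<dots> = A x x * A (T x) (T x)" by (simp add: power_mult_distrib na_sq)
    also have "\<dots> \<le> A x x * ((norm A + 1) * (norm (T x))\<^sup>2)"
    proof (intro mult_left_mono nn)
      have "A (T x) (T x) \<le> norm (A (T x)) * norm (T x)" using norm_blinfun[of "A (T x)" "T x"] by simp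
      also have "\<dots> \<le> (norm A * norm (T x)) * norm (T x)" by (intro mult_right_mono norm_blinfun) auto
      also have "\<dots> \<le> (norm A + 1) * (norm (T x))\<^sup>2"
        by (simp add: power2_eq_square algebra_simps)
      finally show "A (T x) (T x) \<le> (norm A + 1) * (norm (T x))\<^sup>2" .
    qed
    finally have "(norm (T x))\<^sup>2 * (norm (T x))\<^sup>2 \<le> (A x x * (norm A + 1)) * (norm (T x))\<^sup>2"
      by (simp add: power2_eq_square mult_ac)
    then have "(norm (T x))\<^sup>2 \<le> A x x * (norm A + 1)"
      by (rule mult_right_le_imp_le) (simp add: False)
    then show ?thesis using nA by (simp add: c_def T field_simps)
  qed simp
  have kerT: "x = 0" if "T x = 0" for x
    using T[of x x] that pos[of x] by (cases "x = 0") auto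
  define S where "S = id_blinfun - c *\<^sub>R T"
  have S0: "(\<lambda>n. (blinfun_apply S ^^ n) x) \<longlonglongrightarrow> 0" for x
    using landweber_iteration(1)[of T c x, folded S_def] symT c boundT kerT by blast
  have range: "\<exists>z. y - (blinfun_apply S ^^ n) y = T z" for n y
  proof (induction n)
    case (Suc n)
    then obtain z where "y - (blinfun_apply S ^^ n) y = T z" by blast
    then have "y - (blinfun_apply S ^^ Suc n) y = T (z + c *\<^sub>R (blinfun_apply S ^^ n) y)"
      by (simp add: S_def blinfun.bilinear_simps algebra_simps)
    then show ?case by blast
  qed (auto intro: exI[of _ 0])
  have main: "(norm y)\<^sup>2 \<le> K * norm y * na y" for y
  proof -
    define r where "r n = y - (blinfun_apply S ^^ n) y" for n
    have r: "r \<longlonglongrightarrow> y" unfolding r_def using tendsto_diff[OF tendsto_const S0, of y y] by simp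
    have "r n \<bullet> y \<le> K * norm (r n) * na y" for n
    proof -
      obtain z where z: "r n = T z" using range r_def by metis
      have "r n \<bullet> y \<le> na z * na y" using CS[of z y] by (simp add: z T)
      also have "\<dots> \<le> (K * norm (T z)) * na y"
        using K[of z] AT[of z] Kp by (intro mult_right_mono na_nn) (meson mult_left_mono less_imp_le order_trans)
      finally show ?thesis by (simp add: z)
    qed
    moreover have "(\<lambda>n. r n \<bullet> y) \<longlonglongrightarrow> y \<bullet> y" by (intro tendsto_intros r)
    moreover have "(\<lambda>n. K * norm (r n) * na y) \<longlonglongrightarrow> K * norm y * na y" by (intro tendsto_intros r)
    ultimately have "y \<bullet> y \<le> K * norm y * na y" by (intro LIMSEQ_le) auto
    then show ?thesis by (simp add: power2_norm_eq_inner)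
  qed
  have "1 / K\<^sup>2 * (norm y)\<^sup>2 \<le> A y y" for y
  proof (cases "y = 0")
    case False
    have "norm y * norm y \<le> (K * na y) * norm y" using main[of y] by (simp add: power2_eq_square mult_ac)
    then have "norm y \<le> K * na y" using False by simp
    then have "(norm y)\<^sup>2 \<le> (K * na y)\<^sup>2" by (intro power_mono) auto
    then show ?thesis using Kp by (simp add: power_mult_distrib na_sq field_simps)
  qed simp
  then show ?thesis using Kp by (intro exI[of _ "1 / K\<^sup>2"]) auto
qed

section \<open>Smooth steps and scalar weak derivatives\<close>

definition smooth_fun :: "(real \<Rightarrow> real) \<Rightarrow> bool" where
  "smooth_fun f \<longleftrightarrow> (\<forall>n. (deriv ^^ n) f differentiable_on UNIV)"

lemma smooth_funD:
  assumes "smooth_fun f"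
  shows "((deriv ^^ n) f has_real_derivative (deriv ^^ Suc n) f x) (at x)"
  using assms unfolding smooth_fun_def
  by (metis DERIV_deriv_iff_real_differentiable UNIV_I at_within_open differentiable_on_def
      funpow.simps(2) o_apply open_UNIV)

lemma smooth_funI:
  assumes "f 0 = g" "\<And>n x. (f n has_real_derivative f (Suc n) x) (at x)"
  shows "smooth_fun g"
proof -
  have "(deriv ^^ n) g = f n" for n
  proof (induction n)
    case (Suc n)
    have "deriv (f n) = f (Suc n)" using assms(2) by (intro ext DERIV_imp_deriv)
    then show ?case using Suc by simp
  qed (simp add: assms)
  then show ?thesis
    using assms(2) unfolding smooth_fun_def differentiable_on_def
    by (metis UNIV_I at_within_open open_UNIV real_differentiable_def)
qed

lemma smooth_fun_affine:
  assumes "smooth_fun f"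
  shows "smooth_fun (\<lambda>x. f (c * x + d))"
proof (rule smooth_funI)
  show "(\<lambda>x. c ^ 0 * (deriv ^^ 0) f (c * x + d)) = (\<lambda>x. f (c * x + d))" by simp
  show "((\<lambda>x. c ^ n * (deriv ^^ n) f (c * x + d)) has_real_derivative
          c ^ Suc n * (deriv ^^ Suc n) f (c * x + d)) (at x)" for n x
    by (rule derivative_eq_intros DERIV_chain2[OF smooth_funD[OF assms]] refl | simp)+
qed

lemma smooth_fun_diff:
  assumes "smooth_fun f" "smooth_fun g"
  shows "smooth_fun (\<lambda>x. f x - g x)"
proof (rule smooth_funI)
  show "(\<lambda>x. (deriv ^^ 0) f x - (deriv ^^ 0) g x) = (\<lambda>x. f x - g x)" by simp
  show "((\<lambda>x. (deriv ^^ n) f x - (deriv ^^ n) g x) has_real_derivative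
          (deriv ^^ Suc n) f x - (deriv ^^ Suc n) g x) (at x)" for n x
    by (intro derivative_intros smooth_funD assms)
qed

text \<open>
  The polynomial \<open>1\<close> gives the classical function that is flat at \<open>0\<close>; with all polynomials
  the family is closed under differentiation.
\<close>

definition flat_exp :: "real poly \<Rightarrow> real \<Rightarrow> real" where
  "flat_exp p x = (if x > 0 then poly p (1 / x) * exp (- 1 / x) else 0)"

lemma poly_times_exp_minus_tendsto_0: "((\<lambda>y. poly p y * exp (- y)) \<longlongrightarrow> 0) (at_top :: real filter)"
proof -
  have *: "((\<lambda>y. coeff p i * (y ^ i / exp y)) \<longlongrightarrow> coeff p i * 0) (at_top :: real filter)" for i
    by (intro tendsto_mult tendsto_const tendsto_power_div_exp_0)
  have "((\<lambda>y. \<Sum>i\<le>degree p. coeff p i * (y ^ i / exp y)) \<longlongrightarrow> (\<Sum>i\<le>degree p. coeff p i * 0)) (at_top :: real filter)"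
    by (intro tendsto_sum *)
  moreover have "poly p y * exp (- y) = (\<Sum>i\<le>degree p. coeff p i * (y ^ i / exp y))" for y :: real
    by (simp add: poly_altdef sum_distrib_right exp_minus divide_inverse mult.assoc)
  ultimately show ?thesis by simp
qed

lemma flat_exp_has_derivative:
  "(flat_exp p has_real_derivative flat_exp ([:0, 0, 1:] * (p - pderiv p)) x) (at x)"
proof -
  consider "x > 0" | "x < 0" | "x = 0" by linarith
  then show ?thesis
  proof cases
    case 1
    have "((\<lambda>x. poly p (1 / x) * exp (- 1 / x)) has_real_derivative
        flat_exp ([:0, 0, 1:] * (p - pderiv p)) x) (at x)"
      using 1 by (auto intro!: derivative_eq_intros DERIV_chain2[OF poly_DERIV]
          simp: flat_exp_def power2_eq_square field_simps)
    then show ?thesis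
      by (rule has_field_derivative_transform_within_open[where S = "{0<..}"])
        (use 1 in \<open>auto simp: flat_exp_def\<close>)
  next
    case 2
    have "((\<lambda>x. 0) has_real_derivative flat_exp ([:0, 0, 1:] * (p - pderiv p)) x) (at x)"
      using 2 by (simp add: flat_exp_def)
    then show ?thesis
      by (rule has_field_derivative_transform_within_open[where S = "{..<0}"])
        (use 2 in \<open>auto simp: flat_exp_def\<close>)
  next
    case 3
    have "((\<lambda>h. flat_exp p h / h) \<longlongrightarrow> 0) (at 0)"
    proof (rule filterlim_split_at)
      show "((\<lambda>h. flat_exp p h / h) \<longlongrightarrow> 0) (at_left 0)"
        by (rule Lim_transform_eventually[OF tendsto_const])
          (auto simp: flat_exp_def eventually_at_left_field intro: exI[of _ "-1"])
      have "((\<lambda>h. poly (pCons 0 p) (inverse h) * exp (- inverse h)) \<longlongrightarrow> 0) (at_right 0)"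
        by (rule filterlim_compose[OF poly_times_exp_minus_tendsto_0 filterlim_inverse_at_top_right])
      then show "((\<lambda>h. flat_exp p h / h) \<longlongrightarrow> 0) (at_right 0)"
        by (rule Lim_transform_eventually)
          (auto simp: flat_exp_def eventually_at_right_field field_simps intro!: exI[of _ 1])
    qed
    then show ?thesis by (simp add: 3 DERIV_def flat_exp_def)
  qed
qed

lemma flat_exp_sign: "flat_exp 1 x > 0 \<longleftrightarrow> x > 0" "flat_exp 1 x \<ge> 0" "x \<le> 0 \<Longrightarrow> flat_exp p x = 0"
  by (auto simp: flat_exp_def)

abbreviation step_denom :: "real \<Rightarrow> real" where
  "step_denom x \<equiv> flat_exp 1 x + flat_exp 1 (1 - x)"

lemma step_denom_pos: "step_denom x > 0"
  using flat_exp_sign[of x] flat_exp_sign[of "1 - x"]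
  by (cases "x > 0") (auto intro: add_pos_nonneg add_nonneg_pos)

text \<open>
  The class contains the quotient that defines the smooth step below and is closed under
  differentiation, so all its members are smooth.
\<close>

inductive step_algebra :: "(real \<Rightarrow> real) \<Rightarrow> bool" where
  const: "step_algebra (\<lambda>x. c)"
| flat: "step_algebra (flat_exp p)"
| reflected: "step_algebra (\<lambda>x. flat_exp p (1 - x))"
| inverse: "step_algebra (\<lambda>x. inverse (step_denom x))"
| mult: "step_algebra f \<Longrightarrow> step_algebra g \<Longrightarrow> step_algebra (\<lambda>x. f x * g x)"
| add: "step_algebra f \<Longrightarrow> step_algebra g \<Longrightarrow> step_algebra (\<lambda>x. f x + g x)"

lemma flat_exp_reflected_has_derivative:
  "((\<lambda>x. flat_exp p (1 - x)) has_real_derivative - flat_exp ([:0, 0, 1:] * (p - pderiv p)) (1 - x)) (at x)"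
proof -
  have "((\<lambda>x. 1 - x) has_real_derivative - 1) (at x)" by (auto intro!: derivative_eq_intros)
  from DERIV_chain2[OF flat_exp_has_derivative this] show ?thesis by simp
qed

lemma step_algebra_deriv:
  "step_algebra f \<Longrightarrow> \<exists>f'. step_algebra f' \<and> (\<forall>x. (f has_real_derivative f' x) (at x))"
proof (induction rule: step_algebra.induct)
  case (const c)
  show ?case by (intro exI[of _ "\<lambda>x. 0"]) (auto intro: step_algebra.intros)
next
  case (flat p)
  show ?case using flat_exp_has_derivative step_algebra.flat by blast
next
  case (reflected p)
  show ?case
    by (intro exI[of _ "\<lambda>x. (- 1) * flat_exp ([:0, 0, 1:] * (p - pderiv p)) (1 - x)"] conjI allI
        step_algebra.intros) (use flat_exp_reflected_has_derivative[of p] in simp)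
next
  case inverse
  let ?q = "[:0, 0, 1:] * (1 - pderiv 1) :: real poly"
  let ?d = "\<lambda>x. flat_exp ?q x + (- 1) * flat_exp ?q (1 - x)"
  have "(step_denom has_real_derivative ?d x) (at x)" for x
    using DERIV_add[OF flat_exp_has_derivative[of 1 x] flat_exp_reflected_has_derivative[of 1 x]] by simp
  then have "((\<lambda>x. inverse (step_denom x)) has_real_derivative
      (- 1) * (inverse (step_denom x) * (?d x * inverse (step_denom x)))) (at x)" for x
    using DERIV_inverse_fun[of step_denom "?d x" x UNIV] step_denom_pos[of x]
    by (simp add: power2_eq_square divide_inverse mult_ac)
  moreover have "step_algebra (\<lambda>x. (- 1) * (inverse (step_denom x) * (?d x * inverse (step_denom x))))"
    by (intro step_algebra.intros)
  ultimately show ?case by blast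
next
  case (mult f g)
  then obtain f' g' where "step_algebra f'" "step_algebra g'"
    "\<And>x. (f has_real_derivative f' x) (at x)" "\<And>x. (g has_real_derivative g' x) (at x)" by blast
  then show ?case using mult.hyps
    by (intro exI[of _ "\<lambda>x. f' x * g x + g' x * f x"])
      (auto intro!: step_algebra.intros DERIV_mult)
next
  case (add f g)
  then obtain f' g' where "step_algebra f'" "step_algebra g'"
    "\<And>x. (f has_real_derivative f' x) (at x)" "\<And>x. (g has_real_derivative g' x) (at x)" by blast
  then show ?case
    by (intro exI[of _ "\<lambda>x. f' x + g' x"]) (auto intro!: step_algebra.intros DERIV_add)
qed

lemma step_algebra_smooth:
  assumes "step_algebra f"
  shows "smooth_fun f"
proof -
  have D: "step_algebra (deriv g) \<and> (\<forall>x. (g has_real_derivative deriv g x) (at x))"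
    if "step_algebra g" for g
  proof -
    obtain g' where g': "step_algebra g'" "\<And>x. (g has_real_derivative g' x) (at x)"
      using step_algebra_deriv[OF \<open>step_algebra g\<close>] by blast
    moreover have "deriv g = g'" by (intro ext DERIV_imp_deriv g'(2))
    ultimately show ?thesis by simp
  qed
  have "step_algebra ((deriv ^^ n) f)" for n by (induction n) (use assms D in auto)
  then show ?thesis by (intro smooth_funI[of "\<lambda>n. (deriv ^^ n) f"]) (use D in auto)
qed

definition smooth_step :: "real \<Rightarrow> real" where
  "smooth_step x = flat_exp 1 x * inverse (step_denom x)"

lemma smooth_step_smooth: "smooth_fun smooth_step"
  unfolding smooth_step_def[abs_def] by (intro step_algebra_smooth step_algebra.intros)

lemma smooth_step_le_0: "x \<le> 0 \<Longrightarrow> smooth_step x = 0"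
  by (simp add: smooth_step_def flat_exp_sign)

lemma smooth_step_ge_1: "x \<ge> 1 \<Longrightarrow> smooth_step x = 1"
  using flat_exp_sign(1)[of x] by (simp add: smooth_step_def flat_exp_sign(3))

lemma smooth_step_bounds: "0 \<le> smooth_step x" "smooth_step x \<le> 1"
proof -
  show "0 \<le> smooth_step x" using step_denom_pos[of x] flat_exp_sign(2)[of x] by (simp add: smooth_step_def)
  show "smooth_step x \<le> 1"
    using step_denom_pos[of x] flat_exp_sign(2)[of "1 - x"]
    by (simp add: smooth_step_def divide_simps flip: divide_inverse)
qed

lemma smooth_step_DERIV: "(smooth_step has_real_derivative deriv smooth_step x) (at x)"
  using smooth_funD[OF smooth_step_smooth, of 0] by simp

lemma smooth_step_deriv_cont: "continuous_on S (deriv smooth_step)"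
  using smooth_funD[OF smooth_step_smooth, of 1]
  by (auto intro!: continuous_at_imp_continuous_on DERIV_isCont)

lemma smooth_step_deriv_0:
  assumes "x < 0 \<or> x > 1" shows "deriv smooth_step x = 0"
proof (rule DERIV_imp_deriv)
  show "(smooth_step has_real_derivative 0) (at x)"
  proof (cases "x < 0")
    case True
    show ?thesis
      by (rule has_field_derivative_transform_within_open[OF DERIV_const[of 0], where S = "{..<0}"])
        (use True in \<open>auto simp: smooth_step_le_0\<close>)
  next
    case False
    show ?thesis
      by (rule has_field_derivative_transform_within_open[OF DERIV_const[of 1], where S = "{1<..}"])
        (use False assms in \<open>auto simp: smooth_step_ge_1\<close>)
  qed
qed


lemma integrable_lebesgue_on_Ioo_iff:
  fixes f :: "real \<Rightarrow> real"
  shows "integrable (lebesgue_on {a<..<b}) f \<longleftrightarrow> f absolutely_integrable_on {a..b}"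
proof -
  have "integrable (lebesgue_on {a<..<b}) f \<longleftrightarrow> f absolutely_integrable_on {a<..<b}"
    by (simp add: set_integrable_def integrable_restrict_space)
  then show ?thesis
    by (simp add: absolutely_integrable_on_def integrable_on_Icc_iff_Ioo)
qed

lemma integral_lebesgue_on_Ioo:
  fixes f :: "real \<Rightarrow> real"
  assumes "f absolutely_integrable_on {a..b}"
  shows "(LINT t|lebesgue_on {a<..<b}. f t) = integral {a..b} f"
  using lebesgue_integral_eq_integral[of "{a<..<b}" f] assms
  by (simp add: integrable_lebesgue_on_Ioo_iff integral_open_interval_real)

lemma absolutely_integrable_continuous_mult:
  fixes f p :: "real \<Rightarrow> real"
  assumes "continuous_on {a..b} p" "f absolutely_integrable_on {a..b}"
  shows "(\<lambda>x. p x * f x) absolutely_integrable_on {a..b}"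
proof (rule absolutely_integrable_bounded_measurable_product_real[OF _ _ _ assms(2)])
  show "p \<in> borel_measurable (lebesgue_on {a..b})"
    by (rule continuous_imp_measurable_on_sets_lebesgue[OF assms(1)]) simp
  show "bounded (p ` {a..b})"
    by (intro compact_imp_bounded compact_continuous_image assms(1)) simp
qed simp

text \<open>
  The kernel is the derivative of the step rescaled to \<open>{s..s + h}\<close>: it is supported there, is
  bounded by \<open>M / h\<close> and has integral \<open>1\<close>.
\<close>

lemma scaled_step_average:
  fixes F :: "real \<Rightarrow> real"
  assumes F: "continuous_on {a..b} F" and s: "a \<le> s" "s + h \<le> b" and h: "0 < h"
    and M: "\<And>x. \<bar>deriv smooth_step x\<bar> \<le> M"
    and e: "\<And>x. s \<le> x \<Longrightarrow> x \<le> s + h \<Longrightarrow> \<bar>F x - F s\<bar> \<le> e"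
  shows "\<bar>integral {a..b} (\<lambda>x. deriv smooth_step ((x - s) / h) / h * F x) - F s\<bar> \<le> M * e"
proof -
  define k where "k x = deriv smooth_step ((x - s) / h) / h" for x
  have kc: "continuous_on S k" for S
    unfolding k_def
    by (intro continuous_intros continuous_on_compose2[OF smooth_step_deriv_cont[of UNIV]])
      (use h in auto)
  have k0: "k x = 0" if "x \<notin> {s..s + h}" for x
    unfolding k_def using that h smooth_step_deriv_0[of "(x - s) / h"] by (auto simp: field_simps)
  have FS: "continuous_on {s..s + h} F" by (rule continuous_on_subset[OF F]) (use s in auto)
  have D: "((\<lambda>x. smooth_step ((x - s) / h)) has_real_derivative k x) (at x)" for x
  proof -
    have "((\<lambda>x. (x - s) / h) has_real_derivative 1 / h) (at x)"
      using h by (auto intro!: derivative_eq_intros)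
    from DERIV_chain2[OF smooth_step_DERIV this] show ?thesis by (simp add: k_def)
  qed
  have "(k has_integral smooth_step ((s + h - s) / h) - smooth_step ((s - s) / h)) {s..s + h}"
    by (rule fundamental_theorem_of_calculus)
      (use h D in \<open>auto intro: has_field_derivative_at_within simp flip: has_real_derivative_iff_has_vector_derivative\<close>)
  then have k1: "(k has_integral 1) {s..s + h}" using h by (simp add: smooth_step_le_0 smooth_step_ge_1)
  have int: "(\<lambda>x. k x * (F x - F s)) integrable_on {s..s + h}"
    by (intro integrable_continuous_real continuous_intros kc FS)
  have "((\<lambda>x. k x * (F x - F s) + k x * F s) has_integral
      integral {s..s + h} (\<lambda>x. k x * (F x - F s)) + 1 * F s) {s..s + h}"
    by (intro has_integral_add integrable_integral int has_integral_mult_left k1)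
  then have "((\<lambda>x. k x * F x) has_integral
      integral {s..s + h} (\<lambda>x. k x * (F x - F s)) + F s) {s..s + h}"
    by (simp add: algebra_simps)
  then have "((\<lambda>x. k x * F x) has_integral
      integral {s..s + h} (\<lambda>x. k x * (F x - F s)) + F s) {a..b}"
    by (rule has_integral_on_superset) (use s k0 in auto)
  then have eq: "integral {a..b} (\<lambda>x. k x * F x) - F s = integral {s..s + h} (\<lambda>x. k x * (F x - F s))"
    by (simp add: integral_unique)
  have "norm (integral {s..s + h} (\<lambda>x. k x * (F x - F s))) \<le> (M / h * e) * (s + h - s)"
  proof (rule integral_bound)
    show "norm (k x * (F x - F s)) \<le> M / h * e" if "x \<in> {s..s + h}" for x
    proof -
      have "\<bar>k x\<bar> \<le> M / h" using M h by (simp add: k_def abs_div divide_right_mono)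
      moreover have "0 \<le> M" using M[of 0] by simp
      ultimately show ?thesis unfolding real_norm_def abs_mult
        using e[of x] that h by (intro mult_mono) auto
    qed
  qed (use h in \<open>auto intro!: continuous_intros kc FS\<close>)
  then show ?thesis using h by (simp add: eq flip: k_def)
qed

lemma smooth_step_deriv_bounded: "\<exists>M. \<forall>x. \<bar>deriv smooth_step x\<bar> \<le> M"
proof -
  have "bounded (deriv smooth_step ` {0..1})"
    by (intro compact_imp_bounded compact_continuous_image smooth_step_deriv_cont) simp
  then obtain M where M: "\<forall>x\<in>{0..1}. \<bar>deriv smooth_step x\<bar> \<le> M" unfolding bounded_real by auto
  have "\<bar>deriv smooth_step x\<bar> \<le> max M 0" for x
    using M smooth_step_deriv_0[of x] by (cases "x \<in> {0..1}") (force simp: le_max_iff_disj)+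
  then show ?thesis by blast
qed

lemma scaled_step_average_tendsto:
  fixes F :: "real \<Rightarrow> real"
  assumes F: "continuous_on {a..b} F" and s: "a \<le> s" "s < b"
    and h: "h \<longlonglongrightarrow> 0" "\<And>n. 0 < h n" "\<And>n. s + h n \<le> b"
  shows "(\<lambda>n. integral {a..b} (\<lambda>x. deriv smooth_step ((x - s) / h n) / h n * F x)) \<longlonglongrightarrow> F s"
proof (rule LIMSEQ_I)
  obtain M where M: "\<And>x. \<bar>deriv smooth_step x\<bar> \<le> M" using smooth_step_deriv_bounded by blast
  have Mp: "0 \<le> M" using M[of 0] by simp
  fix e :: real assume e: "e > 0"
  have "s \<in> {a..b}" "e / (M + 1) > 0" using s e Mp by auto
  then have "\<exists>d>0. \<forall>x\<in>{a..b}. dist x s < d \<longrightarrow> dist (F x) (F s) < e / (M + 1)"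
    using F unfolding continuous_on_iff by blast
  then obtain d where d: "d > 0" "\<And>x. x \<in> {a..b} \<Longrightarrow> \<bar>x - s\<bar> < d \<Longrightarrow> \<bar>F x - F s\<bar> < e / (M + 1)"
    unfolding dist_real_def by blast
  obtain N where N: "\<And>n. n \<ge> N \<Longrightarrow> h n < d"
    using order_tendstoD(2)[OF h(1) d(1)] by (auto simp: eventually_sequentially)
  show "\<exists>no. \<forall>n\<ge>no. norm (integral {a..b} (\<lambda>x. deriv smooth_step ((x - s) / h n) / h n * F x) - F s) < e"
  proof (intro exI[of _ N] allI impI)
    fix n assume n: "n \<ge> N"
    have "\<bar>integral {a..b} (\<lambda>x. deriv smooth_step ((x - s) / h n) / h n * F x) - F s\<bar> \<le> M * (e / (M + 1))"
    proof (rule scaled_step_average[OF F s(1) h(3) h(2) M])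
      fix x assume "s \<le> x" "x \<le> s + h n"
      then show "\<bar>F x - F s\<bar> \<le> e / (M + 1)"
        using s h(3)[of n] N[OF n] by (intro less_imp_le d(2)) auto
    qed
    also have "\<dots> < e" using Mp e by (simp add: field_simps)
    finally show "norm (integral {a..b} (\<lambda>x. deriv smooth_step ((x - s) / h n) / h n * F x) - F s) < e"
      by simp
  qed
qed

text \<open>
  The test functions are differences of two steps, rising at \<open>s\<close> and at \<open>t\<close> over a length that
  tends to zero. They converge to the indicator of \<open>{s<..t}\<close>, and their derivatives evaluate
  \<open>F\<close> at \<open>s\<close> and at \<open>t\<close>. The end points \<open>a\<close> and \<open>b\<close> are reached by continuity.
\<close>

lemma weak_derivative_imp_integral:
  fixes F f :: "real \<Rightarrow> real"
  assumes F: "continuous_on {a..b} F" and f: "f absolutely_integrable_on {a..b}"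
    and weak: "\<And>\<phi>. test_function {a<..<b} \<phi> \<Longrightarrow>
      (LINT t|lebesgue_on {a<..<b}. deriv \<phi> t * F t) = - (LINT t|lebesgue_on {a<..<b}. \<phi> t * f t)"
    and st: "a \<le> s" "s \<le> t" "t \<le> b"
  shows "(f has_integral (F t - F s)) {s..t}"
proof -
  have fi: "f integrable_on {a..b}" using f by (simp add: absolutely_integrable_on_def)
  have inner: "integral {s..t} f = F t - F s" if st: "a < s" "s < t" "t < b" for s t
  proof -
    define h where "h n = (b - t) / (real n + 2)" for n
    have hp: "0 < h n" for n using st by (simp add: h_def)
    have hb: "h n \<le> (b - t) / 2" for n
      unfolding h_def using st by (intro divide_left_mono) auto
    have htb: "t + h n < b" "s + h n \<le> b" for n
      using hb[of n] st by (auto simp: field_simps)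
    have h0: "h \<longlonglongrightarrow> 0"
      using LIMSEQ_ignore_initial_segment[OF lim_const_over_n[of "b - t"], of 2] by (simp add: h_def[abs_def] add.commute)
    define \<phi> where "\<phi> n x = smooth_step ((x - s) / h n) - smooth_step ((x - t) / h n)" for n x
    define k where "k r n x = deriv smooth_step ((x - r) / h n) / h n" for r n x
    have affine: "smooth_fun (\<lambda>x. smooth_step ((x - r) / h n))" for r n
    proof -
      have "smooth_fun (\<lambda>x. smooth_step (1 / h n * x + - r / h n))"
        by (rule smooth_fun_affine[OF smooth_step_smooth])
      then show ?thesis by (simp add: diff_divide_distrib)
    qed
    have sm: "smooth_fun (\<phi> n)" for n
      unfolding \<phi>_def by (intro smooth_fun_diff affine)
    have D: "(\<phi> n has_real_derivative k s n x - k t n x) (at x)" for n x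
    proof -
      have "((\<lambda>x. smooth_step ((x - r) / h n)) has_real_derivative k r n x) (at x)" for r
      proof -
        have "((\<lambda>x. (x - r) / h n) has_real_derivative 1 / h n) (at x)"
          using hp[of n] by (auto intro!: derivative_eq_intros)
        from DERIV_chain2[OF smooth_step_DERIV this] show ?thesis by (simp add: k_def)
      qed
      then show ?thesis unfolding \<phi>_def by (intro derivative_intros)
    qed
    have deriv\<phi>: "deriv (\<phi> n) = (\<lambda>x. k s n x - k t n x)" for n
      by (intro ext DERIV_imp_deriv D)
    have supp: "\<phi> n x = 0" if "x \<notin> {s..t + h n}" for n x
    proof (cases "x < s")
      case True
      then show ?thesis
        using hp[of n] st by (simp add: \<phi>_def smooth_step_le_0 divide_nonpos_pos)
    next
      case False
      then show ?thesis
        using hp[of n] st that by (simp add: \<phi>_def smooth_step_ge_1 field_simps)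
    qed
    have sub: "closure {x. \<phi> n x \<noteq> 0} \<subseteq> {s..t + h n}" for n
    proof (rule closure_minimal)
      show "{x. \<phi> n x \<noteq> 0} \<subseteq> {s..t + h n}" using supp by blast
    qed simp
    have test: "test_function {a<..<b} (\<phi> n)" for n
    proof -
      have "compact (closure {x. \<phi> n x \<noteq> 0})"
        using compact_Icc sub by (metis closed_closure closed_Int_compact inf.absorb1)
      then show ?thesis
        using sm sub[of n] htb(1)[of n] st by (force simp: test_function_def smooth_fun_def)
    qed
    have kc: "continuous_on S (k r n)" for S r n
      unfolding k_def
      by (intro continuous_intros continuous_on_compose2[OF smooth_step_deriv_cont[of UNIV]])
        (use hp[of n] in auto)
    have kF: "(\<lambda>x. k r n x * F x) integrable_on {a..b}" for r n
      by (intro integrable_continuous_real continuous_intros kc F)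
    have \<phi>c: "continuous_on S (\<phi> n)" for S n
      using D by (intro continuous_at_imp_continuous_on ballI DERIV_isCont)
    have "(LINT t|lebesgue_on {a<..<b}. deriv (\<phi> n) t * F t) = integral {a..b} (\<lambda>x. (k s n x - k t n x) * F x)" for n
      unfolding deriv\<phi>
      by (intro integral_lebesgue_on_Ioo absolutely_integrable_continuous_real continuous_intros kc F)
    also have "\<dots> n = integral {a..b} (\<lambda>x. k s n x * F x) - integral {a..b} (\<lambda>x. k t n x * F x)" for n
      by (simp add: left_diff_distrib Henstock_Kurzweil_Integration.integral_diff kF)
    finally have "(LINT t|lebesgue_on {a<..<b}. deriv (\<phi> n) t * F t) =
      integral {a..b} (\<lambda>x. k s n x * F x) - integral {a..b} (\<lambda>x. k t n x * F x)" for n .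
    moreover have "(\<lambda>n. integral {a..b} (\<lambda>x. k s n x * F x) - integral {a..b} (\<lambda>x. k t n x * F x))
        \<longlonglongrightarrow> F s - F t"
      unfolding k_def
      by (intro tendsto_diff scaled_step_average_tendsto[OF F] h0 hp htb less_imp_le[OF htb(1)]) (use st in auto)
    ultimately have "(\<lambda>n. - (LINT t|lebesgue_on {a<..<b}. \<phi> n t * f t)) \<longlonglongrightarrow> F s - F t"
      using weak[OF test] by simp
    moreover have \<phi>f: "(\<lambda>x. \<phi> n x * f x) absolutely_integrable_on {a..b}" for n
      by (intro absolutely_integrable_continuous_mult \<phi>c f)
    ultimately have lim1: "(\<lambda>n. integral {a..b} (\<lambda>x. \<phi> n x * f x)) \<longlonglongrightarrow> F t - F s"
      using tendsto_minus[of "\<lambda>n. - (LINT t|lebesgue_on {a<..<b}. \<phi> n t * f t)" "F s - F t" sequentially]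
      by (simp add: integral_lebesgue_on_Ioo)
    have step_lim: "(\<lambda>n. smooth_step ((x - r) / h n)) \<longlonglongrightarrow> (if x \<le> r then 0 else 1)" for x r
    proof (cases "x \<le> r")
      case True
      then show ?thesis using hp by (simp add: smooth_step_le_0 divide_nonpos_pos)
    next
      case False
      obtain N where N: "\<And>n. n \<ge> N \<Longrightarrow> h n < x - r"
        using order_tendstoD(2)[OF h0, of "x - r"] False by (auto simp: eventually_sequentially)
      have "smooth_step ((x - r) / h n) = 1" if "n \<ge> N" for n
        using N[OF that] hp[of n] by (intro smooth_step_ge_1) (simp add: field_simps)
      then have "eventually (\<lambda>n. smooth_step ((x - r) / h n) = 1) sequentially"
        by (auto simp: eventually_sequentially)
      then show ?thesis using False by (simp add: tendsto_eventually)
    qed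
    have "(\<lambda>n. integral {a..b} (\<lambda>x. \<phi> n x * f x)) \<longlonglongrightarrow> integral {a..b} (\<lambda>x. (if x \<in> {s<..t} then f x else 0))"
    proof (rule Equivalence_Lebesgue_Henstock_Integration.dominated_convergence(2))
      show "(\<lambda>x. \<phi> n x * f x) integrable_on {a..b}" for n
        using \<phi>f by (simp add: absolutely_integrable_on_def)
      show "(\<lambda>x. norm (f x)) integrable_on {a..b}" using f by (simp add: absolutely_integrable_on_def)
      show "norm (\<phi> n x * f x) \<le> norm (f x)" for n x
      proof -
        have "\<bar>\<phi> n x\<bar> \<le> 1"
          using smooth_step_bounds[of "(x - s) / h n"] smooth_step_bounds[of "(x - t) / h n"]
          by (auto simp: \<phi>_def)
        then show ?thesis by (simp add: abs_mult mult_left_le_one_le)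
      qed
      show "(\<lambda>n. \<phi> n x * f x) \<longlonglongrightarrow> (if x \<in> {s<..t} then f x else 0)" for x
        using tendsto_mult_right[OF tendsto_diff[OF step_lim[of x s] step_lim[of x t]], of "f x"] st
        by (auto simp: \<phi>_def split: if_splits)
    qed
    also have "integral {a..b} (\<lambda>x. (if x \<in> {s<..t} then f x else 0)) = integral {s<..t} f"
      using st by (subst Henstock_Kurzweil_Integration.integral_restrict_Int) (auto intro: arg_cong2[where f = integral])
    also have "\<dots> = integral {s..t} f"
      by (rule integral_spike_set) (auto intro: negligible_subset[of "{s}"])
    finally show ?thesis using lim1 LIMSEQ_unique by blast
  qed
  define G where "G t = F t - integral {a..t} f" for t
  have Gc: "continuous_on {a..b} G"
    unfolding G_def by (intro continuous_intros F indefinite_integral_continuous_1 fi)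
  have comb: "integral {a..s} f + integral {s..t} f = integral {a..t} f" if "a \<le> s" "s \<le> t" "t \<le> b" for s t
    by (rule Henstock_Kurzweil_Integration.integral_combine[OF that(1,2)])
      (rule integrable_on_subinterval[OF fi], use that in auto)
  have mid: "G x = G ((a + b) / 2)" if "x \<in> {a..b}" "a < b" for x
  proof (rule continuous_constant_on_closure[where S = "{a<..<b}" and f = G])
    fix x assume x: "x \<in> {a<..<b}"
    have *: "G s = G t" if "a < s" "s < t" "t < b" for s t
      using inner[OF that] comb[of s t] that by (simp add: G_def)
    show "G x = G ((a + b) / 2)"
    proof -
      have "a < (a + b) / 2" "(a + b) / 2 < b" using \<open>a < b\<close> by auto
      then show ?thesis
        using *[of x "(a + b) / 2"] *[of "(a + b) / 2" x] x
        by (metis greaterThanLessThan_iff linorder_neqE)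
    qed
  qed (use that Gc in auto)
  have "G s = G t"
  proof (cases "a < b")
    case True
    then show ?thesis using mid[of s] mid[of t] st by simp
  next
    case False
    then have "s = t" using st by linarith
    then show ?thesis by simp
  qed
  then have "integral {s..t} f = F t - F s" using comb[OF st] by (simp add: G_def)
  moreover have "f integrable_on {s..t}"
    by (rule integrable_on_subinterval[OF fi]) (use st in auto)
  ultimately show ?thesis by (metis integrable_integral)
qed

text \<open>
  Sum the bound over a fine equidistant partition.
\<close>

lemma additive_small_imp_zero:
  fixes D :: "real \<Rightarrow> real \<Rightarrow> real" and m :: "real \<Rightarrow> real"
  assumes ab: "a \<le> b"
    and add: "\<And>r s t. a \<le> r \<Longrightarrow> r \<le> s \<Longrightarrow> s \<le> t \<Longrightarrow> t \<le> b \<Longrightarrow> D r t = D r s + D s t"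
    and small: "\<And>e. e > 0 \<Longrightarrow> \<exists>\<delta>>0. \<forall>s t. a \<le> s \<and> s \<le> t \<and> t \<le> b \<and> t - s < \<delta> \<longrightarrow>
      \<bar>D s t\<bar> \<le> e * (m t - m s)"
  shows "D a b = 0"
proof -
  have "\<bar>D a b\<bar> \<le> e * (m b - m a)" if e: "e > 0" for e
  proof -
    obtain \<delta> where \<delta>: "\<delta> > 0" and D: "\<And>s t. a \<le> s \<Longrightarrow> s \<le> t \<Longrightarrow> t \<le> b \<Longrightarrow> t - s < \<delta> \<Longrightarrow>
      \<bar>D s t\<bar> \<le> e * (m t - m s)" using small[OF e] by blast
    obtain N :: nat where N: "(b - a) / \<delta> < real N" using reals_Archimedean2 by blast
    have "0 \<le> (b - a) / \<delta>" using ab \<delta> by simp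
    then have Np: "real N > 0" using N by linarith
    define p where "p i = a + (b - a) * real i / real N" for i
    have step: "p (Suc i) - p i = (b - a) / real N" for i
      using Np by (simp add: p_def field_simps)
    have lt: "(b - a) / real N < \<delta>" using N \<delta> Np by (simp add: field_simps)
    have p_bounds: "a \<le> p i" "i \<le> N \<Longrightarrow> p i \<le> b" for i
    proof -
      show "a \<le> p i" using ab Np by (simp add: p_def)
      assume "i \<le> N"
      then have "(b - a) * (real i / real N) \<le> (b - a) * 1"
        using ab Np by (intro mult_left_mono) auto
      then show "p i \<le> b" by (simp add: p_def)
    qed
    have pN: "p N = b" using Np by (simp add: p_def)
    have pS: "p i \<le> p (Suc i)" for i
      using step[of i] ab Np divide_nonneg_pos[of "b - a" "real N"] by linarith
    have "D a a = D a a + D a a" using add[of a a a] ab by simp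
    then have D0: "D a a = 0" by simp
    have "i \<le> N \<Longrightarrow> \<bar>D a (p i)\<bar> \<le> e * (m (p i) - m a)" for i
    proof (induction i)
      case (Suc i)
      have "D a (p (Suc i)) = D a (p i) + D (p i) (p (Suc i))"
        using p_bounds pS Suc.prems by (intro add) auto
      moreover have "\<bar>D (p i) (p (Suc i))\<bar> \<le> e * (m (p (Suc i)) - m (p i))"
        by (rule D) (use p_bounds pS step lt Suc.prems in auto)
      ultimately show ?case using Suc by (simp add: algebra_simps)
    qed (simp add: p_def D0)
    from this[of N] show ?thesis by (simp add: pN)
  qed
  note bound = this
  show ?thesis
  proof (rule ccontr)
    assume nz: "D a b \<noteq> 0"
    have "\<bar>D a b\<bar> \<le> (\<bar>D a b\<bar> / (2 * (\<bar>m b - m a\<bar> + 1))) * (m b - m a)"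
      by (intro bound divide_pos_pos mult_pos_pos add_nonneg_pos) (use nz in auto)
    also have "\<dots> \<le> (\<bar>D a b\<bar> / (2 * (\<bar>m b - m a\<bar> + 1))) * (\<bar>m b - m a\<bar> + 1)"
      by (intro mult_left_mono) auto
    also have "\<dots> = \<bar>D a b\<bar> / 2"
    proof -
      have "x / (2 * y) * y = x / 2" if "y > 0" for x y :: real using that by simp
      from this[of "\<bar>m b - m a\<bar> + 1"] show ?thesis by (simp only: add_nonneg_pos abs_ge_zero zero_less_one)
    qed
    finally show False using nz by simp
  qed
qed

text \<open>
  This is how products are differentiated here: the increments of \<open>q\<close> on short intervals are
  integrals of functions \<open>G\<close> close to \<open>k\<close>, with an error that adds up to \<open>e\<close> times the integral of
  \<open>m\<close>. No differentiability at single times is involved.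
\<close>

lemma has_integral_by_local_approximation:
  fixes q k m :: "real \<Rightarrow> real"
  assumes ab: "a \<le> b" and k: "k integrable_on {a..b}" and m: "m integrable_on {a..b}"
    and approx: "\<And>e. e > 0 \<Longrightarrow> \<exists>\<delta>>0. \<forall>s t. a \<le> s \<and> s \<le> t \<and> t \<le> b \<and> t - s < \<delta> \<longrightarrow>
      (\<exists>G. (G has_integral q t - q s) {s..t} \<and> (\<forall>r\<in>{s..t}. \<bar>G r - k r\<bar> \<le> e * m r))"
  shows "(k has_integral q b - q a) {a..b}"
proof -
  have comb: "integral {r..s} f + integral {s..t} f = integral {r..t} f"
    if "f integrable_on {a..b}" "a \<le> r" "r \<le> s" "s \<le> t" "t \<le> b" for r s t and f :: "real \<Rightarrow> real"
    by (rule Henstock_Kurzweil_Integration.integral_combine[OF that(3,4)])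
      (rule integrable_on_subinterval[OF that(1)], use that in auto)
  define E where "E s t = q t - q s - integral {s..t} k" for s t
  define M where "M t = integral {a..t} m" for t
  have "E a b = 0"
  proof (rule additive_small_imp_zero[OF ab, where m = M])
    show "E r t = E r s + E s t" if "a \<le> r" "r \<le> s" "s \<le> t" "t \<le> b" for r s t
      using comb[OF k that] by (simp add: E_def)
  next
    fix e :: real assume "e > 0"
    from approx[OF this] obtain \<delta> where \<delta>: "\<delta> > 0"
      and G: "\<And>s t. a \<le> s \<and> s \<le> t \<and> t \<le> b \<and> t - s < \<delta> \<Longrightarrow>
        \<exists>G. (G has_integral q t - q s) {s..t} \<and> (\<forall>r\<in>{s..t}. \<bar>G r - k r\<bar> \<le> e * m r)" by blast
    have "\<bar>E s t\<bar> \<le> e * (M t - M s)" if st: "a \<le> s \<and> s \<le> t \<and> t \<le> b \<and> t - s < \<delta>" for s t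
    proof -
      obtain g where g: "(g has_integral q t - q s) {s..t}" "\<And>r. r \<in> {s..t} \<Longrightarrow> \<bar>g r - k r\<bar> \<le> e * m r"
        using G[OF st] by blast
      have sub: "{s..t} \<subseteq> {a..b}" using st by auto
      have gk: "((\<lambda>r. g r - k r) has_integral E s t) {s..t}"
        unfolding E_def
        by (intro has_integral_diff g integrable_integral integrable_on_subinterval[OF k sub])
      have "norm (integral {s..t} (\<lambda>r. g r - k r)) \<le> integral {s..t} (\<lambda>r. e * m r)"
      proof (rule Henstock_Kurzweil_Integration.integral_norm_bound_integral)
        show "(\<lambda>r. e * m r) integrable_on {s..t}"
          by (intro integrable_on_mult_right integrable_on_subinterval[OF m sub])
      qed (use g(2) gk in auto)
      moreover have "integral {s..t} m = M t - M s" using comb[OF m, of a s t] st by (simp add: M_def)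
      ultimately show ?thesis by (simp add: integral_unique[OF gk])
    qed
    then show "\<exists>\<delta>>0. \<forall>s t. a \<le> s \<and> s \<le> t \<and> t \<le> b \<and> t - s < \<delta> \<longrightarrow> \<bar>E s t\<bar> \<le> e * (M t - M s)"
      using \<delta> by blast
  qed
  then have "integral {a..b} k = q b - q a" by (simp add: E_def)
  then show ?thesis using k by (metis integrable_integral)
qed

lemma uniform_modulus:
  fixes f :: "real \<Rightarrow> 'a::real_normed_vector"
  assumes "continuous_on {a..b} f" "e > 0"
  shows "\<exists>d>0. \<forall>x\<in>{a..b}. \<forall>x'\<in>{a..b}. \<bar>x' - x\<bar> < d \<longrightarrow> norm (f x' - f x) < e"
  using compact_uniformly_continuous[OF assms(1) compact_Icc] assms(2)
  unfolding uniformly_continuous_on_def dist_norm real_norm_def by blast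

text \<open>
  The product rule for \<open>\<phi> F\<close>: on a short interval, \<open>\<phi>\<close> is frozen at the right end in \<open>\<phi> f\<close> and
  \<open>F\<close> at the left end in \<open>\<phi>' F\<close>, which makes the increment of \<open>\<phi> F\<close> exactly an integral.
\<close>

lemma integral_imp_weak_derivative:
  fixes F f :: "real \<Rightarrow> real"
  assumes ab: "a \<le> b" and F: "continuous_on {a..b} F" and f: "f absolutely_integrable_on {a..b}"
    and int: "\<And>s t. a \<le> s \<Longrightarrow> s \<le> t \<Longrightarrow> t \<le> b \<Longrightarrow> (f has_integral (F t - F s)) {s..t}"
    and \<phi>: "test_function {a<..<b} \<phi>"
  shows "(LINT t|lebesgue_on {a<..<b}. deriv \<phi> t * F t) = - (LINT t|lebesgue_on {a<..<b}. \<phi> t * f t)"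
proof -
  have sm: "smooth_fun \<phi>" using \<phi> by (simp add: test_function_def smooth_fun_def)
  have D: "(\<phi> has_real_derivative deriv \<phi> x) (at x)" for x using smooth_funD[OF sm, of 0] by simp
  have \<phi>c: "continuous_on S \<phi>" for S
    using D by (intro continuous_at_imp_continuous_on ballI DERIV_isCont)
  have dc: "continuous_on S (deriv \<phi>)" for S
    using smooth_funD[OF sm, of 1] by (auto intro!: continuous_at_imp_continuous_on DERIV_isCont)
  have "\<phi> x = 0" if "x \<notin> {a<..<b}" for x
    using \<phi> that closure_subset[of "{t. \<phi> t \<noteq> 0}"] unfolding test_function_def by blast
  then have \<phi>ab: "\<phi> a = 0" "\<phi> b = 0" by auto
  have A1: "(\<lambda>x. \<phi> x * f x) absolutely_integrable_on {a..b}"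
    by (intro absolutely_integrable_continuous_mult \<phi>c f)
  have A2: "(\<lambda>x. deriv \<phi> x * F x) absolutely_integrable_on {a..b}"
    by (intro absolutely_integrable_continuous_real continuous_intros dc F)
  note I = set_lebesgue_integral_eq_integral(1)[OF A1] set_lebesgue_integral_eq_integral(1)[OF A2]
  have "((\<lambda>x. \<phi> x * f x + deriv \<phi> x * F x) has_integral \<phi> b * F b - \<phi> a * F a) {a..b}"
  proof (rule has_integral_by_local_approximation[OF ab])
    show "(\<lambda>x. \<phi> x * f x + deriv \<phi> x * F x) integrable_on {a..b}" by (intro integrable_add I)
    show "(\<lambda>x. \<bar>f x\<bar> + \<bar>deriv \<phi> x\<bar>) integrable_on {a..b}"
      using f integrable_continuous_real[OF continuous_on_rabs[OF dc]]
      by (intro integrable_add) (simp_all add: absolutely_integrable_on_def)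
    fix e :: real assume e: "e > 0"
    obtain d1 where d1: "d1 > 0"
      "\<forall>x\<in>{a..b}. \<forall>x'\<in>{a..b}. \<bar>x' - x\<bar> < d1 \<longrightarrow> norm (\<phi> x' - \<phi> x) < e"
      using uniform_modulus[OF \<phi>c e] by blast
    obtain d2 where d2: "d2 > 0"
      "\<forall>x\<in>{a..b}. \<forall>x'\<in>{a..b}. \<bar>x' - x\<bar> < d2 \<longrightarrow> norm (F x' - F x) < e"
      using uniform_modulus[OF F e] by blast
    show "\<exists>\<delta>>0. \<forall>s t. a \<le> s \<and> s \<le> t \<and> t \<le> b \<and> t - s < \<delta> \<longrightarrow>
      (\<exists>G. (G has_integral \<phi> t * F t - \<phi> s * F s) {s..t} \<and>
        (\<forall>x\<in>{s..t}. \<bar>G x - (\<phi> x * f x + deriv \<phi> x * F x)\<bar> \<le> e * (\<bar>f x\<bar> + \<bar>deriv \<phi> x\<bar>)))"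
    proof (intro exI[of _ "min d1 d2"] conjI allI impI)
      fix s t assume st: "a \<le> s \<and> s \<le> t \<and> t \<le> b \<and> t - s < min d1 d2"
      have "(deriv \<phi> has_integral \<phi> t - \<phi> s) {s..t}"
        by (rule fundamental_theorem_of_calculus)
          (use st D in \<open>auto intro: has_field_derivative_at_within simp flip: has_real_derivative_iff_has_vector_derivative\<close>)
      then have "((\<lambda>x. \<phi> t * f x + deriv \<phi> x * F s) has_integral
          \<phi> t * (F t - F s) + (\<phi> t - \<phi> s) * F s) {s..t}"
        by (intro has_integral_add has_integral_mult_right has_integral_mult_left int) (use st in auto)
      then have G: "((\<lambda>x. \<phi> t * f x + deriv \<phi> x * F s) has_integral \<phi> t * F t - \<phi> s * F s) {s..t}"
        by (simp add: algebra_simps)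
      have "\<bar>\<phi> t * f x + deriv \<phi> x * F s - (\<phi> x * f x + deriv \<phi> x * F x)\<bar>
          \<le> e * (\<bar>f x\<bar> + \<bar>deriv \<phi> x\<bar>)" if x: "x \<in> {s..t}" for x
      proof -
      have "\<bar>\<phi> t - \<phi> x\<bar> \<le> e" "\<bar>F s - F x\<bar> \<le> e"
        using d1(2)[rule_format, of x t] d2(2)[rule_format, of x s] x st by auto
      then have "\<bar>(\<phi> t - \<phi> x) * f x\<bar> \<le> e * \<bar>f x\<bar>" "\<bar>(F s - F x) * deriv \<phi> x\<bar> \<le> e * \<bar>deriv \<phi> x\<bar>"
        by (auto simp: abs_mult intro!: mult_right_mono)
      moreover have "\<phi> t * f x + deriv \<phi> x * F s - (\<phi> x * f x + deriv \<phi> x * F x) =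
          (\<phi> t - \<phi> x) * f x + (F s - F x) * deriv \<phi> x"
        by (simp add: algebra_simps)
      ultimately show ?thesis by (simp add: distrib_left)
      qed
      with G show "\<exists>G. (G has_integral \<phi> t * F t - \<phi> s * F s) {s..t} \<and>
        (\<forall>x\<in>{s..t}. \<bar>G x - (\<phi> x * f x + deriv \<phi> x * F x)\<bar> \<le> e * (\<bar>f x\<bar> + \<bar>deriv \<phi> x\<bar>))"
        by blast
    qed (use d1 d2 in auto)
  qed
  then have "integral {a..b} (\<lambda>x. \<phi> x * f x) + integral {a..b} (\<lambda>x. deriv \<phi> x * F x) = 0"
    using Henstock_Kurzweil_Integration.integral_add[OF I] by (simp add: \<phi>ab integral_unique)
  then show ?thesis by (simp add: integral_lebesgue_on_Ioo A1 A2)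
qed

section \<open>Bochner measurability and square integrability\<close>

abbreviation strongly_measurable_on :: "real set \<Rightarrow> (real \<Rightarrow> 'b::real_normed_vector) \<Rightarrow> bool" where
  "strongly_measurable_on \<equiv> strongly_measurable_in UNIV norm"

lemma strongly_measurable_on_iff:
  "strongly_measurable_on I f \<longleftrightarrow>
    (\<exists>s. (\<forall>n::nat. simple_function (lebesgue_on I) (s n)) \<and>
      (AE t in lebesgue_on I. (\<lambda>n. s n t) \<longlonglongrightarrow> f t))"
  unfolding strongly_measurable_in_def
  by (simp add: tendsto_norm_zero_iff LIM_zero_iff)

lemma strongly_measurable_on_continuous2:
  assumes "strongly_measurable_on I f" "strongly_measurable_on I g"
    and h: "continuous_on UNIV (\<lambda>p. h (fst p) (snd p))"
  shows "strongly_measurable_on I (\<lambda>t. h (f t) (g t))"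
proof -
  obtain s where s: "\<And>n::nat. simple_function (lebesgue_on I) (s n)"
    "AE t in lebesgue_on I. (\<lambda>n. s n t) \<longlonglongrightarrow> f t"
    using assms(1) unfolding strongly_measurable_on_iff by blast
  obtain r where r: "\<And>n::nat. simple_function (lebesgue_on I) (r n)"
    "AE t in lebesgue_on I. (\<lambda>n. r n t) \<longlonglongrightarrow> g t"
    using assms(2) unfolding strongly_measurable_on_iff by blast
  have lim: "(\<lambda>n. h (x n) (y n)) \<longlonglongrightarrow> h a b" if "x \<longlonglongrightarrow> a" "y \<longlonglongrightarrow> b" for x y a b
    using continuous_on_tendsto_compose[OF h tendsto_Pair[OF that]] by simp
  show ?thesis unfolding strongly_measurable_on_iff
  proof (intro exI[of _ "\<lambda>n t. h (s n t) (r n t)"] conjI allI)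
    show "simple_function (lebesgue_on I) (\<lambda>t. h (s n t) (r n t))" for n
      by (rule simple_function_compose2[OF s(1) r(1)])
    show "AE t in lebesgue_on I. (\<lambda>n. h (s n t) (r n t)) \<longlonglongrightarrow> h (f t) (g t)"
      using s(2) r(2) by eventually_elim (rule lim)
  qed
qed

lemma strongly_measurable_on_const: "strongly_measurable_on I (\<lambda>t. c)"
  unfolding strongly_measurable_on_iff by (intro exI[of _ "\<lambda>n t. c"]) auto

lemma strongly_measurable_on_cong_AE:
  assumes "strongly_measurable_on I f" "AE t in lebesgue_on I. f t = g t"
  shows "strongly_measurable_on I g"
proof -
  obtain s where s: "\<And>n::nat. simple_function (lebesgue_on I) (s n)"
    "AE t in lebesgue_on I. (\<lambda>n. s n t) \<longlonglongrightarrow> f t"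
    using assms(1) unfolding strongly_measurable_on_iff by blast
  have "AE t in lebesgue_on I. (\<lambda>n. s n t) \<longlonglongrightarrow> g t" using s(2) assms(2) by eventually_elim simp
  then show ?thesis using s(1) unfolding strongly_measurable_on_iff by blast
qed

lemma simple_function_lebesgue_on_iff:
  assumes "I \<in> sets lebesgue"
  shows "simple_function (lebesgue_on I) s \<longleftrightarrow> finite (s ` I) \<and> (\<forall>x. {t \<in> I. s t = x} \<in> sets lebesgue)"
proof -
  have eq: "s -` {x} \<inter> I = {t \<in> I. s t = x}" for x by auto
  have "{t \<in> I. s t = x} \<in> sets (lebesgue_on I) \<longleftrightarrow> {t \<in> I. s t = x} \<in> sets lebesgue" for x
    using assms by (subst sets_restrict_space_iff) auto
  then have "simple_function (lebesgue_on I) s \<longleftrightarrow> finite (s ` I) \<and> (\<forall>x\<in>s ` I. {t \<in> I. s t = x} \<in> sets lebesgue)"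
    by (simp add: simple_function_def eq)
  moreover have "{t \<in> I. s t = x} \<in> sets lebesgue" if "x \<notin> s ` I" for x
  proof -
    have "{t \<in> I. s t = x} = {}" using that by auto
    then show ?thesis by (simp only: sets.empty_sets)
  qed
  ultimately show ?thesis by blast
qed

lemma AE_lebesgue_on_iff:
  "I \<in> sets lebesgue \<Longrightarrow> (AE t in lebesgue_on I. P t) \<longleftrightarrow> (AE t in lebesgue. t \<in> I \<longrightarrow> P t)"
  by (simp add: AE_restrict_space_iff)

lemma AE_lebesgue_on_subset:
  assumes "AE t in lebesgue_on J. P t" "I \<subseteq> J" "I \<in> sets lebesgue" "J \<in> sets lebesgue"
  shows "AE t in lebesgue_on I. P t"
proof -
  have "AE t in lebesgue. t \<in> J \<longrightarrow> P t" using assms by (simp add: AE_lebesgue_on_iff)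
  then have "AE t in lebesgue. t \<in> I \<longrightarrow> P t" by eventually_elim (use assms(2) in blast)
  then show ?thesis using assms by (simp add: AE_lebesgue_on_iff)
qed

lemma strongly_measurable_on_subset:
  assumes "strongly_measurable_on J f" "I \<subseteq> J" "I \<in> sets lebesgue" "J \<in> sets lebesgue"
  shows "strongly_measurable_on I f"
proof -
  obtain s where s: "\<And>n::nat. simple_function (lebesgue_on J) (s n)"
    "AE t in lebesgue_on J. (\<lambda>n. s n t) \<longlonglongrightarrow> f t"
    using assms(1) unfolding strongly_measurable_on_iff by blast
  have "simple_function (lebesgue_on I) (s n)" for n
  proof -
    have *: "finite (s n ` J)" "\<And>x. {t \<in> J. s n t = x} \<in> sets lebesgue"
      using s(1)[of n] assms(4) by (auto simp: simple_function_lebesgue_on_iff)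
    have "{t \<in> I. s n t = x} = {t \<in> J. s n t = x} \<inter> I" for x using assms(2) by auto
    then show ?thesis
      using * assms by (auto simp: simple_function_lebesgue_on_iff intro: finite_subset[OF image_mono])
  qed
  then show ?thesis
    using AE_lebesgue_on_subset[OF s(2) assms(2-4)] unfolding strongly_measurable_on_iff by blast
qed

lemma AE_lebesgue_on_join:
  assumes "AE t in lebesgue_on {a<..<b}. P t" "AE t in lebesgue_on {b<..<c}. P t"
  shows "AE t in lebesgue_on {a<..<c :: real}. P t"
proof -
  have 1: "AE t in lebesgue. t \<in> {a<..<b} \<longrightarrow> P t"
    by (rule AE_lebesgue_on_iff[THEN iffD1, OF _ assms(1)]) simp
  have 2: "AE t in lebesgue. t \<in> {b<..<c} \<longrightarrow> P t"
    by (rule AE_lebesgue_on_iff[THEN iffD1, OF _ assms(2)]) simp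
  have 3: "AE t in lebesgue. t \<noteq> b"
    by (rule AE_I'[of "{b}"]) auto
  from 1 2 3 have "AE t in lebesgue. t \<in> {a<..<c} \<longrightarrow> P t"
  proof eventually_elim
    case (elim t)
    then show ?case by (cases "t < b") auto
  qed
  then show ?thesis by (intro AE_lebesgue_on_iff[THEN iffD2]) simp_all
qed

lemma strongly_measurable_on_join:
  assumes "strongly_measurable_on {a<..<b} f" "strongly_measurable_on {b<..<c} f" "a \<le> b" "b \<le> c"
  shows "strongly_measurable_on {a<..<c} f"
proof -
  obtain s where s: "\<And>n::nat. simple_function (lebesgue_on {a<..<b}) (s n)"
    "AE t in lebesgue_on {a<..<b}. (\<lambda>n. s n t) \<longlonglongrightarrow> f t"
    using assms(1) unfolding strongly_measurable_on_iff by blast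
  obtain r where r: "\<And>n::nat. simple_function (lebesgue_on {b<..<c}) (r n)"
    "AE t in lebesgue_on {b<..<c}. (\<lambda>n. r n t) \<longlonglongrightarrow> f t"
    using assms(2) unfolding strongly_measurable_on_iff by blast
  define q where "q n t = (if t < b then s n t else if b < t then r n t else 0)" for n t
  have "simple_function (lebesgue_on {a<..<c}) (q n)" for n
  proof -
    have s': "finite (s n ` {a<..<b})" "\<And>x. {t \<in> {a<..<b}. s n t = x} \<in> sets lebesgue"
      using s(1)[of n] by (auto simp: simple_function_lebesgue_on_iff)
    have r': "finite (r n ` {b<..<c})" "\<And>x. {t \<in> {b<..<c}. r n t = x} \<in> sets lebesgue"
      using r(1)[of n] by (auto simp: simple_function_lebesgue_on_iff)
    have "q n ` {a<..<c} \<subseteq> s n ` {a<..<b} \<union> r n ` {b<..<c} \<union> {0}"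
      by (auto simp: q_def)
    moreover have "finite (s n ` {a<..<b} \<union> r n ` {b<..<c} \<union> {0})" using s'(1) r'(1) by simp
    ultimately have 1: "finite (q n ` {a<..<c})" by (rule finite_subset)
    have eq: "{t \<in> {a<..<c}. q n t = x} = {t \<in> {a<..<b}. s n t = x} \<union> {t \<in> {b<..<c}. r n t = x} \<union>
      (if x = 0 \<and> b \<in> {a<..<c} then {b} else {})" for x
    proof (rule set_eqI)
      fix t
      consider "t < b" | "t = b" | "b < t" by linarith
      then show "t \<in> {t \<in> {a<..<c}. q n t = x} \<longleftrightarrow> t \<in> {t \<in> {a<..<b}. s n t = x} \<union>
          {t \<in> {b<..<c}. r n t = x} \<union> (if x = 0 \<and> b \<in> {a<..<c} then {b} else {})"
        by cases (use assms(3,4) in \<open>auto simp: q_def\<close>)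
    qed
    have "{t \<in> {a<..<c}. q n t = x} \<in> sets lebesgue" for x
      unfolding eq by (intro sets.Un s'(2) r'(2)) simp
    with 1 show ?thesis by (subst simple_function_lebesgue_on_iff) auto
  qed
  moreover have "AE t in lebesgue_on {a<..<c}. (\<lambda>n. q n t) \<longlonglongrightarrow> f t"
  proof (rule AE_lebesgue_on_join)
    have "AE t in lebesgue_on {a<..<b}. t < b" "AE t in lebesgue_on {b<..<c}. b < t"
      by (simp_all add: AE_lebesgue_on_iff)
    from this(1) s(2) show "AE t in lebesgue_on {a<..<b}. (\<lambda>n. q n t) \<longlonglongrightarrow> f t"
      by eventually_elim (simp add: q_def)
    from \<open>AE t in lebesgue_on {b<..<c}. b < t\<close> r(2)
    show "AE t in lebesgue_on {b<..<c}. (\<lambda>n. q n t) \<longlonglongrightarrow> f t"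
      by eventually_elim (simp add: q_def)
  qed
  ultimately show ?thesis unfolding strongly_measurable_on_iff by blast
qed

lemma strongly_measurable_on_imp_borel:
  fixes f :: "real \<Rightarrow> 'b::euclidean_space"
  assumes f: "strongly_measurable_on I f" and I: "I \<in> sets lebesgue"
  shows "f \<in> borel_measurable (lebesgue_on I)"
proof -
  obtain s where s: "\<And>n::nat. simple_function (lebesgue_on I) (s n)"
    "AE t in lebesgue_on I. (\<lambda>n. s n t) \<longlonglongrightarrow> f t"
    using f unfolding strongly_measurable_on_iff by blast
  have "AE t in lebesgue. t \<in> I \<longrightarrow> (\<lambda>n. s n t) \<longlonglongrightarrow> f t"
    using s(2) I by (simp add: AE_lebesgue_on_iff)
  then obtain N where N: "N \<in> null_sets lebesgue"
    "{t. \<not> (t \<in> I \<longrightarrow> (\<lambda>n. s n t) \<longlonglongrightarrow> f t)} \<subseteq> N"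
    unfolding eventually_ae_filter by auto
  have NI: "I - N \<in> sets lebesgue" using N(1) I by auto
  have "(\<lambda>t. if t \<in> I - N then s n t else 0) \<in> borel_measurable lebesgue" for n
  proof -
    have "s n \<in> borel_measurable (lebesgue_on I)" using s(1) by (rule borel_measurable_simple_function)
    then have "s n \<in> borel_measurable (lebesgue_on (I - N))"
      using measurable_restrict_mono by blast
    then show ?thesis by (rule borel_measurable_if_I[OF _ NI])
  qed
  then have "(\<lambda>t. if t \<in> I - N then f t else 0) \<in> borel_measurable lebesgue"
    by (rule borel_measurable_LIMSEQ_metric) (use N(2) in auto)
  moreover have "AE t in lebesgue. (if t \<in> I - N then f t else 0) = (if t \<in> I then f t else 0)"
    by (rule AE_I'[OF N(1)]) auto
  ultimately have "(\<lambda>t. if t \<in> I then f t else 0) \<in> borel_measurable lebesgue"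
    by (rule borel_measurable_AE)
  then show ?thesis by (rule borel_measurable_if_D)
qed

lemma borel_imp_strongly_measurable_on:
  fixes f :: "real \<Rightarrow> 'b::euclidean_space"
  assumes "f \<in> borel_measurable (lebesgue_on I)"
  shows "strongly_measurable_on I f"
  using borel_measurable_implies_sequence_metric[OF assms, of 0]
  unfolding strongly_measurable_on_iff by (auto intro!: AE_I2 elim!: ex_forward)

lemma strongly_measurable_on_norm:
  "strongly_measurable_on I f \<Longrightarrow> strongly_measurable_on I (\<lambda>t. norm (f t))"
  by (rule strongly_measurable_on_continuous2[of I f "\<lambda>t. 0 :: real" "\<lambda>x y. norm x"])
    (auto intro!: strongly_measurable_on_const continuous_intros)

lemma strongly_measurable_on_diff:
  "strongly_measurable_on I f \<Longrightarrow> strongly_measurable_on I g \<Longrightarrow> strongly_measurable_on I (\<lambda>t. f t - g t)"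
  by (rule strongly_measurable_on_continuous2[where h = "(-)"]) (auto intro!: continuous_intros)

lemma strongly_measurable_on_blinfun_apply:
  "strongly_measurable_on I f \<Longrightarrow> strongly_measurable_on I g \<Longrightarrow>
    strongly_measurable_on I (\<lambda>t. blinfun_apply (f t) (g t))"
  by (rule strongly_measurable_on_continuous2[where h = blinfun_apply]) (auto intro!: continuous_intros)

lemma norm_power2_measurable:
  assumes "strongly_measurable_on I f" "I \<in> sets lebesgue"
  shows "(\<lambda>t. (norm (f t))\<^sup>2) \<in> borel_measurable (lebesgue_on I)"
  using strongly_measurable_on_imp_borel[OF strongly_measurable_on_norm[OF assms(1)] assms(2)] by measurable

lemma L2_on_bounded_by:
  assumes h: "strongly_measurable_on I h" and I: "I \<in> sets lebesgue"
    and g: "integrable (lebesgue_on I) g" and le: "AE t in lebesgue_on I. (norm (h t))\<^sup>2 \<le> g t"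
  shows "L2_on I h"
  unfolding L2_on_def
proof (intro conjI h)
  show "integrable (lebesgue_on I) (\<lambda>t. (norm (h t))\<^sup>2)"
    by (rule Bochner_Integration.integrable_bound[OF g norm_power2_measurable[OF h I]])
      (use le in \<open>auto elim: eventually_mono\<close>)
qed

lemma L2_on_diff:
  assumes f: "L2_on I f" and g: "L2_on I g" and I: "I \<in> sets lebesgue"
  shows "L2_on I (\<lambda>t. f t - g t)"
proof (rule L2_on_bounded_by[OF _ I])
  show "strongly_measurable_on I (\<lambda>t. f t - g t)"
    using f g by (auto simp: L2_on_def intro: strongly_measurable_on_diff)
  show "integrable (lebesgue_on I) (\<lambda>t. 2 * (norm (f t))\<^sup>2 + 2 * (norm (g t))\<^sup>2)"
    using f g by (auto simp: L2_on_def)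
  have "(norm (x - y))\<^sup>2 \<le> 2 * (norm x)\<^sup>2 + 2 * (norm y)\<^sup>2" for x y :: 'a
  proof -
    have "(norm (x - y))\<^sup>2 \<le> (norm x + norm y)\<^sup>2" by (intro power_mono norm_triangle_ineq4) auto
    also have "\<dots> \<le> 2 * (norm x)\<^sup>2 + 2 * (norm y)\<^sup>2"
      using zero_le_power2[of "norm x - norm y"] by (simp add: power2_sum power2_diff)
    finally show ?thesis .
  qed
  then show "AE t in lebesgue_on I. (norm (f t - g t))\<^sup>2 \<le> 2 * (norm (f t))\<^sup>2 + 2 * (norm (g t))\<^sup>2"
    by simp
qed

lemma L2_on_blinfun_apply:
  assumes K: "strongly_measurable_on I K" "AE t in lebesgue_on I. norm (K t) \<le> C"
    and f: "L2_on I f" and I: "I \<in> sets lebesgue"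
  shows "L2_on I (\<lambda>t. blinfun_apply (K t) (f t))"
proof (rule L2_on_bounded_by[OF _ I])
  show "strongly_measurable_on I (\<lambda>t. blinfun_apply (K t) (f t))"
    using K f by (auto simp: L2_on_def intro: strongly_measurable_on_blinfun_apply)
  show "integrable (lebesgue_on I) (\<lambda>t. C\<^sup>2 * (norm (f t))\<^sup>2)"
    using f by (auto simp: L2_on_def)
  show "AE t in lebesgue_on I. (norm (blinfun_apply (K t) (f t)))\<^sup>2 \<le> C\<^sup>2 * (norm (f t))\<^sup>2"
    using K(2)
  proof eventually_elim
    case (elim t)
    have "norm (blinfun_apply (K t) (f t)) \<le> C * norm (f t)"
      using norm_blinfun[of "K t" "f t"] elim by (meson mult_right_mono norm_ge_zero order_trans)
    then show ?case by (metis norm_ge_zero power_mono power_mult_distrib)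
  qed
qed

lemma integrable_dual_pairing:
  fixes g :: "real \<Rightarrow> 'a::real_normed_vector \<Rightarrow>\<^sub>L real"
  assumes g: "L2_on I g" and f: "L2_on I f" and I: "I \<in> sets lebesgue"
  shows "integrable (lebesgue_on I) (\<lambda>t. g t (f t))"
proof (rule Bochner_Integration.integrable_bound)
  show "integrable (lebesgue_on I) (\<lambda>t. (norm (g t))\<^sup>2 + (norm (f t))\<^sup>2)"
    using f g by (auto simp: L2_on_def)
  show "(\<lambda>t. g t (f t)) \<in> borel_measurable (lebesgue_on I)"
    using f g I by (intro strongly_measurable_on_imp_borel strongly_measurable_on_blinfun_apply)
      (auto simp: L2_on_def)
  have "\<bar>g t (f t)\<bar> \<le> (norm (g t))\<^sup>2 + (norm (f t))\<^sup>2" for t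
  proof -
    have "\<bar>g t (f t)\<bar> \<le> norm (g t) * norm (f t)" using norm_blinfun[of "g t" "f t"] by simp
    also have "\<dots> \<le> (norm (g t))\<^sup>2 + (norm (f t))\<^sup>2"
      using sum_squares_bound[of "norm (g t)" "norm (f t)"]
        mult_nonneg_nonneg[OF norm_ge_zero[of "g t"] norm_ge_zero[of "f t"]] by linarith
    finally show ?thesis .
  qed
  then show "AE t in lebesgue_on I. norm (g t (f t)) \<le> norm ((norm (g t))\<^sup>2 + (norm (f t))\<^sup>2)"
    by (auto simp: abs_of_nonneg)
qed

lemma L2_on_const: "L2_on {a<..<b} (\<lambda>t. c)"
  using integrable_lebesgue_on_Ioo_iff[of a b "\<lambda>t. (norm c)\<^sup>2"]
  by (auto simp: L2_on_def strongly_measurable_on_const intro: absolutely_integrable_continuous_real)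

lemma L2_on_subset:
  assumes "L2_on J f" "I \<subseteq> J" "I \<in> sets lebesgue" "J \<in> sets lebesgue"
  shows "L2_on I f"
proof -
  have "integrable (lebesgue_on I) (\<lambda>t. (norm (f t))\<^sup>2)"
    using assms set_integrable_subset[of lebesgue J "\<lambda>t. (norm (f t))\<^sup>2" I]
    by (simp add: L2_on_def set_integrable_def integrable_restrict_space)
  then show ?thesis
    using assms strongly_measurable_on_subset by (auto simp: L2_on_def)
qed

lemma L2_on_join:
  assumes "L2_on {a<..<b} f" "L2_on {b<..<c} f" "a \<le> b" "b \<le> c"
  shows "L2_on {a<..<c} f"
proof -
  have "(\<lambda>t. (norm (f t))\<^sup>2) absolutely_integrable_on {a..b}"
    "(\<lambda>t. (norm (f t))\<^sup>2) absolutely_integrable_on {b..c}"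
    using assms by (auto simp: L2_on_def integrable_lebesgue_on_Ioo_iff)
  then have "(\<lambda>t. (norm (f t))\<^sup>2) absolutely_integrable_on {a..c}"
    using assms by (auto simp: absolutely_integrable_on_def intro: Henstock_Kurzweil_Integration.integrable_combine)
  then show ?thesis
    using assms strongly_measurable_on_join by (auto simp: L2_on_def integrable_lebesgue_on_Ioo_iff)
qed

lemma L2_on_cong_AE:
  assumes f: "L2_on I f" and I: "I \<in> sets lebesgue" and eq: "AE t in lebesgue_on I. f t = g t"
  shows "L2_on I g"
proof (rule L2_on_bounded_by[OF _ I])
  show "strongly_measurable_on I g"
    using f eq strongly_measurable_on_cong_AE by (auto simp: L2_on_def)
  show "integrable (lebesgue_on I) (\<lambda>t. (norm (f t))\<^sup>2)" using f by (simp add: L2_on_def)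
  show "AE t in lebesgue_on I. (norm (g t))\<^sup>2 \<le> (norm (f t))\<^sup>2" using eq by eventually_elim simp
qed

lemma L2_on_Ioo_norm_integrable:
  assumes "L2_on {a<..<b} f"
  shows "(\<lambda>t. (norm (f t))\<^sup>2) absolutely_integrable_on {a..b}"
  using assms by (simp add: L2_on_def integrable_lebesgue_on_Ioo_iff)

lemma L2_on_Ioo_norm_integrable1:
  assumes f: "L2_on {a<..<b} f"
  shows "(\<lambda>t. norm (f t)) absolutely_integrable_on {a..b}"
proof -
  have "integrable (lebesgue_on {a<..<b}) (\<lambda>t. norm (f t))"
  proof (rule Bochner_Integration.integrable_bound)
    show "integrable (lebesgue_on {a<..<b}) (\<lambda>t. (norm (f t))\<^sup>2 + (norm (1::real))\<^sup>2)"
      using f L2_on_const[of a b "1 :: real"] by (auto simp: L2_on_def simp del: norm_one)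
    show "(\<lambda>t. norm (f t)) \<in> borel_measurable (lebesgue_on {a<..<b})"
      using f by (intro strongly_measurable_on_imp_borel strongly_measurable_on_norm) (auto simp: L2_on_def)
    have "x \<le> x\<^sup>2 + 1" for x :: real
      using zero_le_power2[of "x - 1 / 2"] by (simp add: power2_diff power_divide)
    then show "AE t in lebesgue_on {a<..<b}. norm (norm (f t)) \<le> norm ((norm (f t))\<^sup>2 + (norm (1::real))\<^sup>2)"
      by (simp add: abs_of_nonneg)
  qed
  then show ?thesis by (simp add: integrable_lebesgue_on_Ioo_iff)
qed

lemma L2_on_Ioo_apply_integrable:
  fixes g :: "real \<Rightarrow> 'a::real_normed_vector \<Rightarrow>\<^sub>L real"
  assumes "L2_on {a<..<b} g"
  shows "(\<lambda>t. g t w) absolutely_integrable_on {a..b}"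
  using integrable_dual_pairing[OF assms L2_on_const[of a b w]] by (simp add: integrable_lebesgue_on_Ioo_iff)

text \<open>
  The integrated form can be restricted to subintervals and glued along them, which is awkward
  with compactly supported test functions. It is also the form in which products of paths
  can be treated by Riemann sums.
\<close>

lemma W_deriv_iff_integral:
  assumes "a \<le> b"
  shows "W_deriv \<iota> a b y g \<longleftrightarrow>
    continuous_on {a..b} y \<and>
    (AE t in lebesgue_on {a<..<b}. y t \<in> range (blinfun_apply \<iota>)) \<and>
    L2_on {a<..<b} (in_V \<iota> y) \<and> L2_on {a<..<b} g \<and>
    (\<forall>w s t. a \<le> s \<longrightarrow> s \<le> t \<longrightarrow> t \<le> b \<longrightarrow> ((\<lambda>r. g r w) has_integral (y t - y s) \<bullet> \<iota> w) {s..t})"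
  (is "_ \<longleftrightarrow> ?c \<and> ?r \<and> ?v \<and> ?g \<and> ?i")
proof -
  have "(\<forall>\<phi> w. test_function {a<..<b} \<phi> \<longrightarrow>
      (LINT t|lebesgue_on {a<..<b}. deriv \<phi> t * (y t \<bullet> \<iota> w)) =
      - (LINT t|lebesgue_on {a<..<b}. \<phi> t * g t w)) \<longleftrightarrow> ?i" if c: ?c and g: ?g
  proof
    have F: "continuous_on {a..b} (\<lambda>t. y t \<bullet> \<iota> w)" for w by (intro continuous_intros c)
    note G = L2_on_Ioo_apply_integrable[OF g]
    {
      assume *: "\<forall>\<phi> w. test_function {a<..<b} \<phi> \<longrightarrow>
        (LINT t|lebesgue_on {a<..<b}. deriv \<phi> t * (y t \<bullet> \<iota> w)) =
        - (LINT t|lebesgue_on {a<..<b}. \<phi> t * g t w)"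
      then show ?i
        using weak_derivative_imp_integral[OF F G] by (simp add: inner_diff_left)
    next
      assume ?i
      then show "\<forall>\<phi> w. test_function {a<..<b} \<phi> \<longrightarrow>
        (LINT t|lebesgue_on {a<..<b}. deriv \<phi> t * (y t \<bullet> \<iota> w)) =
        - (LINT t|lebesgue_on {a<..<b}. \<phi> t * g t w)"
        using integral_imp_weak_derivative[OF assms F G] by (simp add: inner_diff_left)
    }
  qed
  then show ?thesis unfolding W_deriv_def by blast
qed

section \<open>The energy identity and the energy estimate\<close>

lemma in_V_eq: "y t \<in> range (blinfun_apply \<iota>) \<Longrightarrow> \<iota> (in_V \<iota> y t) = y t"
  unfolding in_V_def by (rule f_inv_into_f)

lemma W_deriv_in_V_AE:
  assumes "W_deriv \<iota> a b y g"
  shows "AE t in lebesgue_on {a<..<b}. \<iota> (in_V \<iota> y t) = y t"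
proof -
  have "AE t in lebesgue_on {a<..<b}. y t \<in> range (blinfun_apply \<iota>)"
    using assms by (simp add: W_deriv_def)
  then show ?thesis by eventually_elim (rule in_V_eq)
qed

lemma W_deriv_subinterval:
  assumes W: "W_deriv \<iota> a b y g" and st: "a \<le> s" "s \<le> t" "t \<le> b"
  shows "W_deriv \<iota> s t y g"
proof -
  have ab: "a \<le> b" using st by simp
  have sub: "{s<..<t} \<subseteq> {a<..<b}" using st by auto
  note I = W[unfolded W_deriv_iff_integral[OF ab]]
  show ?thesis unfolding W_deriv_iff_integral[OF st(2)]
  proof (intro conjI allI impI)
    show "continuous_on {s..t} y" using I st by (auto intro: continuous_on_subset)
    show "AE t in lebesgue_on {s<..<t}. y t \<in> range (blinfun_apply \<iota>)"
      by (rule AE_lebesgue_on_subset[OF _ sub]) (use I in auto)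
    show "L2_on {s<..<t} (in_V \<iota> y)" "L2_on {s<..<t} g"
      using I by (auto intro!: L2_on_subset[OF _ sub])
    show "((\<lambda>r. g r w) has_integral (y t' - y s') \<bullet> \<iota> w) {s'..t'}"
      if "s \<le> s'" "s' \<le> t'" "t' \<le> t" for w s' t'
      using I that st by auto
  qed
qed

lemma L2_on_smoothed:
  fixes P :: "'h::{real_inner,banach} \<Rightarrow>\<^sub>L 'v::{real_inner,banach}"
  assumes W: "W_deriv \<iota> a b y g"
  shows "L2_on {a<..<b} (\<lambda>r. P (y r))"
proof (rule L2_on_cong_AE)
  have "L2_on {a<..<b} (in_V \<iota> y)" using W by (simp add: W_deriv_def)
  then show "L2_on {a<..<b} (\<lambda>r. blinfun_apply (P o\<^sub>L \<iota>) (in_V \<iota> y r))"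
    by (intro L2_on_blinfun_apply[where C = "norm (P o\<^sub>L \<iota>)"] strongly_measurable_on_const) auto
  show "AE r in lebesgue_on {a<..<b}. blinfun_apply (P o\<^sub>L \<iota>) (in_V \<iota> y r) = P (y r)"
    using W_deriv_in_V_AE[OF W] by eventually_elim simp
qed simp

text \<open>
  By symmetry, \<open>q t = y t \<bullet> \<iota> (P (y t))\<close> satisfies
  \<open>q t - q s = (y t - y s) \<bullet> \<iota> (P (y t) + P (y s))\<close>, which is the integral of
  \<open>g r (P (y t) + P (y s))\<close> over \<open>{s..t}\<close>. As \<open>P \<circ> y\<close> is continuous in \<open>V\<close>, replacing
  \<open>P (y t) + P (y s)\<close> by \<open>2 P (y r)\<close> costs little on short intervals.
\<close>

lemma smoothed_energy_identity:
  fixes \<iota> :: "'v::{real_inner,banach} \<Rightarrow>\<^sub>L 'h::{real_inner,banach}" and P :: "'h \<Rightarrow>\<^sub>L 'v"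
  assumes ab: "a \<le> b" and W: "W_deriv \<iota> a b y g"
    and sym: "\<And>h k. h \<bullet> \<iota> (P k) = \<iota> (P h) \<bullet> k"
  shows "(LINT r|lebesgue_on {a<..<b}. 2 * g r (P (y r))) = y b \<bullet> \<iota> (P (y b)) - y a \<bullet> \<iota> (P (y a))"
proof -
  note I = W[unfolded W_deriv_iff_integral[OF ab]]
  have yc: "continuous_on {a..b} y" and gL: "L2_on {a<..<b} g"
    and int: "\<And>w s t. a \<le> s \<Longrightarrow> s \<le> t \<Longrightarrow> t \<le> b \<Longrightarrow>
      ((\<lambda>r. g r w) has_integral (y t - y s) \<bullet> \<iota> w) {s..t}"
    using I by auto
  define q where "q t = y t \<bullet> \<iota> (P (y t))" for t
  define k where "k r = 2 * g r (P (y r))" for r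
  have "integrable (lebesgue_on {a<..<b}) (\<lambda>r. g r (P (y r)))"
    by (rule integrable_dual_pairing[OF gL L2_on_smoothed[OF W]]) simp
  then have kA: "k absolutely_integrable_on {a..b}"
    unfolding k_def using integrable_lebesgue_on_Ioo_iff[of a b "\<lambda>r. 2 * g r (P (y r))"] by simp
  have "(k has_integral q b - q a) {a..b}"
  proof (rule has_integral_by_local_approximation[OF ab])
    show "k integrable_on {a..b}" using kA by (simp add: absolutely_integrable_on_def)
    show "(\<lambda>r. norm (g r)) integrable_on {a..b}"
      using L2_on_Ioo_norm_integrable1[OF gL] by (simp add: absolutely_integrable_on_def)
    fix e :: real assume "e > 0"
    moreover have "continuous_on {a..b} (\<lambda>t. P (y t))" by (intro continuous_intros yc)
    ultimately obtain d where d: "d > 0"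
      "\<forall>x\<in>{a..b}. \<forall>x'\<in>{a..b}. \<bar>x' - x\<bar> < d \<longrightarrow> norm (P (y x') - P (y x)) < e / 2"
      using uniform_modulus half_gt_zero by blast
    show "\<exists>\<delta>>0. \<forall>s t. a \<le> s \<and> s \<le> t \<and> t \<le> b \<and> t - s < \<delta> \<longrightarrow>
      (\<exists>G. (G has_integral q t - q s) {s..t} \<and> (\<forall>r\<in>{s..t}. \<bar>G r - k r\<bar> \<le> e * norm (g r)))"
    proof (intro exI[of _ d] conjI allI impI)
      fix s t assume st: "a \<le> s \<and> s \<le> t \<and> t \<le> b \<and> t - s < d"
      define w where "w = P (y t) + P (y s)"
      have "q t - q s = (y t - y s) \<bullet> \<iota> w"
        using sym[of "y t" "y s"] by (simp add: q_def w_def blinfun.add_right inner_simps inner_commute)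
      then have G: "((\<lambda>r. g r w) has_integral q t - q s) {s..t}" using int[of s t w] st by simp
      have "\<bar>g r w - k r\<bar> \<le> e * norm (g r)" if r: "r \<in> {s..t}" for r
      proof -
        have "g r w - k r = g r ((P (y t) - P (y r)) + (P (y s) - P (y r)))"
          by (simp add: w_def k_def blinfun.bilinear_simps)
        also have "\<bar>\<dots>\<bar> \<le> norm (g r) * norm ((P (y t) - P (y r)) + (P (y s) - P (y r)))"
          using norm_blinfun[of "g r"] by simp
        also have "\<dots> \<le> norm (g r) * e"
        proof (rule mult_left_mono)
          have "norm (P (y t) - P (y r)) < e / 2" "norm (P (y s) - P (y r)) < e / 2"
            using d(2)[rule_format, of r t] d(2)[rule_format, of r s] st r by auto
          then show "norm ((P (y t) - P (y r)) + (P (y s) - P (y r))) \<le> e"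
            using norm_triangle_ineq[of "P (y t) - P (y r)" "P (y s) - P (y r)"] by linarith
        qed simp
        finally show ?thesis by (simp add: mult.commute)
      qed
      with G show "\<exists>G. (G has_integral q t - q s) {s..t} \<and> (\<forall>r\<in>{s..t}. \<bar>G r - k r\<bar> \<le> e * norm (g r))"
        by blast
    qed (use d in auto)
  qed
  then show ?thesis using integral_lebesgue_on_Ioo[OF kA] by (simp add: k_def q_def integral_unique)
qed

text \<open>
  The lemma of Lions and Magenes. The smoothed identities pass to the limit because the smoothing
  operators are uniformly bounded on \<open>V\<close>, so that the integrands are dominated by a multiple of
  \<open>|g|\<^sup>2 + |in_V \<iota> y|\<^sup>2\<close>.
\<close>

lemma energy_identity:
  fixes \<iota> :: "'v::{real_inner,banach} \<Rightarrow>\<^sub>L 'h::{real_inner,banach}"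
  assumes \<iota>: "gelfand_embedding \<iota>" and ab: "a \<le> b" and W: "W_deriv \<iota> a b y g"
  shows "(LINT r|lebesgue_on {a<..<b}. 2 * g r (in_V \<iota> y r)) = (norm (y b))\<^sup>2 - (norm (y a))\<^sup>2"
proof -
  obtain B :: "nat \<Rightarrow> 'h \<Rightarrow>\<^sub>L 'v" where B: "\<And>n h k. h \<bullet> \<iota> (B n k) = \<iota> (B n h) \<bullet> k"
    "\<And>h. (\<lambda>n. \<iota> (B n h)) \<longlonglongrightarrow> h" "\<And>v. (\<lambda>n. B n (\<iota> v)) \<longlonglongrightarrow> v" "\<And>n v. norm (B n (\<iota> v)) \<le> 2 * norm v"
    using smoothing_operators[of \<iota>] \<iota> unfolding gelfand_embedding_def by metis
  have vL: "L2_on {a<..<b} (in_V \<iota> y)" and gL: "L2_on {a<..<b} g"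
    using W by (simp_all add: W_deriv_def)
  note AEv = W_deriv_in_V_AE[OF W]
  have meas: "(\<lambda>r. g r (f r)) \<in> borel_measurable (lebesgue_on {a<..<b})"
    if "L2_on {a<..<b} f" for f
    using integrable_dual_pairing[OF gL that] by (auto intro: borel_measurable_integrable)
  have lim: "(\<lambda>n. LINT r|lebesgue_on {a<..<b}. 2 * g r (B n (y r))) \<longlonglongrightarrow>
      (LINT r|lebesgue_on {a<..<b}. 2 * g r (in_V \<iota> y r))"
  proof (rule integral_dominated_convergence)
    show "integrable (lebesgue_on {a<..<b}) (\<lambda>r. 2 * (norm (g r))\<^sup>2 + 2 * (norm (in_V \<iota> y r))\<^sup>2)"
      using vL gL by (auto simp: L2_on_def)
    show "AE r in lebesgue_on {a<..<b}. (\<lambda>n. 2 * g r (B n (y r))) \<longlonglongrightarrow> 2 * g r (in_V \<iota> y r)"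
      using AEv
    proof eventually_elim
      case (elim r)
      have "(\<lambda>n. 2 * g r (B n (\<iota> (in_V \<iota> y r)))) \<longlonglongrightarrow> 2 * g r (in_V \<iota> y r)"
        by (intro tendsto_intros B)
      then show ?case by (simp add: elim)
    qed
    show "AE r in lebesgue_on {a<..<b}. norm (2 * g r (B n (y r))) \<le>
        2 * (norm (g r))\<^sup>2 + 2 * (norm (in_V \<iota> y r))\<^sup>2" for n
      using AEv
    proof eventually_elim
      case (elim r)
      have "\<bar>g r (B n (y r))\<bar> \<le> norm (g r) * norm (B n (y r))" using norm_blinfun[of "g r"] by simp
      also have "\<dots> \<le> norm (g r) * (2 * norm (in_V \<iota> y r))"
        using B(4)[of n "in_V \<iota> y r"] by (intro mult_left_mono) (auto simp: elim)
      finally show ?case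
        using sum_squares_bound[of "norm (g r)" "norm (in_V \<iota> y r)"] by (simp add: abs_mult)
    qed
  qed (intro borel_measurable_times borel_measurable_const meas L2_on_smoothed[OF W] vL)+
  have "(LINT r|lebesgue_on {a<..<b}. 2 * g r (B n (y r))) =
      y b \<bullet> \<iota> (B n (y b)) - y a \<bullet> \<iota> (B n (y a))" for n
    by (rule smoothed_energy_identity[OF ab W B(1)])
  moreover have "(\<lambda>n. y b \<bullet> \<iota> (B n (y b)) - y a \<bullet> \<iota> (B n (y a))) \<longlonglongrightarrow> y b \<bullet> y b - y a \<bullet> y a"
    by (intro tendsto_intros B)
  ultimately have "(\<lambda>n. LINT r|lebesgue_on {a<..<b}. 2 * g r (B n (y r))) \<longlonglongrightarrow> y b \<bullet> y b - y a \<bullet> y a"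
    by simp
  then show ?thesis using LIMSEQ_unique[OF lim] by (simp add: power2_norm_eq_inner)
qed

lemma gronwall:
  fixes E :: "real \<Rightarrow> real"
  assumes E: "continuous_on {a..b} E" and K: "K \<ge> 0"
    and le: "\<And>t. t \<in> {a..b} \<Longrightarrow> E t \<le> C + K * integral {a..t} E" and t: "t \<in> {a..b}"
  shows "E t \<le> C * exp (K * (t - a))"
proof -
  define G where "G t = exp (- K * (t - a)) * (C + K * integral {a..t} E)" for t
  have Ei: "E integrable_on {a..b}" by (intro integrable_continuous_real E)
  have "G t \<le> G a"
  proof (rule DERIV_nonpos_imp_decreasing_open[of a t G])
    show "a \<le> t" using t by simp
    show "continuous_on {a..t} G"
      unfolding G_def
      by (intro continuous_intros continuous_on_subset[OF indefinite_integral_continuous_1[OF Ei]])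
        (use t in auto)
    fix x assume x: "a < x" "x < t"
    have "((\<lambda>t. integral {a..t} E) has_real_derivative E x) (at x within {a..b})"
      by (rule integral_has_real_derivative[OF E]) (use x t in auto)
    then have D: "((\<lambda>t. integral {a..t} E) has_real_derivative E x) (at x)"
      using x t by (subst (asm) at_within_interior) auto
    have "(G has_real_derivative exp (- K * (x - a)) * (K * E x) +
        (exp (- K * (x - a)) * (- K)) * (C + K * integral {a..x} E)) (at x)"
      unfolding G_def by (rule derivative_eq_intros D refl | simp)+
    moreover have "exp (- K * (x - a)) * (K * E x) +
        (exp (- K * (x - a)) * (- K)) * (C + K * integral {a..x} E) \<le> 0"
    proof -
      have "K * E x \<le> K * (C + K * integral {a..x} E)"
        using le[of x] x t K by (intro mult_left_mono) auto
      then have "exp (- K * (x - a)) * (K * E x) \<le> exp (- K * (x - a)) * (K * (C + K * integral {a..x} E))"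
        by (rule mult_left_mono) simp
      then show ?thesis by simp
    qed
    ultimately show "\<exists>y. (G has_real_derivative y) (at x) \<and> y \<le> 0" by blast
  qed
  then have "exp (- K * (t - a)) * (C + K * integral {a..t} E) \<le> C" by (simp add: G_def)
  then have "C + K * integral {a..t} E \<le> C * exp (K * (t - a))"
    using mult_left_mono[of "exp (- K * (t - a)) * (C + K * integral {a..t} E)" C "exp (K * (t - a))"]
    by (simp add: mult.commute flip: mult.assoc exp_add)
  then show ?thesis using le[OF t] by linarith
qed

text \<open>
  Gronwall's lemma bounds \<open>|y|\<^sup>2\<close> with the factor \<open>exp (K * L)\<close>; inserting this bound into the
  integrated inequality gives the integral of \<open>|in_V \<iota> y|\<^sup>2\<close> and the factor \<open>1 + K * L\<close>.
\<close>

lemma energy_estimate: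
  fixes \<iota> :: "'v::{real_inner,banach} \<Rightarrow>\<^sub>L 'h::{real_inner,banach}"
  assumes \<iota>: "gelfand_embedding \<iota>" and ab: "a \<le> b" "b - a \<le> L" and W: "W_deriv \<iota> a b y g"
    and K: "K \<ge> 0" and c: "c \<ge> 0"
    and F: "integrable (lebesgue_on {a<..<b}) F" and F0: "\<And>r. F r \<ge> 0"
    and ineq: "AE r in lebesgue_on {a<..<b}.
      2 * g r (in_V \<iota> y r) \<le> - c * (norm (in_V \<iota> y r))\<^sup>2 + K * (norm (y r))\<^sup>2 + F r"
  defines "S \<equiv> (norm (y a))\<^sup>2 + (LINT r|lebesgue_on {a<..<b}. F r)"
  shows "t \<in> {a..b} \<Longrightarrow> (norm (y t))\<^sup>2 \<le> (1 + K * L) * exp (K * L) * S"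
    and "c * (LINT r|lebesgue_on {a<..<b}. (norm (in_V \<iota> y r))\<^sup>2) \<le> (1 + K * L) * exp (K * L) * S"
proof -
  have yc: "continuous_on {a..b} y" using W by (simp add: W_deriv_def)
  define E where "E t = (norm (y t))\<^sup>2" for t
  have Ec: "continuous_on {a..b} E" unfolding E_def by (intro continuous_intros yc)
  have EA: "E absolutely_integrable_on {s..t}" if "a \<le> s" "t \<le> b" for s t
    by (rule absolutely_integrable_continuous_real) (use that in \<open>auto intro: continuous_on_subset[OF Ec]\<close>)
  have Sn: "S \<ge> 0" unfolding S_def using F0 by (intro add_nonneg_nonneg Bochner_Integration.integral_nonneg) auto
  have FA: "F absolutely_integrable_on {a..b}" using F by (simp add: integrable_lebesgue_on_Ioo_iff)
  have main: "E t + c * (LINT r|lebesgue_on {a<..<t}. (norm (in_V \<iota> y r))\<^sup>2) \<le> S + K * integral {a..t} E"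
    if t: "t \<in> {a..b}" for t
  proof -
    have Wt: "W_deriv \<iota> a t y g" by (rule W_deriv_subinterval[OF W]) (use t in auto)
    have vL: "L2_on {a<..<t} (in_V \<iota> y)" and gL: "L2_on {a<..<t} g"
      using Wt by (simp_all add: W_deriv_def)
    have sub: "{a<..<t} \<subseteq> {a<..<b}" using t by auto
    have FAt: "F absolutely_integrable_on {a..t}"
      by (rule absolutely_integrable_on_subinterval[OF FA]) (use t in auto)
    have Ft: "integrable (lebesgue_on {a<..<t}) F" using FAt by (simp add: integrable_lebesgue_on_Ioo_iff)
    have Et: "integrable (lebesgue_on {a<..<t}) E"
      using EA[of a t] t by (simp add: integrable_lebesgue_on_Ioo_iff)
    have vt: "integrable (lebesgue_on {a<..<t}) (\<lambda>r. (norm (in_V \<iota> y r))\<^sup>2)" using vL by (simp add: L2_on_def)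
    have "E t - E a = (LINT r|lebesgue_on {a<..<t}. 2 * g r (in_V \<iota> y r))"
      using energy_identity[OF \<iota> _ Wt] t by (simp add: E_def)
    also have "\<dots> \<le> (LINT r|lebesgue_on {a<..<t}. - c * (norm (in_V \<iota> y r))\<^sup>2 + K * E r + F r)"
    proof (rule integral_mono_AE)
      show "integrable (lebesgue_on {a<..<t}) (\<lambda>r. 2 * g r (in_V \<iota> y r))"
        by (intro integrable_mult_right integrable_dual_pairing gL vL) simp
      show "integrable (lebesgue_on {a<..<t}) (\<lambda>r. - c * (norm (in_V \<iota> y r))\<^sup>2 + K * E r + F r)"
        by (intro Bochner_Integration.integrable_add integrable_mult_right vt Et Ft)
      show "AE r in lebesgue_on {a<..<t}. 2 * g r (in_V \<iota> y r) \<le> - c * (norm (in_V \<iota> y r))\<^sup>2 + K * E r + F r"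
        unfolding E_def by (rule AE_lebesgue_on_subset[OF ineq sub]) auto
    qed
    also have "\<dots> = - c * (LINT r|lebesgue_on {a<..<t}. (norm (in_V \<iota> y r))\<^sup>2)
        + K * (LINT r|lebesgue_on {a<..<t}. E r) + (LINT r|lebesgue_on {a<..<t}. F r)"
      using vt Et Ft by (simp add: Bochner_Integration.integral_add Bochner_Integration.integrable_add)
    also have "(LINT r|lebesgue_on {a<..<t}. E r) = integral {a..t} E"
      by (rule integral_lebesgue_on_Ioo) (use EA t in auto)
    also have "(LINT r|lebesgue_on {a<..<t}. F r) \<le> (LINT r|lebesgue_on {a<..<b}. F r)"
      unfolding integral_lebesgue_on_Ioo[OF FA] integral_lebesgue_on_Ioo[OF FAt]
      by (rule Henstock_Kurzweil_Integration.integral_subset_le)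
        (use t FA FAt F0 in \<open>auto simp: absolutely_integrable_on_def\<close>)
    finally show ?thesis by (simp add: S_def E_def[of a])
  qed
  have vnn: "0 \<le> c * (LINT r|lebesgue_on {a<..<t}. (norm (in_V \<iota> y r))\<^sup>2)" for t
    using c by (intro mult_nonneg_nonneg Bochner_Integration.integral_nonneg) auto
  have gr: "E t \<le> S * exp (K * L)" if t: "t \<in> {a..b}" for t
  proof -
    have "E t \<le> S * exp (K * (t - a))"
    proof (rule gronwall[OF Ec K _ t])
      show "E t \<le> S + K * integral {a..t} E" if "t \<in> {a..b}" for t
        using main[OF that] vnn[of t] by linarith
    qed
    also have "\<dots> \<le> S * exp (K * L)"
      using Sn K t ab by (intro mult_left_mono) (auto intro!: mult_left_mono)
    finally show ?thesis .
  qed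
  have L: "L \<ge> 0" using ab by simp
  have KL: "0 \<le> K * L" using K L by simp
  show "(norm (y t))\<^sup>2 \<le> (1 + K * L) * exp (K * L) * S" if "t \<in> {a..b}"
  proof -
    have "S * exp (K * L) \<le> (1 + K * L) * (S * exp (K * L))"
      using Sn KL by (simp add: distrib_right)
    then show ?thesis using gr[OF that] by (simp add: E_def mult_ac)
  qed
  have "integral {a..b} E \<le> integral {a..b} (\<lambda>t. S * exp (K * L))"
    by (rule integral_le) (use gr Ec in \<open>auto intro: integrable_continuous_real\<close>)
  also have "\<dots> = (b - a) * (S * exp (K * L))" using ab by simp
  also have "\<dots> \<le> L * (S * exp (K * L))" using ab Sn by (intro mult_right_mono) auto
  finally have "K * integral {a..b} E \<le> K * (L * (S * exp (K * L)))" using K by (rule mult_left_mono)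
  moreover have "E b + c * (LINT r|lebesgue_on {a<..<b}. (norm (in_V \<iota> y r))\<^sup>2) \<le> S + K * integral {a..b} E"
    by (rule main) (use ab in auto)
  moreover have "S * 1 \<le> S * exp (K * L)" using Sn KL by (intro mult_left_mono) auto
  moreover have "0 \<le> E b" by (simp add: E_def)
  ultimately show "c * (LINT r|lebesgue_on {a<..<b}. (norm (in_V \<iota> y r))\<^sup>2) \<le> (1 + K * L) * exp (K * L) * S"
    by (simp add: algebra_simps)
qed

section \<open>Weak solutions of the controlled equation\<close>

text \<open>
  A part in \<open>L(H,V')\<close> or in \<open>L(V,H)\<close> costs one norm in \<open>H\<close> and one in \<open>V\<close>, never two in \<open>V\<close>; this
  makes \<open>B\<close> a lower order perturbation of \<open>A\<close>. The summand \<open>1\<close> allows for an infimum in \<open>rc_norm\<close>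
  that is not attained.
\<close>

lemma rc_space_quadratic_bound:
  fixes \<iota> :: "'v::real_inner \<Rightarrow>\<^sub>L 'h::real_inner"
  assumes "B \<in> rc_space \<iota>" "rc_norm \<iota> B \<le> C"
  shows "\<bar>B v v\<bar> \<le> (C + 1) * (norm v * norm (\<iota> v))"
proof -
  let ?N = "{norm B1 + norm B2 |(B1 :: 'h \<Rightarrow>\<^sub>L ('v \<Rightarrow>\<^sub>L real)) (B2 :: 'v \<Rightarrow>\<^sub>L 'h).
      B = (B1 o\<^sub>L \<iota>) + (dual_incl \<iota> o\<^sub>L B2)}"
  have "?N \<noteq> {}" using assms(1) unfolding rc_space_def by blast
  moreover have "Inf ?N < C + 1" using assms(2) unfolding rc_norm_def by linarith
  ultimately obtain x where x: "x \<in> ?N" "x < C + 1" using cInf_lessD by meson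
  then obtain B1 :: "'h \<Rightarrow>\<^sub>L ('v \<Rightarrow>\<^sub>L real)" and B2 :: "'v \<Rightarrow>\<^sub>L 'h"
    where B: "B = (B1 o\<^sub>L \<iota>) + (dual_incl \<iota> o\<^sub>L B2)" and n: "norm B1 + norm B2 < C + 1"
    by blast
  have "B v v = B1 (\<iota> v) v + B2 v \<bullet> \<iota> v" by (simp add: B blinfun.add_left)
  then have "\<bar>B v v\<bar> \<le> \<bar>B1 (\<iota> v) v\<bar> + \<bar>B2 v \<bullet> \<iota> v\<bar>" by simp
  also have "\<bar>B1 (\<iota> v) v\<bar> \<le> norm B1 * norm (\<iota> v) * norm v"
  proof -
    have "\<bar>B1 (\<iota> v) v\<bar> \<le> norm (B1 (\<iota> v)) * norm v" using norm_blinfun[of "B1 (\<iota> v)" v] by simp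
    also have "\<dots> \<le> norm B1 * norm (\<iota> v) * norm v" by (intro mult_right_mono norm_blinfun) simp
    finally show ?thesis .
  qed
  also have "\<bar>B2 v \<bullet> \<iota> v\<bar> \<le> norm B2 * norm v * norm (\<iota> v)"
  proof -
    have "\<bar>B2 v \<bullet> \<iota> v\<bar> \<le> norm (B2 v) * norm (\<iota> v)" by (rule Cauchy_Schwarz_ineq2)
    also have "\<dots> \<le> norm B2 * norm v * norm (\<iota> v)" by (intro mult_right_mono norm_blinfun) simp
    finally show ?thesis .
  qed
  finally have "\<bar>B v v\<bar> \<le> (norm B1 + norm B2) * (norm v * norm (\<iota> v))" by (simp add: algebra_simps)
  also have "\<dots> \<le> (C + 1) * (norm v * norm (\<iota> v))" using n by (intro mult_right_mono) auto
  finally show ?thesis .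
qed

text \<open>
  Young's inequality: half of the coercive term absorbs the lower order terms.
\<close>

lemma parabolic_form_bound:
  fixes c R k p q x y :: real
  assumes "c > 0"
  shows "2 * (- c * x\<^sup>2 + R * (x * y) + k * x * y + p * y) \<le> - c * x\<^sup>2 + ((R + k)\<^sup>2 / c + 1) * y\<^sup>2 + p\<^sup>2"
proof -
  have "0 \<le> (c * x - (R + k) * y)\<^sup>2 / c" using assms by simp
  also have "\<dots> = c * x\<^sup>2 - 2 * (R + k) * (x * y) + (R + k)\<^sup>2 / c * y\<^sup>2"
    using assms by (simp add: power2_eq_square field_simps)
  finally have "2 * (R + k) * (x * y) \<le> c * x\<^sup>2 + (R + k)\<^sup>2 / c * y\<^sup>2" by simp
  moreover have "2 * p * y \<le> p\<^sup>2 + y\<^sup>2" by (rule sum_squares_bound)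
  ultimately show ?thesis by (simp add: algebra_simps)
qed

text \<open>
  The forcing is split into a part \<open>h\<close> dominated by the solution in \<open>V\<close>, as produced by a
  feedback or an output injection, and a given part \<open>f\<close>. The constant depends on the length of
  the interval and on \<open>k\<close>, but not on the position of the interval, so that it serves all steps
  of the algorithm.
\<close>

definition energy_constant ::
  "('v::{real_inner,banach} \<Rightarrow>\<^sub>L 'h::{real_inner,banach}) \<Rightarrow>
    (real \<Rightarrow> ('v \<Rightarrow>\<^sub>L ('v \<Rightarrow>\<^sub>L real))) \<Rightarrow> real \<Rightarrow> real \<Rightarrow> real \<Rightarrow> bool" where
  "energy_constant \<iota> \<AA> k L M \<longleftrightarrow> M \<ge> 0 \<and>
    (\<forall>a b y g h f. 0 \<le> a \<longrightarrow> a \<le> b \<longrightarrow> b - a \<le> L \<longrightarrow> W_deriv \<iota> a b y g \<longrightarrow>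
      (AE t in lebesgue_on {a<..<b}. g t = \<AA> t (in_V \<iota> y t) + dual_incl \<iota> (h t + f t) \<and>
        norm (h t) \<le> k * norm (in_V \<iota> y t)) \<longrightarrow>
      integrable (lebesgue_on {a<..<b}) (\<lambda>t. (norm (f t))\<^sup>2) \<longrightarrow>
      (\<forall>t\<in>{a..b}. (norm (y t))\<^sup>2 \<le> M * ((norm (y a))\<^sup>2 + (LINT r|lebesgue_on {a<..<b}. (norm (f r))\<^sup>2))) \<and>
      (LINT r|lebesgue_on {a<..<b}. (norm (in_V \<iota> y r))\<^sup>2)
        \<le> M * ((norm (y a))\<^sup>2 + (LINT r|lebesgue_on {a<..<b}. (norm (f r))\<^sup>2)))"

lemmas energy_constantD = energy_constant_def[THEN iffD1, THEN conjunct2, rule_format]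

text \<open>
  By coercivity of \<open>A\<close> and the bound on \<open>Arc\<close>, the pairing of \<open>y'\<close> with \<open>y\<close> satisfies the
  inequality required by \<open>energy_estimate\<close>.
\<close>

lemma forced_energy_estimate:
  fixes \<iota> :: "'v::{real_inner,banach} \<Rightarrow>\<^sub>L 'h::{real_inner,banach}"
  assumes \<iota>: "gelfand_embedding \<iota>" and A: "complete_scalar_product A"
    and Arc: "Linf_in (rc_space \<iota>) (rc_norm \<iota>) {0<..} Arc" and k: "k \<ge> 0" and L: "L \<ge> 0"
  shows "\<exists>M. energy_constant \<iota> (\<lambda>t. - A - Arc t) k L M"
proof -
  obtain c where c: "c > 0" and Ac: "\<And>v. c * (norm v)\<^sup>2 \<le> A v v"
    using complete_scalar_product_coercive[OF A] by blast
  obtain C where "AE t in lebesgue_on {0<..}. rc_norm \<iota> (Arc t) \<le> C"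
    using Arc unfolding Linf_in_def by blast
  moreover have "AE t in lebesgue_on {0<..}. Arc t \<in> rc_space \<iota>"
    using Arc unfolding Linf_in_def strongly_measurable_in_def by (auto elim: eventually_mono)
  ultimately have "AE t in lebesgue_on {0<..}. \<forall>v. \<bar>Arc t v v\<bar> \<le> (C + 1) * (norm v * norm (\<iota> v))"
    by eventually_elim (use rc_space_quadratic_bound in blast)
  then have Arc': "AE t in lebesgue_on {a<..<b}. \<forall>v. \<bar>Arc t v v\<bar> \<le> (C + 1) * (norm v * norm (\<iota> v))"
    if "0 \<le> a" for a b
    by (rule AE_lebesgue_on_subset) (use that in auto)
  define K where "K = (C + 1 + k)\<^sup>2 / c + 1"
  have K: "K \<ge> 0" using c by (simp add: K_def)
  define M0 where "M0 = (1 + K * L) * exp (K * L)"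
  have M0: "M0 \<ge> 0" using K L by (simp add: M0_def)
  show ?thesis
    unfolding energy_constant_def
  proof (rule exI[of _ "M0 + M0 / c"], rule conjI, goal_cases)
    case 1
    then show ?case using M0 c by simp
  next
    case 2
    show ?case
    proof (rule allI | rule impI)+
      fix a b y g and h f :: "real \<Rightarrow> 'h"
      assume a: "0 \<le> a" and ab: "a \<le> b" "b - a \<le> L" and W: "W_deriv \<iota> a b y g"
        and eq: "AE t in lebesgue_on {a<..<b}. g t = (- A - Arc t) (in_V \<iota> y t) + dual_incl \<iota> (h t + f t) \<and>
          norm (h t) \<le> k * norm (in_V \<iota> y t)"
        and f: "integrable (lebesgue_on {a<..<b}) (\<lambda>t. (norm (f t))\<^sup>2)"
      have ineq: "AE r in lebesgue_on {a<..<b}. 2 * g r (in_V \<iota> y r) \<le>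
          - c * (norm (in_V \<iota> y r))\<^sup>2 + K * (norm (y r))\<^sup>2 + (norm (f r))\<^sup>2"
        using eq W_deriv_in_V_AE[OF W] Arc'[OF a, of b]
      proof eventually_elim
        case (elim r)
        define v where "v = in_V \<iota> y r"
        have y: "\<iota> v = y r" using elim by (simp add: v_def)
        have hk: "norm (h r) \<le> k * norm v" using elim by (simp add: v_def)
        have "g r v = - A v v - Arc r v v + h r \<bullet> \<iota> v + f r \<bullet> \<iota> v"
          using elim by (simp add: blinfun.bilinear_simps inner_add_left flip: v_def)
        moreover have "- Arc r v v \<le> (C + 1) * (norm v * norm (\<iota> v))"
          using elim(3)[rule_format, of v] by linarith
        moreover have "h r \<bullet> \<iota> v \<le> k * norm v * norm (\<iota> v)"
          by (rule order_trans[OF norm_cauchy_schwarz]) (intro mult_right_mono hk norm_ge_zero)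
        moreover have "f r \<bullet> \<iota> v \<le> norm (f r) * norm (\<iota> v)" by (rule norm_cauchy_schwarz)
        moreover have "2 * G \<le> 2 * (- c * n + p1 + p2 + p3)"
          if "G = - a - b + d1 + d2" "- b \<le> p1" "d1 \<le> p2" "d2 \<le> p3" "c * n \<le> a"
          for G a b d1 d2 p1 p2 p3 n :: real
          using that by simp
        ultimately have "2 * g r v \<le> 2 * (- c * (norm v)\<^sup>2 + (C + 1) * (norm v * norm (\<iota> v))
            + k * norm v * norm (\<iota> v) + norm (f r) * norm (\<iota> v))"
          using Ac[of v] by blast
        also have "\<dots> \<le> - c * (norm v)\<^sup>2 + K * (norm (\<iota> v))\<^sup>2 + (norm (f r))\<^sup>2"
          unfolding K_def by (rule parabolic_form_bound[OF c])
        finally show ?case by (simp add: y flip: v_def)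
      qed
      define S where "S = (norm (y a))\<^sup>2 + (LINT r|lebesgue_on {a<..<b}. (norm (f r))\<^sup>2)"
      have S: "S \<ge> 0" unfolding S_def by (intro add_nonneg_nonneg Bochner_Integration.integral_nonneg) auto
      note est = energy_estimate[OF \<iota> ab W K less_imp_le[OF c] f zero_le_power2 ineq, folded S_def M0_def]
      have "M0 * S \<le> (M0 + M0 / c) * S" using M0 c S by (intro mult_right_mono) auto
      moreover have "(LINT r|lebesgue_on {a<..<b}. (norm (in_V \<iota> y r))\<^sup>2) \<le> M0 / c * S"
        using est(2) c by (simp add: field_simps)
      moreover have "M0 / c * S \<le> (M0 + M0 / c) * S" using M0 c S by (intro mult_right_mono) auto
      ultimately show "(\<forall>t\<in>{a..b}. (norm (y t))\<^sup>2 \<le> (M0 + M0 / c) *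
            ((norm (y a))\<^sup>2 + (LINT r|lebesgue_on {a<..<b}. (norm (f r))\<^sup>2))) \<and>
          (LINT r|lebesgue_on {a<..<b}. (norm (in_V \<iota> y r))\<^sup>2)
            \<le> (M0 + M0 / c) * ((norm (y a))\<^sup>2 + (LINT r|lebesgue_on {a<..<b}. (norm (f r))\<^sup>2))"
        using est(1) unfolding S_def[symmetric] by (meson order_trans)
    qed
  qed
qed

text \<open>
  As \<open>\<iota>\<close> is injective, the element of \<open>V\<close> behind a difference is the difference of the elements of
  \<open>V\<close>, at almost every time.
\<close>

lemma W_deriv_diff:
  fixes \<iota> :: "'v::{real_inner,banach} \<Rightarrow>\<^sub>L 'h::{real_inner,banach}"
  assumes inj: "inj (blinfun_apply \<iota>)" and ab: "a \<le> b"
    and W: "W_deriv \<iota> a b y1 g1" "W_deriv \<iota> a b y2 g2"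
  shows "W_deriv \<iota> a b (\<lambda>t. y1 t - y2 t) (\<lambda>t. g1 t - g2 t)"
    and "AE t in lebesgue_on {a<..<b}. in_V \<iota> (\<lambda>t. y1 t - y2 t) t = in_V \<iota> y1 t - in_V \<iota> y2 t"
proof -
  note I = W[unfolded W_deriv_iff_integral[OF ab]]
  let ?y = "\<lambda>t. y1 t - y2 t"
  have eq: "AE t in lebesgue_on {a<..<b}. ?y t = \<iota> (in_V \<iota> y1 t - in_V \<iota> y2 t)"
    using W_deriv_in_V_AE[OF W(1)] W_deriv_in_V_AE[OF W(2)]
    by eventually_elim (simp add: blinfun.diff_right)
  then have v: "AE t in lebesgue_on {a<..<b}. in_V \<iota> y1 t - in_V \<iota> y2 t = in_V \<iota> ?y t"
    by eventually_elim (simp only: in_V_def[of \<iota> ?y] inv_f_f[OF inj])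
  then show "AE t in lebesgue_on {a<..<b}. in_V \<iota> ?y t = in_V \<iota> y1 t - in_V \<iota> y2 t"
    by eventually_elim simp
  show "W_deriv \<iota> a b ?y (\<lambda>t. g1 t - g2 t)"
    unfolding W_deriv_iff_integral[OF ab]
  proof (intro conjI allI impI)
    show "continuous_on {a..b} ?y" using I by (auto intro: continuous_intros)
    show "AE t in lebesgue_on {a<..<b}. ?y t \<in> range (blinfun_apply \<iota>)"
      using eq by eventually_elim simp
    show "L2_on {a<..<b} (in_V \<iota> ?y)"
      by (rule L2_on_cong_AE[OF L2_on_diff _ v]) (use I in auto)
    show "L2_on {a<..<b} (\<lambda>t. g1 t - g2 t)"
      by (rule L2_on_diff) (use I in auto)
    fix w s t assume "a \<le> s" "s \<le> t" "t \<le> b"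
    then have "((\<lambda>r. g1 r w - g2 r w) has_integral (y1 t - y1 s) \<bullet> \<iota> w - (y2 t - y2 s) \<bullet> \<iota> w) {s..t}"
      using I by (intro has_integral_diff) auto
    then show "((\<lambda>r. (g1 r - g2 r) w) has_integral (?y t - ?y s) \<bullet> \<iota> w) {s..t}"
      by (simp add: blinfun.diff_left algebra_simps)
  qed
qed

lemma W_deriv_cong:
  assumes W: "W_deriv \<iota> a b y g" and eq: "\<And>t. t \<in> {a<..<b} \<Longrightarrow> g t = g' t"
  shows "W_deriv \<iota> a b y g'"
proof -
  have "L2_on {a<..<b} g'"
    by (rule L2_on_cong_AE[of _ g]) (use W eq in \<open>auto simp: W_deriv_def intro!: AE_I2\<close>)
  moreover have "(LINT t|lebesgue_on {a<..<b}. \<phi> t * g t w) = (LINT t|lebesgue_on {a<..<b}. \<phi> t * g' t w)" for \<phi> w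
    by (rule Bochner_Integration.integral_cong) (use eq in auto)
  ultimately show ?thesis using W unfolding W_deriv_def by simp
qed

lemma W_deriv_join:
  assumes abc: "a \<le> b" "b \<le> c" and W: "W_deriv \<iota> a b y g" "W_deriv \<iota> b c y g"
  shows "W_deriv \<iota> a c y g"
proof -
  have ac: "a \<le> c" using abc by simp
  note I = W(1)[unfolded W_deriv_iff_integral[OF abc(1)]] W(2)[unfolded W_deriv_iff_integral[OF abc(2)]]
  show ?thesis unfolding W_deriv_iff_integral[OF ac]
  proof (intro conjI allI impI)
    have "continuous_on ({a..b} \<union> {b..c}) y"
      by (rule continuous_on_closed_Un) (use I in auto)
    then show "continuous_on {a..c} y" using abc by (simp add: ivl_disj_un_two_touch)
    show "AE t in lebesgue_on {a<..<c}. y t \<in> range (blinfun_apply \<iota>)"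
      by (rule AE_lebesgue_on_join) (use I in auto)
    show "L2_on {a<..<c} (in_V \<iota> y)" "L2_on {a<..<c} g"
      using I abc by (auto intro: L2_on_join)
    fix w s t assume st: "a \<le> s" "s \<le> t" "t \<le> c"
    consider "t \<le> b" | "b \<le> s" | "s \<le> b" "b \<le> t" by linarith
    then show "((\<lambda>r. g r w) has_integral (y t - y s) \<bullet> \<iota> w) {s..t}"
    proof cases
      case 3
      have "((\<lambda>r. g r w) has_integral (y b - y s) \<bullet> \<iota> w + (y t - y b) \<bullet> \<iota> w) {s..t}"
        by (rule has_integral_combine[OF 3]) (use I st 3 in auto)
      then show ?thesis by (simp add: algebra_simps)
    qed (use I st in auto)
  qed
qed

lemma weak_solution_on_subinterval:
  assumes "weak_solution_on \<iota> a b \<AA> f y" "a \<le> s" "s \<le> t" "t \<le> b"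
  shows "weak_solution_on \<iota> s t \<AA> f y"
proof -
  obtain g where g: "W_deriv \<iota> a b y g" "AE t in lebesgue_on {a<..<b}. g t = \<AA> t (in_V \<iota> y t) + f t"
    using assms(1) unfolding weak_solution_on_def by blast
  have "AE t in lebesgue_on {s<..<t}. g t = \<AA> t (in_V \<iota> y t) + f t"
    by (rule AE_lebesgue_on_subset[OF g(2)]) (use assms in auto)
  then show ?thesis
    using W_deriv_subinterval[OF g(1) assms(2-4)] unfolding weak_solution_on_def by blast
qed

lemma weak_solution_on_join:
  assumes s1: "weak_solution_on \<iota> a b \<AA> f y" and s2: "weak_solution_on \<iota> b c \<AA> f y"
    and abc: "a \<le> b" "b \<le> c"
  shows "weak_solution_on \<iota> a c \<AA> f y"
proof -
  obtain g1 where g1: "W_deriv \<iota> a b y g1" "AE t in lebesgue_on {a<..<b}. g1 t = \<AA> t (in_V \<iota> y t) + f t"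
    using s1 unfolding weak_solution_on_def by blast
  obtain g2 where g2: "W_deriv \<iota> b c y g2" "AE t in lebesgue_on {b<..<c}. g2 t = \<AA> t (in_V \<iota> y t) + f t"
    using s2 unfolding weak_solution_on_def by blast
  define g where "g t = (if t < b then g1 t else g2 t)" for t
  have "W_deriv \<iota> a c y g"
    by (rule W_deriv_join[OF abc W_deriv_cong[OF g1(1)] W_deriv_cong[OF g2(1)]]) (auto simp: g_def)
  moreover have "AE t in lebesgue_on {a<..<c}. g t = \<AA> t (in_V \<iota> y t) + f t"
  proof (rule AE_lebesgue_on_join)
    have "AE t in lebesgue_on {a<..<b}. g1 t = g t" "AE t in lebesgue_on {b<..<c}. g2 t = g t"
      by (auto simp: g_def intro!: AE_I2)
    from this(1) g1(2) show "AE t in lebesgue_on {a<..<b}. g t = \<AA> t (in_V \<iota> y t) + f t"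
      by eventually_elim simp
    from \<open>AE t in lebesgue_on {b<..<c}. g2 t = g t\<close> g2(2)
    show "AE t in lebesgue_on {b<..<c}. g t = \<AA> t (in_V \<iota> y t) + f t"
      by eventually_elim simp
  qed
  ultimately show ?thesis unfolding weak_solution_on_def by blast
qed

lemma blinfun_norm_power2_le:
  assumes "norm X \<le> n"
  shows "(norm (blinfun_apply X x))\<^sup>2 \<le> n\<^sup>2 * (norm x)\<^sup>2"
proof -
  have "norm (blinfun_apply X x) \<le> n * norm x"
    using norm_blinfun[of X x] assms by (meson mult_right_mono norm_ge_zero order_trans)
  then show ?thesis by (metis norm_ge_zero power_mono power_mult_distrib)
qed

text \<open>
  The trajectory of a stabilizing feedback, cut off at the horizon, is admissible, and the energy
  estimate bounds its cost. The cost dominates the optimal control in \<open>L\<^sup>2\<close>, and the optimal state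
  is bounded by the energy estimate with this control as forcing.
\<close>

lemma optimal_pair_bounds:
  fixes \<iota> :: "'v::{real_inner,banach} \<Rightarrow>\<^sub>L 'h::{real_inner,banach}"
    and \<Phi> :: "'m::finite \<Rightarrow> 'h" and Q :: "'v \<Rightarrow>\<^sub>L 'q::{real_inner,banach}"
  assumes \<iota>: "gelfand_embedding \<iota>" and A: "complete_scalar_product A"
    and Arc: "Linf_in (rc_space \<iota>) (rc_norm \<iota>) {0<..} Arc"
    and stab: "stabilizable \<iota> (\<lambda>t. - A - Arc t) (\<lambda>t. control_op \<Phi>)" and T: "T > 0"
  shows "\<exists>C\<ge>0. \<forall>a y\<^sub>a y u. 0 \<le> a \<longrightarrow> optimal_pair \<iota> A Arc \<Phi> Q T a y\<^sub>a y u \<longrightarrow>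
    (\<forall>t\<in>{a..a + T}. (norm (y t))\<^sup>2 \<le> C * (norm y\<^sub>a)\<^sup>2) \<and>
    (LINT t|lebesgue_on {a<..<a + T}. (norm (u t))\<^sup>2) \<le> C * (norm y\<^sub>a)\<^sup>2"
proof -
  obtain K :: "real \<Rightarrow> 'v \<Rightarrow>\<^sub>L (real^'m)" where K: "Linf_on {0<..} K"
    and stable: "exponentially_stable \<iota> (\<lambda>t. - A - Arc t + (dual_incl \<iota> o\<^sub>L control_op \<Phi> o\<^sub>L K t))"
    using stab unfolding stabilizable_def by blast
  obtain \<kappa> where \<kappa>: "AE t in lebesgue_on {0<..}. norm (K t) \<le> \<kappa>" and Km: "strongly_measurable_on {0<..} K"
    using K unfolding Linf_on_def Linf_in_def by blast
  let ?\<Phi> = "control_op \<Phi>"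
  define k where "k = norm ?\<Phi> * \<bar>\<kappa>\<bar>"
  obtain M where EM: "energy_constant \<iota> (\<lambda>t. - A - Arc t) k T M"
    using forced_energy_estimate[OF \<iota> A Arc, of k T] T by (auto simp: k_def)
  then have M0: "M \<ge> 0" by (simp add: energy_constant_def)
  note M = energy_constantD[OF EM]
  define J where "J = ((norm Q)\<^sup>2 + \<kappa>\<^sup>2) * M"
  have J0: "J \<ge> 0" using M0 by (simp add: J_def)
  have QL: "integrable (lebesgue_on {a<..<b}) (\<lambda>t. (norm (Q (in_V \<iota> y t)))\<^sup>2)"
    if "W_deriv \<iota> a b y g" for a b y g
  proof -
    have "L2_on {a<..<b} (\<lambda>t. Q (in_V \<iota> y t))"
      using that by (intro L2_on_blinfun_apply[where C = "norm Q"] strongly_measurable_on_const)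
        (auto simp: W_deriv_def)
    then show ?thesis by (simp add: L2_on_def)
  qed
  have main: "(\<forall>t\<in>{a..a + T}. (norm (y t))\<^sup>2 \<le> M * (1 + (norm ?\<Phi>)\<^sup>2 * J) * (norm y\<^sub>a)\<^sup>2) \<and>
      (LINT t|lebesgue_on {a<..<a + T}. (norm (u t))\<^sup>2) \<le> J * (norm y\<^sub>a)\<^sup>2"
    if a: "0 \<le> a" and opt: "optimal_pair \<iota> A Arc \<Phi> Q T a y\<^sub>a y u" for a y\<^sub>a y u
  proof -
    let ?I = "{a<..<a + T}"
    have sub: "?I \<subseteq> {0<..}" using a by auto
    have \<kappa>I: "AE t in lebesgue_on ?I. norm (K t) \<le> \<kappa>"
      by (rule AE_lebesgue_on_subset[OF \<kappa> sub]) auto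
    have KI: "strongly_measurable_on ?I K"
      by (rule strongly_measurable_on_subset[OF Km sub]) auto
    obtain yf where "weak_solution_from \<iota> a (\<lambda>t. - A - Arc t + (dual_incl \<iota> o\<^sub>L ?\<Phi> o\<^sub>L K t)) yf"
      and yfa: "yf a = y\<^sub>a"
      using stable a unfolding exponentially_stable_def by blast
    then have "weak_solution_on \<iota> a (a + T) (\<lambda>t. - A - Arc t + (dual_incl \<iota> o\<^sub>L ?\<Phi> o\<^sub>L K t)) (\<lambda>t. 0) yf"
      using T unfolding weak_solution_from_def by simp
    then obtain g where Wf: "W_deriv \<iota> a (a + T) yf g"
      and gf: "AE t in lebesgue_on ?I. g t = (- A - Arc t + (dual_incl \<iota> o\<^sub>L ?\<Phi> o\<^sub>L K t)) (in_V \<iota> yf t) + 0"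
      unfolding weak_solution_on_def by blast
    define uf where "uf t = K t (in_V \<iota> yf t)" for t
    have vL: "L2_on ?I (in_V \<iota> yf)" using Wf by (simp add: W_deriv_def)
    have ufL: "L2_on ?I uf"
      unfolding uf_def by (rule L2_on_blinfun_apply[OF KI \<kappa>I vL]) simp
    have gf': "AE t in lebesgue_on ?I. g t = (- A - Arc t) (in_V \<iota> yf t) + dual_incl \<iota> (?\<Phi> (uf t))"
      using gf by eventually_elim (simp add: uf_def blinfun.add_left del: control_op_apply)
    then have adm: "admissible_pair \<iota> A Arc \<Phi> T a y\<^sub>a yf uf"
      using ufL Wf yfa unfolding admissible_pair_def weak_solution_on_def by blast
    have v: "(LINT r|lebesgue_on ?I. (norm (in_V \<iota> yf r))\<^sup>2) \<le> M * (norm y\<^sub>a)\<^sup>2"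
    proof -
      have "AE t in lebesgue_on ?I. g t = (- A - Arc t) (in_V \<iota> yf t) + dual_incl \<iota> (?\<Phi> (uf t) + 0) \<and>
          norm (?\<Phi> (uf t)) \<le> k * norm (in_V \<iota> yf t)"
        using gf' \<kappa>I
      proof eventually_elim
        case (elim t)
        have "norm (?\<Phi> (uf t)) \<le> norm ?\<Phi> * norm (uf t)" by (rule norm_blinfun)
        also have "\<dots> \<le> norm ?\<Phi> * (norm (K t) * norm (in_V \<iota> yf t))"
          unfolding uf_def by (intro mult_left_mono norm_blinfun) simp
        also have "\<dots> \<le> norm ?\<Phi> * (\<bar>\<kappa>\<bar> * norm (in_V \<iota> yf t))"
          using elim(2) by (intro mult_left_mono mult_right_mono) auto
        finally show ?case using elim(1) by (simp add: k_def mult_ac del: control_op_apply)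
      qed
      from M[OF a _ _ Wf this] T show ?thesis by (simp add: yfa)
    qed
    have ya: "y a = y\<^sub>a" and uL: "L2_on ?I u"
      and sol: "weak_solution_on \<iota> a (a + T) (\<lambda>t. - A - Arc t) (\<lambda>t. dual_incl \<iota> (?\<Phi> (u t))) y"
      and le: "cost \<iota> Q T a y u \<le> cost \<iota> Q T a yf uf"
      using opt adm unfolding optimal_pair_def admissible_pair_def by blast+
    obtain go where Wo: "W_deriv \<iota> a (a + T) y go"
      and go: "AE t in lebesgue_on ?I. go t = (- A - Arc t) (in_V \<iota> y t) + dual_incl \<iota> (?\<Phi> (u t))"
      using sol unfolding weak_solution_on_def by blast
    have "(LINT t|lebesgue_on ?I. (norm (u t))\<^sup>2) \<le>
        (LINT t|lebesgue_on ?I. (norm (Q (in_V \<iota> y t)))\<^sup>2 + (norm (u t))\<^sup>2)"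
      by (intro integral_mono Bochner_Integration.integrable_add QL[OF Wo])
        (use uL in \<open>auto simp: L2_on_def\<close>)
    also have "\<dots> \<le> (LINT t|lebesgue_on ?I. (norm (Q (in_V \<iota> yf t)))\<^sup>2 + (norm (uf t))\<^sup>2)"
      using le by (simp add: cost_def)
    also have "\<dots> \<le> (LINT t|lebesgue_on ?I. ((norm Q)\<^sup>2 + \<kappa>\<^sup>2) * (norm (in_V \<iota> yf t))\<^sup>2)"
    proof (rule integral_mono_AE)
      show "integrable (lebesgue_on ?I) (\<lambda>t. (norm (Q (in_V \<iota> yf t)))\<^sup>2 + (norm (uf t))\<^sup>2)"
        by (intro Bochner_Integration.integrable_add QL[OF Wf]) (use ufL in \<open>auto simp: L2_on_def\<close>)
      show "integrable (lebesgue_on ?I) (\<lambda>t. ((norm Q)\<^sup>2 + \<kappa>\<^sup>2) * (norm (in_V \<iota> yf t))\<^sup>2)"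
        using vL by (auto simp: L2_on_def)
      show "AE t in lebesgue_on ?I. (norm (Q (in_V \<iota> yf t)))\<^sup>2 + (norm (uf t))\<^sup>2
          \<le> ((norm Q)\<^sup>2 + \<kappa>\<^sup>2) * (norm (in_V \<iota> yf t))\<^sup>2"
        using \<kappa>I
      proof eventually_elim
        case (elim t)
        have "(norm (uf t))\<^sup>2 \<le> \<kappa>\<^sup>2 * (norm (in_V \<iota> yf t))\<^sup>2"
          unfolding uf_def by (rule blinfun_norm_power2_le) (rule elim)
        moreover have "(norm (Q (in_V \<iota> yf t)))\<^sup>2 \<le> (norm Q)\<^sup>2 * (norm (in_V \<iota> yf t))\<^sup>2"
          by (rule blinfun_norm_power2_le) simp
        ultimately show ?case by (simp add: distrib_right)
      qed
    qed
    also have "\<dots> \<le> ((norm Q)\<^sup>2 + \<kappa>\<^sup>2) * (M * (norm y\<^sub>a)\<^sup>2)"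
      using v by (simp add: mult_left_mono)
    finally have u: "(LINT t|lebesgue_on ?I. (norm (u t))\<^sup>2) \<le> J * (norm y\<^sub>a)\<^sup>2" by (simp add: J_def mult_ac)
    have fL: "L2_on ?I (\<lambda>t. ?\<Phi> (u t))"
      by (rule L2_on_blinfun_apply[where C = "norm ?\<Phi>", OF strongly_measurable_on_const _ uL]) auto
    have f: "(LINT t|lebesgue_on ?I. (norm (?\<Phi> (u t)))\<^sup>2) \<le> (norm ?\<Phi>)\<^sup>2 * (J * (norm y\<^sub>a)\<^sup>2)"
    proof -
      have "(LINT t|lebesgue_on ?I. (norm (?\<Phi> (u t)))\<^sup>2) \<le>
          (LINT t|lebesgue_on ?I. (norm ?\<Phi>)\<^sup>2 * (norm (u t))\<^sup>2)"
        by (intro integral_mono blinfun_norm_power2_le)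
          (use fL uL in \<open>auto simp: L2_on_def simp del: control_op_apply\<close>)
      also have "\<dots> \<le> (norm ?\<Phi>)\<^sup>2 * (J * (norm y\<^sub>a)\<^sup>2)"
        using u by (simp add: mult_left_mono)
      finally show ?thesis .
    qed
    have "AE t in lebesgue_on ?I. go t = (- A - Arc t) (in_V \<iota> y t) + dual_incl \<iota> (0 + ?\<Phi> (u t)) \<and>
        norm (0 :: 'h) \<le> k * norm (in_V \<iota> y t)"
      using go by eventually_elim (simp add: k_def del: control_op_apply)
    from M[OF a _ _ Wo this] T fL
    have "\<forall>t\<in>{a..a + T}. (norm (y t))\<^sup>2 \<le> M * ((norm y\<^sub>a)\<^sup>2 + (LINT r|lebesgue_on ?I. (norm (?\<Phi> (u r)))\<^sup>2))"
      by (simp add: L2_on_def ya del: control_op_apply)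
    moreover have "M * ((norm y\<^sub>a)\<^sup>2 + (LINT r|lebesgue_on ?I. (norm (?\<Phi> (u r)))\<^sup>2))
        \<le> M * (1 + (norm ?\<Phi>)\<^sup>2 * J) * (norm y\<^sub>a)\<^sup>2"
    proof -
      have "M * ((norm y\<^sub>a)\<^sup>2 + (LINT r|lebesgue_on ?I. (norm (?\<Phi> (u r)))\<^sup>2))
          \<le> M * ((norm y\<^sub>a)\<^sup>2 + (norm ?\<Phi>)\<^sup>2 * (J * (norm y\<^sub>a)\<^sup>2))"
        using f M0 by (intro mult_left_mono add_left_mono)
      then show ?thesis by (simp add: algebra_simps)
    qed
    ultimately show ?thesis using u by (meson order_trans)
  qed
  define C where "C = M * (1 + (norm ?\<Phi>)\<^sup>2 * J) + J"
  have "M * (1 + (norm ?\<Phi>)\<^sup>2 * J) * x \<le> C * x" "J * x \<le> C * x" if "x \<ge> 0" for x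
    using that M0 J0 by (auto simp: C_def intro!: mult_right_mono)
  then have "(\<forall>t\<in>{a..a + T}. (norm (y t))\<^sup>2 \<le> C * (norm y\<^sub>a)\<^sup>2) \<and>
      (LINT t|lebesgue_on {a<..<a + T}. (norm (u t))\<^sup>2) \<le> C * (norm y\<^sub>a)\<^sup>2"
    if "0 \<le> a" "optimal_pair \<iota> A Arc \<Phi> Q T a y\<^sub>a y u" for a y\<^sub>a y u
    using main[OF that] by (meson order_trans zero_le_power2)
  moreover have "C \<ge> 0" using M0 J0 by (simp add: C_def)
  ultimately show ?thesis by blast
qed

text \<open>
  The input \<open>p\<close> is common to plant and observer and cancels.
\<close>

lemma observer_error_solution:
  fixes \<iota> :: "'v::{real_inner,banach} \<Rightarrow>\<^sub>L 'h::{real_inner,banach}"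
    and Inj :: "real \<Rightarrow> 'z::{real_inner,banach} \<Rightarrow>\<^sub>L 'h" and Z :: "'v \<Rightarrow>\<^sub>L 'z"
  assumes \<iota>: "inj (blinfun_apply \<iota>)" and ab: "a \<le> b"
    and y: "weak_solution_on \<iota> a b \<AA> (\<lambda>t. dual_incl \<iota> (p t)) y"
    and yh: "weak_solution_on \<iota> a b \<AA>
      (\<lambda>t. dual_incl \<iota> (p t + Inj t (Z (in_V \<iota> yh t) - Z (in_V \<iota> y t)))) yh"
  shows "weak_solution_on \<iota> a b (\<lambda>t. \<AA> t + (dual_incl \<iota> o\<^sub>L Inj t o\<^sub>L Z)) (\<lambda>t. 0) (\<lambda>t. yh t - y t)"
proof -
  obtain g1 where g1: "W_deriv \<iota> a b y g1"
    "AE t in lebesgue_on {a<..<b}. g1 t = \<AA> t (in_V \<iota> y t) + dual_incl \<iota> (p t)"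
    using y unfolding weak_solution_on_def by blast
  obtain g2 where g2: "W_deriv \<iota> a b yh g2" "AE t in lebesgue_on {a<..<b}. g2 t = \<AA> t (in_V \<iota> yh t) +
      dual_incl \<iota> (p t + Inj t (Z (in_V \<iota> yh t) - Z (in_V \<iota> y t)))"
    using yh unfolding weak_solution_on_def by blast
  note D = W_deriv_diff[OF \<iota> ab g2(1) g1(1)]
  have "AE t in lebesgue_on {a<..<b}. g2 t - g1 t =
      (\<AA> t + (dual_incl \<iota> o\<^sub>L Inj t o\<^sub>L Z)) (in_V \<iota> (\<lambda>t. yh t - y t) t) + 0"
    using g1(2) g2(2) D(2) by eventually_elim (simp add: blinfun.bilinear_simps)
  then show ?thesis using D(1) unfolding weak_solution_on_def by blast
qed

text \<open>
  \<open>yh\<close> is the estimate and \<open>y\<^sub>o\<close> the predicted state under the same input \<open>p\<close>. Their difference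
  starts at zero and is driven by the output injection only, which is bounded by \<open>z = yh - y\<close> in
  \<open>L\<^sup>2\<close> with values in \<open>V\<close>; the energy estimate for the error equation bounds the latter by \<open>z a\<close>.
\<close>

lemma estimate_deviation_bound:
  fixes \<iota> :: "'v::{real_inner,banach} \<Rightarrow>\<^sub>L 'h::{real_inner,banach}"
    and Inj :: "real \<Rightarrow> 'z::{real_inner,banach} \<Rightarrow>\<^sub>L 'h" and Z :: "'v \<Rightarrow>\<^sub>L 'z"
  assumes inj: "inj (blinfun_apply \<iota>)" and EM: "energy_constant \<iota> \<AA> k T M" and k: "k = \<bar>\<kappa>\<bar> * norm Z"
    and Inj: "strongly_measurable_on {0<..} Inj" "AE t in lebesgue_on {0<..}. norm (Inj t) \<le> \<kappa>"
    and a: "0 \<le> a" and ab: "a \<le> b" "b \<le> a + T" and t: "t \<in> {a..b}"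
    and sy: "weak_solution_on \<iota> a b \<AA> (\<lambda>t. dual_incl \<iota> (p t)) y"
    and syh: "weak_solution_on \<iota> a b \<AA>
      (\<lambda>t. dual_incl \<iota> (p t + Inj t (Z (in_V \<iota> yh t) - Z (in_V \<iota> y t)))) yh"
    and so: "weak_solution_on \<iota> a b \<AA> (\<lambda>t. dual_incl \<iota> (p t)) y\<^sub>o"
    and start: "y\<^sub>o a = yh a"
  shows "(norm (yh t - y\<^sub>o t))\<^sup>2 \<le> M * (k\<^sup>2 * M) * (norm (yh a - y a))\<^sup>2"
proof -
  have M0: "M \<ge> 0" using EM by (simp add: energy_constant_def)
  note M = energy_constantD[OF EM]
  let ?I = "{a<..<b}"
  let ?z = "\<lambda>t. yh t - y t"
  let ?e = "\<lambda>t. yh t - y\<^sub>o t"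
  have ba: "b - a \<le> T" using ab by simp
  have sub: "?I \<subseteq> {0<..}" using a by auto
  have \<kappa>I: "AE t in lebesgue_on ?I. norm (Inj t) \<le> \<kappa>"
    by (rule AE_lebesgue_on_subset[OF Inj(2) sub]) auto
  have II: "strongly_measurable_on ?I Inj"
    by (rule strongly_measurable_on_subset[OF Inj(1) sub]) auto
  define f where "f t = Inj t (Z (in_V \<iota> ?z t))" for t
  have fk: "AE t in lebesgue_on ?I. norm (f t) \<le> k * norm (in_V \<iota> ?z t)"
    using \<kappa>I
  proof eventually_elim
    case (elim t)
    have "norm (f t) \<le> norm (Inj t) * norm (Z (in_V \<iota> ?z t))" unfolding f_def by (rule norm_blinfun)
    also have "\<dots> \<le> \<bar>\<kappa>\<bar> * (norm Z * norm (in_V \<iota> ?z t))"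
      using elim by (intro mult_mono norm_blinfun) auto
    finally show ?case by (simp add: k mult.assoc)
  qed
  obtain gz where Wz: "W_deriv \<iota> a b ?z gz" and gz: "AE t in lebesgue_on ?I.
      gz t = (\<AA> t + (dual_incl \<iota> o\<^sub>L Inj t o\<^sub>L Z)) (in_V \<iota> ?z t) + 0"
    using observer_error_solution[OF inj ab(1) sy syh] unfolding weak_solution_on_def by blast
  have vL: "L2_on ?I (in_V \<iota> ?z)" using Wz by (simp add: W_deriv_def)
  have "AE t in lebesgue_on ?I. gz t = \<AA> t (in_V \<iota> ?z t) + dual_incl \<iota> (f t + 0) \<and>
      norm (f t) \<le> k * norm (in_V \<iota> ?z t)"
    using gz fk by eventually_elim (simp add: f_def blinfun.add_left)
  from M[OF a ab(1) ba Wz this]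
  have zv: "(LINT r|lebesgue_on ?I. (norm (in_V \<iota> ?z r))\<^sup>2) \<le> M * (norm (?z a))\<^sup>2" by simp
  have fL: "L2_on ?I f"
    unfolding f_def
    by (rule L2_on_blinfun_apply[OF II \<kappa>I L2_on_blinfun_apply[where C = "norm Z", OF strongly_measurable_on_const _ vL]])
      auto
  have "(LINT r|lebesgue_on ?I. (norm (f r))\<^sup>2) \<le> (LINT r|lebesgue_on ?I. k\<^sup>2 * (norm (in_V \<iota> ?z r))\<^sup>2)"
  proof (rule integral_mono_AE)
    show "AE r in lebesgue_on ?I. (norm (f r))\<^sup>2 \<le> k\<^sup>2 * (norm (in_V \<iota> ?z r))\<^sup>2"
      using fk by eventually_elim (metis norm_ge_zero power_mono power_mult_distrib)
  qed (use fL vL in \<open>auto simp: L2_on_def\<close>)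
  also have "\<dots> \<le> k\<^sup>2 * (M * (norm (?z a))\<^sup>2)" using zv by (simp add: mult_left_mono)
  finally have fI: "(LINT r|lebesgue_on ?I. (norm (f r))\<^sup>2) \<le> k\<^sup>2 * (M * (norm (?z a))\<^sup>2)" .
  obtain g1 where g1: "W_deriv \<iota> a b y g1"
    using sy unfolding weak_solution_on_def by blast
  obtain g2 where g2: "W_deriv \<iota> a b yh g2" "AE t in lebesgue_on ?I. g2 t = \<AA> t (in_V \<iota> yh t) +
      dual_incl \<iota> (p t + Inj t (Z (in_V \<iota> yh t) - Z (in_V \<iota> y t)))"
    using syh unfolding weak_solution_on_def by blast
  obtain g3 where g3: "W_deriv \<iota> a b y\<^sub>o g3"
    "AE t in lebesgue_on ?I. g3 t = \<AA> t (in_V \<iota> y\<^sub>o t) + dual_incl \<iota> (p t)"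
    using so unfolding weak_solution_on_def by blast
  note De = W_deriv_diff[OF inj ab(1) g2(1) g3(1)] and Dz = W_deriv_diff[OF inj ab(1) g2(1) g1]
  have "AE t in lebesgue_on ?I. g2 t - g3 t = \<AA> t (in_V \<iota> ?e t) + dual_incl \<iota> (0 + f t) \<and>
      norm (0 :: 'h) \<le> k * norm (in_V \<iota> ?e t)"
    using g2(2) g3(2) De(2) Dz(2)
    by eventually_elim (simp add: f_def k blinfun.bilinear_simps)
  from M[OF a ab(1) ba De(1) this] fL t start
  have "(norm (?e t))\<^sup>2 \<le> M * (LINT r|lebesgue_on ?I. (norm (f r))\<^sup>2)" by (simp add: L2_on_def)
  also have "\<dots> \<le> M * (k\<^sup>2 * (M * (norm (?z a))\<^sup>2))" using fI M0 by (rule mult_left_mono)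
  finally show ?thesis by (simp add: mult.assoc)
qed

section \<open>Concatenation times and discrete decay\<close>

lemma max_argmin_compact:
  fixes f :: "real \<Rightarrow> real"
  assumes S: "compact S" "S \<noteq> {}" and f: "continuous_on S f"
  shows "max_argmin f S \<in> S" and "\<And>s. s \<in> S \<Longrightarrow> f (max_argmin f S) \<le> f s"
proof -
  define M where "M = {t \<in> S. \<forall>s\<in>S. f t \<le> f s}"
  obtain x where x: "x \<in> S" "\<forall>s\<in>S. f x \<le> f s" using continuous_attains_inf[OF S f] by blast
  have M: "M = {t \<in> S. f t = f x}" using x by (auto simp: M_def intro: antisym)
  have "closed M"
    unfolding M using continuous_closed_preimage_constant[OF f compact_imp_closed[OF S(1)]] by simp
  then have "compact M" using S(1) by (metis (no_types, lifting) M_def closed_Int_compact inf.absorb1 mem_Collect_eq subsetI)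
  moreover have "M \<noteq> {}" using x by (auto simp: M_def)
  ultimately obtain m where m: "m \<in> M" "\<forall>t\<in>M. t \<le> m" using compact_attains_sup by blast
  have arg: "is_arg_min f (\<lambda>t. t \<in> S) t \<longleftrightarrow> t \<in> M" for t
    by (auto simp: is_arg_min_def M_def not_less)
  have "max_argmin f S = m"
    unfolding max_argmin_def by (rule Greatest_equality) (use m arg in auto)
  then show "max_argmin f S \<in> S" "\<And>s. s \<in> S \<Longrightarrow> f (max_argmin f S) \<le> f s"
    using m by (auto simp: M_def)
qed

text \<open>
  The algorithm minimises over \<open>{a + \<tau>..a + T}\<close>, whereas the assumed contraction concerns the
  minimum over \<open>{a..a + T}\<close>. As the latest minimiser over the larger interval lies in the smaller
  one, both minima agree.
\<close>

lemma horizon_contraction: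
  fixes f :: "real \<Rightarrow> real"
  assumes f: "continuous_on {a..a + T} f" and T: "\<tau> \<le> T" "0 < \<tau>"
    and inf: "(INF t\<in>{a..a + T}. f t) \<le> m" and late: "max_argmin f {a..a + T} > a + \<tau>"
  shows "max_argmin f {a + \<tau>..a + T} \<in> {a + \<tau>..a + T}" and "f (max_argmin f {a + \<tau>..a + T}) \<le> m"
proof -
  have ne: "{a..a + T} \<noteq> {}" "{a + \<tau>..a + T} \<noteq> {}" using T by auto
  have f': "continuous_on {a + \<tau>..a + T} f" by (rule continuous_on_subset[OF f]) (use T in auto)
  note 1 = max_argmin_compact[OF compact_Icc ne(1) f] and 2 = max_argmin_compact[OF compact_Icc ne(2) f']
  show "max_argmin f {a + \<tau>..a + T} \<in> {a + \<tau>..a + T}" by (rule 2(1))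
  have "f (max_argmin f {a + \<tau>..a + T}) \<le> f (max_argmin f {a..a + T})"
    by (rule 2(2)) (use 1(1) late in auto)
  also have "\<dots> \<le> (INF t\<in>{a..a + T}. f t)" by (rule cINF_greatest[OF ne(1)]) (rule 1(2))
  also note inf
  finally show "f (max_argmin f {a + \<tau>..a + T}) \<le> m" .
qed

text \<open>
  With \<open>\<delta> = \<mu> - \<kappa>\<close>, the function \<open>(2 + D * (1 - exp (- \<delta> * t))) * exp (- \<kappa> * t) * N\<close> is a
  supersolution of the recursion: per step, the growth of its first factor pays for the
  perturbation. The lower bound \<open>\<tau>\<close> on the step length makes a finite \<open>D\<close> possible; it has the sign
  of \<open>\<delta>\<close>. With equal rates the perturbations would add up to a factor growing like \<open>n\<close>.
\<close>

lemma perturbed_contraction_decay: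
  fixes \<kappa> \<mu> \<tau> T C :: real
  assumes neq: "\<mu> \<noteq> \<kappa>" and \<mu>: "0 < \<mu>" and \<kappa>: "0 < \<kappa>" and \<tau>: "0 < \<tau>" "\<tau> \<le> T" and C: "0 \<le> C"
  shows "\<exists>D\<ge>0. \<forall>(t :: nat \<Rightarrow> real) a N. t 0 = 0 \<longrightarrow>
    (\<forall>n. \<tau> \<le> t (Suc n) - t n \<and> t (Suc n) - t n \<le> T) \<longrightarrow> 0 \<le> N \<longrightarrow> a 0 \<le> 2 * N \<longrightarrow>
    (\<forall>n. a (Suc n) \<le> exp (- \<kappa> * (t (Suc n) - t n)) * a n + C * exp (- \<mu> * t n) * N) \<longrightarrow>
    (\<forall>n. a n \<le> D * exp (- min \<mu> \<kappa> * t n) * N)"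
proof -
  define \<delta> where "\<delta> = \<mu> - \<kappa>"
  define q where "q = 1 - exp (- \<delta> * \<tau>)"
  have q: "0 < \<delta> \<Longrightarrow> 0 < q" "\<delta> < 0 \<Longrightarrow> q < 0" "q \<noteq> 0"
    using \<tau> neq by (auto simp: q_def \<delta>_def mult_neg_pos)
  define D where "D = C * exp (\<kappa> * T) / q"
  have D: "0 < \<delta> \<Longrightarrow> 0 \<le> D" "\<delta> < 0 \<Longrightarrow> D \<le> 0"
    using C q by (auto simp: D_def intro: divide_nonneg_pos divide_nonneg_neg)
  have gain: "C * exp (\<kappa> * d) \<le> D * (1 - exp (- \<delta> * d))" if d: "\<tau> \<le> d" "d \<le> T" for d
  proof -
    have "C * exp (\<kappa> * d) \<le> C * exp (\<kappa> * T)" using C \<kappa> d by (intro mult_left_mono) auto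
    also have "\<dots> = D * q" using q by (simp add: D_def)
    also have "\<dots> \<le> D * (1 - exp (- \<delta> * d))"
    proof (cases "\<delta> > 0")
      case True
      then show ?thesis using D d by (intro mult_left_mono) (auto simp: q_def)
    next
      case False
      then have "\<delta> < 0" using neq by (simp add: \<delta>_def)
      then show ?thesis using D d by (intro mult_left_mono_neg) (auto simp: q_def)
    qed
    finally show ?thesis .
  qed
  have final: "(2 + D * (1 - exp (- \<delta> * t))) * exp (- \<kappa> * t) \<le> (2 + \<bar>D\<bar>) * exp (- min \<mu> \<kappa> * t)" if "t \<ge> 0" for t
  proof (cases "\<delta> > 0")
    case True
    then have "D * (1 - exp (- \<delta> * t)) \<le> \<bar>D\<bar> * 1" using D that by (intro mult_mono) auto
    then show ?thesis using True by (simp add: \<delta>_def)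
  next
    case False
    then have "\<delta> < 0" using neq by (simp add: \<delta>_def)
    have "exp (- \<delta> * t) * exp (- \<kappa> * t) = exp (- \<mu> * t)"
      by (simp add: \<delta>_def algebra_simps flip: exp_add)
    then have "(2 + D * (1 - exp (- \<delta> * t))) * exp (- \<kappa> * t) = (2 + D) * exp (- \<kappa> * t) - D * exp (- \<mu> * t)"
      by (simp add: algebra_simps)
    also have "\<dots> \<le> 2 * exp (- \<mu> * t) - D * exp (- \<mu> * t)"
    proof -
      have "exp (- \<kappa> * t) \<le> exp (- \<mu> * t)" using \<open>\<delta> < 0\<close> that by (simp add: \<delta>_def mult_right_mono)
      moreover have "D * exp (- \<kappa> * t) \<le> 0" using D \<open>\<delta> < 0\<close> by (simp add: mult_nonpos_nonneg)
      ultimately show ?thesis unfolding distrib_right by linarith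
    qed
    finally show ?thesis using D \<open>\<delta> < 0\<close> by (simp add: \<delta>_def algebra_simps)
  qed
  show ?thesis
  proof (intro exI[of _ "2 + \<bar>D\<bar>"] conjI allI impI)
    fix t :: "nat \<Rightarrow> real" and a :: "nat \<Rightarrow> real" and N :: real and n
    assume t0: "t 0 = 0" and dt: "\<forall>n. \<tau> \<le> t (Suc n) - t n \<and> t (Suc n) - t n \<le> T"
      and N: "0 \<le> N" and a0: "a 0 \<le> 2 * N"
      and rec: "\<forall>n. a (Suc n) \<le> exp (- \<kappa> * (t (Suc n) - t n)) * a n + C * exp (- \<mu> * t n) * N"
    have tn: "0 \<le> t n" for n
    proof (induction n)
      case (Suc n)
      then show ?case using dt[rule_format, of n] \<tau> by linarith
    qed (simp add: t0)
    have "a n \<le> (2 + D * (1 - exp (- \<delta> * t n))) * exp (- \<kappa> * t n) * N"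
    proof (induction n)
      case (Suc n)
      define d where "d = t (Suc n) - t n"
      have d: "\<tau> \<le> d" "d \<le> T" using dt by (auto simp: d_def)
      define E where "E = exp (- \<delta> * t n)"
      have tS: "t (Suc n) = t n + d" by (simp add: d_def)
      have "C * exp (\<kappa> * d) * E \<le> D * (1 - exp (- \<delta> * d)) * E"
        by (rule mult_right_mono[OF gain[OF d]]) (simp add: E_def)
      then have key: "2 + D * (1 - E) + C * exp (\<kappa> * d) * E \<le> 2 + D * (1 - exp (- \<delta> * d) * E)"
        by (simp add: algebra_simps)
      have exps: "exp (- \<kappa> * d) * exp (- \<kappa> * t n) = exp (- \<kappa> * t (Suc n))"
        "exp (- \<mu> * t n) = exp (\<kappa> * d) * E * exp (- \<kappa> * t (Suc n))"
        "exp (- \<delta> * t (Suc n)) = exp (- \<delta> * d) * E"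
        by (simp_all add: E_def \<delta>_def tS algebra_simps flip: exp_add)
      have "a (Suc n) \<le> exp (- \<kappa> * d) * a n + C * exp (- \<mu> * t n) * N" using rec by (simp add: d_def)
      also have "\<dots> \<le> exp (- \<kappa> * d) * ((2 + D * (1 - E)) * exp (- \<kappa> * t n) * N) + C * exp (- \<mu> * t n) * N"
        using Suc by (intro add_right_mono mult_left_mono) (auto simp: E_def)
      also have "\<dots> = (2 + D * (1 - E)) * (exp (- \<kappa> * d) * exp (- \<kappa> * t n)) * N + C * exp (- \<mu> * t n) * N"
        by (simp only: mult_ac)
      also have "\<dots> = (2 + D * (1 - E) + C * exp (\<kappa> * d) * E) * (exp (- \<kappa> * t (Suc n)) * N)"
        unfolding exps by (simp add: distrib_left distrib_right mult_ac)
      also have "\<dots> \<le> (2 + D * (1 - exp (- \<delta> * d) * E)) * (exp (- \<kappa> * t (Suc n)) * N)"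
        using N by (intro mult_right_mono key) auto
      finally show ?case unfolding exps(3) by (simp only: mult.assoc)
    qed (use t0 a0 in simp)
    also have "\<dots> \<le> (2 + \<bar>D\<bar>) * exp (- min \<mu> \<kappa> * t n) * N"
      by (rule mult_right_mono[OF final[OF tn] N])
    finally show "a n \<le> (2 + \<bar>D\<bar>) * exp (- min \<mu> \<kappa> * t n) * N" .
  qed simp
qed

lemma L2_on_halfline:
  fixes u :: "real \<Rightarrow> 'b::euclidean_space" and t :: "nat \<Rightarrow> real"
  assumes u: "\<And>n. L2_on {0<..<t n} u" and B: "\<And>n. (LINT r|lebesgue_on {0<..<t n}. (norm (u r))\<^sup>2) \<le> B"
    and t: "incseq t" "filterlim t at_top sequentially"
  shows "L2_on {0<..} u" and "(LINT r|lebesgue_on {0<..}. (norm (u r))\<^sup>2) \<le> B"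
proof -
  have ev: "eventually (\<lambda>n. r \<in> {0<..<t n} \<longleftrightarrow> r \<in> {0<..}) sequentially" for r
    using filterlim_at_top_dense[THEN iffD1, OF t(2), rule_format, of r] by eventually_elim auto
  have lim: "(\<lambda>n. if r \<in> {0<..<t n} then c else 0) \<longlonglongrightarrow> (if r \<in> {0<..} then c else 0)"
    for r and c :: "'c::real_normed_vector"
  proof (rule tendsto_eventually)
    show "eventually (\<lambda>n. (if r \<in> {0<..<t n} then c else 0) = (if r \<in> {0<..} then c else 0)) sequentially"
      using ev[of r] by eventually_elim (simp only:)
  qed
  have "(\<lambda>r. if r \<in> {0<..<t n} then u r else 0) \<in> borel_measurable lebesgue" for n
    by (rule borel_measurable_if_I[OF strongly_measurable_on_imp_borel])
      (use u[of n] in \<open>auto simp: L2_on_def\<close>)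
  then have "(\<lambda>r. if r \<in> {0<..} then u r else 0) \<in> borel_measurable lebesgue"
    by (rule borel_measurable_LIMSEQ_metric) (rule lim)
  then have um: "strongly_measurable_on {0<..} u"
    by (intro borel_imp_strongly_measurable_on borel_measurable_if_D)
  define f where "f n r = (if r \<in> {0<..<t n} then (norm (u r))\<^sup>2 else 0)" for n r
  define F where "F r = (if r \<in> {0<..} then (norm (u r))\<^sup>2 else 0)" for r
  have fi: "integrable lebesgue (f n)" for n
    unfolding f_def using u[of n] by (subst Lebesgue_Measure.integrable_restrict_UNIV) (auto simp: L2_on_def)
  have fB: "integral\<^sup>L lebesgue (f n) \<le> B" for n
    unfolding f_def using B[of n] by (subst Lebesgue_Measure.integral_restrict_UNIV) auto
  have mono: "f n r \<le> f m r" if "n \<le> m" for n m r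
    using incseqD[OF t(1) that] by (auto simp: f_def)
  have "incseq (\<lambda>n. integral\<^sup>L lebesgue (f n))"
    by (intro incseq_SucI integral_mono fi mono) auto
  then obtain I where I: "(\<lambda>n. integral\<^sup>L lebesgue (f n)) \<longlonglongrightarrow> I"
    using fB incseq_convergent[of "\<lambda>n. integral\<^sup>L lebesgue (f n)" B] by blast
  have "has_bochner_integral lebesgue F I"
  proof (rule has_bochner_integral_monotone_convergence[OF fi])
    show "AE r in lebesgue. mono (\<lambda>n. f n r)" by (auto simp: mono_def intro: mono)
    show "AE r in lebesgue. (\<lambda>n. f n r) \<longlonglongrightarrow> F r" unfolding f_def F_def using lim by (intro AE_I2)
    show "(\<lambda>n. integral\<^sup>L lebesgue (f n)) \<longlonglongrightarrow> I" by (rule I)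
    show "F \<in> borel_measurable lebesgue"
    proof (rule borel_measurable_LIMSEQ_metric[where f = f])
      show "f n \<in> borel_measurable lebesgue" for n using fi by (rule borel_measurable_integrable)
      show "(\<lambda>n. f n r) \<longlonglongrightarrow> F r" for r unfolding f_def F_def by (rule lim)
    qed
  qed
  then have Fi: "integrable lebesgue F" and FI: "integral\<^sup>L lebesgue F = I"
    by (auto simp: has_bochner_integral_iff)
  have "I \<le> B" by (rule LIMSEQ_le_const2[OF I]) (use fB in auto)
  then show "(LINT r|lebesgue_on {0<..}. (norm (u r))\<^sup>2) \<le> B"
    using FI Lebesgue_Measure.integral_restrict_UNIV[of "{0<..}" "\<lambda>r. (norm (u r))\<^sup>2"] by (simp add: F_def[abs_def])
  show "L2_on {0<..} u"
    unfolding L2_on_def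
    using um Fi Lebesgue_Measure.integrable_restrict_UNIV[of "{0<..}" "\<lambda>r. (norm (u r))\<^sup>2"] by (simp add: F_def[abs_def])
qed

text \<open>
  The integral up to \<open>t n\<close> is at most \<open>c / (1 - exp (- \<nu> * \<tau>)) * (1 - exp (- \<nu> * t n))\<close>, which
  grows on each step by at least \<open>c * exp (- \<nu> * t n)\<close>, as the step is not shorter than \<open>\<tau>\<close>.
\<close>

lemma L2_on_pieces:
  fixes u :: "real \<Rightarrow> 'b::euclidean_space" and t :: "nat \<Rightarrow> real"
  assumes t0: "t 0 = 0" and t: "\<And>n. \<tau> \<le> t (Suc n) - t n" and \<tau>: "\<tau> > 0"
    and u: "\<And>n. L2_on {t n<..<t (Suc n)} u" and \<nu>: "\<nu> > 0" and c: "c \<ge> 0"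
    and le: "\<And>n. (LINT r|lebesgue_on {t n<..<t (Suc n)}. (norm (u r))\<^sup>2) \<le> c * exp (- \<nu> * t n)"
  shows "L2_on {0<..} u" and "(LINT r|lebesgue_on {0<..}. (norm (u r))\<^sup>2) \<le> c / (1 - exp (- \<nu> * \<tau>))"
proof -
  define q where "q = 1 - exp (- \<nu> * \<tau>)"
  have q: "q > 0" using \<nu> \<tau> by (simp add: q_def)
  have tmono: "t n \<le> t (Suc n)" for n using t[of n] \<tau> by linarith
  have inc: "incseq t" by (rule incseq_SucI) (rule tmono)
  have tn: "0 \<le> t n" for n using incseqD[OF inc, of 0 n] t0 by simp
  have low: "\<tau> * real n \<le> t n" for n
  proof (induction n)
    case (Suc n)
    then show ?case using t[of n] by (simp add: algebra_simps)
  qed (simp add: t0)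
  have top: "filterlim t at_top sequentially"
  proof (rule filterlim_at_top_mono[of "\<lambda>n. \<tau> * real n"])
    show "filterlim (\<lambda>n. \<tau> * real n) at_top sequentially"
      by (rule filterlim_tendsto_pos_mult_at_top[OF tendsto_const \<tau> filterlim_real_sequentially])
  qed (simp add: low)
  have claim: "L2_on {0<..<t n} u \<and> (LINT r|lebesgue_on {0<..<t n}. (norm (u r))\<^sup>2) \<le> c / q * (1 - exp (- \<nu> * t n))" for n
  proof (induction n)
    case 0
    have "L2_on {0<..<0 :: real} u"
      by (rule L2_on_subset[OF u[of 0]]) auto
    then show ?case by (simp add: t0)
  next
    case (Suc n)
    then have L: "L2_on {0<..<t (Suc n)} u"
      using u[of n] tn tmono by (blast intro: L2_on_join)
    note n1 = L2_on_Ioo_norm_integrable[OF conjunct1[OF Suc]] and n2 = L2_on_Ioo_norm_integrable[OF u[of n]]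
      and n3 = L2_on_Ioo_norm_integrable[OF L]
    have "(LINT r|lebesgue_on {0<..<t (Suc n)}. (norm (u r))\<^sup>2) =
        (LINT r|lebesgue_on {0<..<t n}. (norm (u r))\<^sup>2) + (LINT r|lebesgue_on {t n<..<t (Suc n)}. (norm (u r))\<^sup>2)"
      unfolding integral_lebesgue_on_Ioo[OF n1] integral_lebesgue_on_Ioo[OF n2] integral_lebesgue_on_Ioo[OF n3]
      by (rule Henstock_Kurzweil_Integration.integral_combine[symmetric])
        (use tn tmono n3 in \<open>auto simp: absolutely_integrable_on_def\<close>)
    also have "\<dots> \<le> c / q * (1 - exp (- \<nu> * t n)) + c * exp (- \<nu> * t n)"
      using Suc le[of n] by (intro add_mono) auto
    also have "\<dots> \<le> c / q * (1 - exp (- \<nu> * t (Suc n)))"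
    proof -
      have "exp (- \<nu> * t (Suc n)) \<le> exp (- \<nu> * \<tau>) * exp (- \<nu> * t n)"
        using mult_left_mono[OF t[of n], of \<nu>] \<nu> by (simp add: algebra_simps flip: exp_add)
      then have "q * exp (- \<nu> * t n) \<le> exp (- \<nu> * t n) - exp (- \<nu> * t (Suc n))"
        by (simp add: q_def algebra_simps)
      then have "c / q * (q * exp (- \<nu> * t n)) \<le> c / q * (exp (- \<nu> * t n) - exp (- \<nu> * t (Suc n)))"
        using c q by (intro mult_left_mono) auto
      moreover have "c / q * (q * exp (- \<nu> * t n)) = c * exp (- \<nu> * t n)" using q by simp
      ultimately show ?thesis by (simp add: algebra_simps)
    qed
    finally show ?case using L by simp
  qed
  have "(LINT r|lebesgue_on {0<..<t n}. (norm (u r))\<^sup>2) \<le> c / q" for n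
  proof -
    have "c / q * (1 - exp (- \<nu> * t n)) \<le> c / q * 1" using c q by (intro mult_left_mono) auto
    then show ?thesis using claim[of n] by linarith
  qed
  from L2_on_halfline[OF _ this inc top] claim
  show "L2_on {0<..} u" "(LINT r|lebesgue_on {0<..}. (norm (u r))\<^sup>2) \<le> c / (1 - exp (- \<nu> * \<tau>))"
    by (auto simp: q_def)
qed

section \<open>Exponential stability of the algorithm\<close>

theorem theorem3p11:
  fixes \<iota> :: "'v::{real_inner,banach,second_countable_topology} \<Rightarrow>\<^sub>L
                'h::{real_inner,banach,second_countable_topology}"
    and A :: "'v \<Rightarrow>\<^sub>L ('v \<Rightarrow>\<^sub>L real)"
    and Arc :: "real \<Rightarrow> ('v \<Rightarrow>\<^sub>L ('v \<Rightarrow>\<^sub>L real))"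
    and \<Phi> :: "'m::finite \<Rightarrow> 'h"
    and Z :: "'v \<Rightarrow>\<^sub>L (real^'s::finite)"
    and Q :: "'v \<Rightarrow>\<^sub>L 'q::{real_inner,banach}"
    and Inj :: "real \<Rightarrow> ((real^'s) \<Rightarrow>\<^sub>L 'h)"
    and C\<^sub>o \<mu>\<^sub>1 \<mu>\<^sub>2 \<theta> T \<tau> :: real
  assumes triple: "gelfand_embedding \<iota>"
    and A: "complete_scalar_product A"
    and Arc: "Linf_in (rc_space \<iota>) (rc_norm \<iota>) {0<..} Arc"
    and det_Z: "detectable \<iota> (\<lambda>t. - A - Arc t) (\<lambda>t. Z)"
    and stab_U: "stabilizable \<iota> (\<lambda>t. - A - Arc t) (\<lambda>t. control_op \<Phi>)"
    and det_Q: "detectable \<iota> (\<lambda>t. - A - Arc t) (\<lambda>t. Q)"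
    and Inj: "Linf_on {0<..} Inj"
    and C\<^sub>o: "C\<^sub>o \<ge> 1" and \<mu>\<^sub>1: "\<mu>\<^sub>1 > 0"
    and observer: "\<And>z s t. weak_solution_from \<iota> 0
          (\<lambda>t. - A - Arc t + (dual_incl \<iota> o\<^sub>L Inj t o\<^sub>L Z)) z \<Longrightarrow> 0 \<le> s \<Longrightarrow> s \<le> t \<Longrightarrow>
          norm (z t) \<le> C\<^sub>o * exp (- \<mu>\<^sub>1 * (t - s)) * norm (z s)"
    and \<theta>: "0 < \<theta>" "\<theta> < 1" and T: "T \<ge> \<tau>" "\<tau> > 0"
    and horizon: "\<And>t_in y_in y u. 0 \<le> t_in \<Longrightarrow> optimal_pair \<iota> A Arc \<Phi> Q T t_in y_in y u \<Longrightarrow>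
          (INF t\<in>{t_in..t_in + T}. norm (y t)) \<le> \<theta> * norm y_in \<and>
          max_argmin (\<lambda>t. norm (y t)) {t_in..t_in + T} > t_in + \<tau>"
    and \<mu>\<^sub>2: "\<mu>\<^sub>2 < min \<mu>\<^sub>1 (inverse T * ln (inverse \<theta>)) \<or>
          (\<mu>\<^sub>1 \<noteq> inverse T * ln (inverse \<theta>) \<and> \<mu>\<^sub>2 = min \<mu>\<^sub>1 (inverse T * ln (inverse \<theta>)))"
  shows "\<exists>D\<^sub>1\<ge>1. \<exists>D\<^sub>2>0. \<forall>y\<^sub>0 yh\<^sub>0 y yh u.
          orh_run \<iota> A Arc \<Phi> Q Z Inj T \<tau> y\<^sub>0 yh\<^sub>0 y yh u \<longrightarrow>
            (\<forall>t\<ge>0. norm (y t, yh t - y t) \<le> D\<^sub>1 * exp (- \<mu>\<^sub>2 * t) * norm (y 0, yh 0 - y 0)) \<and>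
            L2_on {0<..} u \<and>
            L2_norm_on {0<..} u \<le> D\<^sub>2 * norm (y 0, yh 0 - y 0)"
proof -
  define \<kappa> where "\<kappa> = inverse T * ln (inverse \<theta>)"
  have Tp: "T > 0" using T by simp
  have \<kappa>: "\<kappa> > 0" using \<theta> Tp by (simp add: \<kappa>_def ln_div divide_inverse[symmetric] field_simps)
  have \<theta>\<kappa>: "\<theta> = exp (- \<kappa> * T)"
  proof -
    have "- \<kappa> * T = ln \<theta>" using \<theta> Tp by (simp add: \<kappa>_def ln_inverse)
    then show ?thesis using \<theta> by simp
  qed
  \<comment> \<open>The error also decays with any rate below \<open>\<mu>\<^sub>1\<close>; a rate other than \<open>\<kappa>\<close> and not below \<open>\<mu>\<^sub>2\<close> is used.\<close>
  obtain \<mu> where \<mu>: "0 < \<mu>" "\<mu> \<le> \<mu>\<^sub>1" "\<mu> \<noteq> \<kappa>" "\<mu>\<^sub>2 \<le> min \<mu> \<kappa>"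
  proof (cases "\<mu>\<^sub>2 < min \<mu>\<^sub>1 \<kappa>")
    case True
    define m where "m = max \<mu>\<^sub>2 (min \<mu>\<^sub>1 \<kappa> / 2)"
    have "0 < m" "m < min \<mu>\<^sub>1 \<kappa>" "\<mu>\<^sub>2 \<le> m" using True \<mu>\<^sub>1 \<kappa> by (auto simp: m_def)
    then show ?thesis by (intro that[of m]) auto
  next
    case False
    then show ?thesis using \<mu>\<^sub>2 \<mu>\<^sub>1 by (intro that[of \<mu>\<^sub>1]) (auto simp: \<kappa>_def)
  qed
  define \<nu> where "\<nu> = min \<mu> \<kappa>"
  have \<nu>: "0 < \<nu>" "\<mu>\<^sub>2 \<le> \<nu>" "\<nu> \<le> \<mu>" using \<mu> \<kappa> by (auto simp: \<nu>_def)
  have inj: "inj (blinfun_apply \<iota>)" using triple by (simp add: gelfand_embedding_def)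
  obtain C1 where C1: "C1 \<ge> 0" "\<forall>a y\<^sub>a y u. 0 \<le> a \<longrightarrow> optimal_pair \<iota> A Arc \<Phi> Q T a y\<^sub>a y u \<longrightarrow>
    (\<forall>t\<in>{a..a + T}. (norm (y t))\<^sup>2 \<le> C1 * (norm y\<^sub>a)\<^sup>2) \<and>
    (LINT t|lebesgue_on {a<..<a + T}. (norm (u t))\<^sup>2) \<le> C1 * (norm y\<^sub>a)\<^sup>2"
    using optimal_pair_bounds[OF triple A Arc stab_U Tp, of Q] by (elim exE conjE) (rule that)
  obtain \<kappa>\<^sub>I where Inj': "strongly_measurable_on {0<..} Inj" "AE t in lebesgue_on {0<..}. norm (Inj t) \<le> \<kappa>\<^sub>I"
    using Inj unfolding Linf_on_def Linf_in_def by blast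
  define k where "k = \<bar>\<kappa>\<^sub>I\<bar> * norm Z"
  obtain M where M: "energy_constant \<iota> (\<lambda>t. - A - Arc t) k T M"
    using forced_energy_estimate[OF triple A Arc, of k T] Tp by (auto simp: k_def)
  define C2 where "C2 = M * (k\<^sup>2 * M)"
  have C2: "C2 \<ge> 0" using M by (simp add: C2_def energy_constant_def)
  define c1 where "c1 = sqrt C1"
  define c2 where "c2 = sqrt C2"
  have c12: "c1 \<ge> 0" "c2 \<ge> 0" using C1(1) C2 by (simp_all add: c1_def c2_def)
  have "0 \<le> c2 * C\<^sub>o" using c12 C\<^sub>o by simp
  from perturbed_contraction_decay[OF \<mu>(3,1) \<kappa> T(2,1) this, folded \<nu>_def]
  obtain D where D: "D \<ge> 0" "\<forall>(t :: nat \<Rightarrow> real) a N. t 0 = 0 \<longrightarrow>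
    (\<forall>n. \<tau> \<le> t (Suc n) - t n \<and> t (Suc n) - t n \<le> T) \<longrightarrow> 0 \<le> N \<longrightarrow> a 0 \<le> 2 * N \<longrightarrow>
    (\<forall>n. a (Suc n) \<le> exp (- \<kappa> * (t (Suc n) - t n)) * a n + (c2 * C\<^sub>o) * exp (- \<mu> * t n) * N) \<longrightarrow>
    (\<forall>n. a n \<le> D * exp (- \<nu> * t n) * N)"
    by (elim exE conjE) (rule that)
  define E where "E = c1 * D + c2 * C\<^sub>o"
  have E: "E \<ge> 0" using c12 D C\<^sub>o by (simp add: E_def)
  define D1 where "D1 = E * exp (\<nu> * T) + 2 * C\<^sub>o"
  have D1: "D1 \<ge> 1" using E C\<^sub>o by (simp add: D1_def add_increasing)
  define G where "G = C1 * D\<^sup>2 / (1 - exp (- (2 * \<nu>) * \<tau>))"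
  have e1: "exp (- (2 * \<nu>) * \<tau>) < 1" using \<nu> T by simp
  have G: "G \<ge> 0" using C1 e1 by (simp add: G_def)
  have main: "(\<forall>t\<ge>0. norm (y t, yh t - y t) \<le> D1 * exp (- \<mu>\<^sub>2 * t) * norm (y 0, yh 0 - y 0)) \<and>
      L2_on {0<..} u \<and> L2_norm_on {0<..} u \<le> (sqrt G + 1) * norm (y 0, yh 0 - y 0)"
    if run: "orh_run \<iota> A Arc \<Phi> Q Z Inj T \<tau> y\<^sub>0 yh\<^sub>0 y yh u" for y\<^sub>0 yh\<^sub>0 y yh u
  proof -
    obtain ts where ts0: "ts 0 = (0 :: real)" and step: "\<And>n. (\<exists>y_opt u_opt.
              optimal_pair \<iota> A Arc \<Phi> Q T (ts n) (yh (ts n)) y_opt u_opt \<and>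
              ts (Suc n) = max_argmin (\<lambda>t. norm (y_opt t)) {ts n + \<tau>..ts n + T} \<and>
              (\<forall>t\<in>{ts n<..<ts (Suc n)}. u t = u_opt t)) \<and>
           weak_solution_on \<iota> (ts n) (ts (Suc n)) (\<lambda>t. - A - Arc t)
             (\<lambda>t. dual_incl \<iota> (control_op \<Phi> (u t))) y \<and>
           weak_solution_on \<iota> (ts n) (ts (Suc n)) (\<lambda>t. - A - Arc t)
             (\<lambda>t. dual_incl \<iota> (control_op \<Phi> (u t)
                + Inj t (Z (in_V \<iota> yh t) - Z (in_V \<iota> y t)))) yh"
      using run unfolding orh_run_def by blast
    have soly: "weak_solution_on \<iota> (ts n) (ts (Suc n)) (\<lambda>t. - A - Arc t)
        (\<lambda>t. dual_incl \<iota> (control_op \<Phi> (u t))) y"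
      and solyh: "weak_solution_on \<iota> (ts n) (ts (Suc n)) (\<lambda>t. - A - Arc t)
        (\<lambda>t. dual_incl \<iota> (control_op \<Phi> (u t) + Inj t (Z (in_V \<iota> yh t) - Z (in_V \<iota> y t)))) yh" for n
      using step[of n] by blast+
    obtain yo uo where opt: "\<And>n. optimal_pair \<iota> A Arc \<Phi> Q T (ts n) (yh (ts n)) (yo n) (uo n)"
      and tsS: "\<And>n. ts (Suc n) = max_argmin (\<lambda>t. norm (yo n t)) {ts n + \<tau>..ts n + T}"
      and uuo: "\<And>n t. t \<in> {ts n<..<ts (Suc n)} \<Longrightarrow> u t = uo n t"
      using step by metis
    have adm: "admissible_pair \<iota> A Arc \<Phi> T (ts n) (yh (ts n)) (yo n) (uo n)" for n
      using opt unfolding optimal_pair_def by blast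
    have solo: "weak_solution_on \<iota> (ts n) (ts n + T) (\<lambda>t. - A - Arc t)
        (\<lambda>t. dual_incl \<iota> (control_op \<Phi> (uo n t))) (yo n)"
      and yoa: "yo n (ts n) = yh (ts n)" and uoL: "L2_on {ts n<..<ts n + T} (uo n)" for n
      using adm unfolding admissible_pair_def by blast+
    have yoc: "continuous_on {ts n..ts n + T} (\<lambda>t. norm (yo n t))" for n
      using solo[of n] unfolding weak_solution_on_def W_deriv_def by (auto intro: continuous_intros)
    have tn: "0 \<le> ts n" and dts: "\<tau> \<le> ts (Suc n) - ts n" "ts (Suc n) - ts n \<le> T"
      and contr: "norm (yo n (ts (Suc n))) \<le> \<theta> * norm (yh (ts n))" for n
    proof -
      have A: "\<tau> \<le> ts (Suc n) - ts n \<and> ts (Suc n) - ts n \<le> T \<and>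
          norm (yo n (ts (Suc n))) \<le> \<theta> * norm (yh (ts n))" if "0 \<le> ts n" for n
      proof -
        note h = horizon[OF that opt[of n]]
        from horizon_contraction[OF yoc T conjunct1[OF h] conjunct2[OF h], folded tsS]
        show ?thesis by simp
      qed
      show t: "0 \<le> ts n" for n
      proof (induction n)
        case (Suc n)
        then show ?case using A[of n] T by linarith
      qed (simp add: ts0)
      show "\<tau> \<le> ts (Suc n) - ts n" "ts (Suc n) - ts n \<le> T"
        "norm (yo n (ts (Suc n))) \<le> \<theta> * norm (yh (ts n))"
        using A[OF t] by auto
    qed
    have tmono: "ts n \<le> ts (Suc n)" for n using dts(1)[of n] T by linarith
    have low: "\<tau> * real n \<le> ts n" for n
    proof (induction n)
      case (Suc n)
      then show ?case using dts(1)[of n] by (simp add: algebra_simps)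
    qed (simp add: ts0)
    have reach: "\<exists>n. b \<le> ts n" for b
    proof -
      obtain n where "b / \<tau> < real n" using reals_Archimedean2 by blast
      then have "b < \<tau> * real n" using T by (simp add: field_simps)
      then show ?thesis using low[of n] by (intro exI[of _ n]) linarith
    qed
    define z where "z t = yh t - y t" for t
    define N where "N = norm (y 0, z 0)"
    have N0: "N \<ge> 0" by (simp add: N_def)
    have yN: "norm (y 0) \<le> N" and zN: "norm (z 0) \<le> N"
      using norm_fst_le[of "y 0" "z 0"] norm_snd_le[of "z 0" "y 0"] by (simp_all add: N_def)
    have yhN: "norm (yh 0) \<le> 2 * N"
      using norm_triangle_ineq[of "y 0" "z 0"] yN zN by (simp add: z_def)

    \<comment> \<open>The error solves the homogeneous observer equation on the whole half-line.\<close>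
    let ?\<AA> = "\<lambda>t. - A - Arc t + (dual_incl \<iota> o\<^sub>L Inj t o\<^sub>L Z)"
    have zpiece: "weak_solution_on \<iota> (ts n) (ts (Suc n)) ?\<AA> (\<lambda>t. 0) z" for n
      using observer_error_solution[OF inj tmono soly solyh] by (simp add: z_def[abs_def])
    have zto: "weak_solution_on \<iota> 0 (ts (Suc n)) ?\<AA> (\<lambda>t. 0) z" for n
    proof (induction n)
      case 0
      then show ?case using zpiece[of 0] by (simp add: ts0)
    next
      case (Suc n)
      then show ?case by (rule weak_solution_on_join[OF _ zpiece tn tmono])
    qed
    have "weak_solution_from \<iota> 0 ?\<AA> z"
      unfolding weak_solution_from_def
    proof (intro allI impI)
      fix b :: real assume b: "0 < b"
      obtain n where "b \<le> ts n" using reach by blast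
      then have "b \<le> ts (Suc n)" using tmono[of n] by linarith
      then show "weak_solution_on \<iota> 0 b ?\<AA> (\<lambda>t. 0) z"
        using weak_solution_on_subinterval[OF zto, of 0 b n] b by simp
    qed
    then have zdecay: "norm (z t) \<le> C\<^sub>o * exp (- \<mu> * t) * N" if "0 \<le> t" for t
    proof -
      have "norm (z t) \<le> C\<^sub>o * exp (- \<mu>\<^sub>1 * t) * norm (z 0)"
        using observer[OF \<open>weak_solution_from \<iota> 0 ?\<AA> z\<close> order_refl that] by simp
      also have "\<dots> \<le> C\<^sub>o * exp (- \<mu> * t) * N"
        using C\<^sub>o \<mu> that zN by (intro mult_mono) (auto intro: mult_right_mono)
      finally show ?thesis .
    qed

    have dev: "norm (yh t - yo n t) \<le> c2 * norm (z (ts n))" if t: "t \<in> {ts n..ts (Suc n)}" for n t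
    proof -
      have b: "ts (Suc n) \<le> ts n + T" using dts(2)[of n] by simp
      have "weak_solution_on \<iota> (ts n) (ts (Suc n)) (\<lambda>t. - A - Arc t)
          (\<lambda>t. dual_incl \<iota> (control_op \<Phi> (uo n t))) (yo n)"
        by (rule weak_solution_on_subinterval[OF solo order_refl tmono b])
      then obtain g where "W_deriv \<iota> (ts n) (ts (Suc n)) (yo n) g"
        and g: "AE t in lebesgue_on {ts n<..<ts (Suc n)}. g t = (- A - Arc t) (in_V \<iota> (yo n) t) +
          dual_incl \<iota> (control_op \<Phi> (uo n t))"
        unfolding weak_solution_on_def by blast
      moreover have "AE t in lebesgue_on {ts n<..<ts (Suc n)}. u t = uo n t"
        by (rule AE_I2) (use uuo in simp)
      with g have "AE t in lebesgue_on {ts n<..<ts (Suc n)}. g t = (- A - Arc t) (in_V \<iota> (yo n) t) +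
          dual_incl \<iota> (control_op \<Phi> (u t))"
        by eventually_elim (simp only:)
      ultimately have so: "weak_solution_on \<iota> (ts n) (ts (Suc n)) (\<lambda>t. - A - Arc t)
          (\<lambda>t. dual_incl \<iota> (control_op \<Phi> (u t))) (yo n)"
        unfolding weak_solution_on_def by blast
      have "(norm (yh t - yo n t))\<^sup>2 \<le> C2 * (norm (z (ts n)))\<^sup>2"
        unfolding C2_def z_def by (rule estimate_deviation_bound[OF inj M k_def Inj' tn tmono b t soly solyh so yoa])
      then have "sqrt ((norm (yh t - yo n t))\<^sup>2) \<le> sqrt (C2 * (norm (z (ts n)))\<^sup>2)" by (rule real_sqrt_le_mono)
      then show ?thesis by (simp add: real_sqrt_mult c2_def)
    qed
    have zn: "norm (z (ts n)) \<le> C\<^sub>o * exp (- \<mu> * ts n) * N" for n by (rule zdecay[OF tn])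
    \<comment> \<open>The estimates at the concatenation times form a perturbed contraction.\<close>
    have an: "norm (yh (ts n)) \<le> D * exp (- \<nu> * ts n) * N" for n
    proof (rule D(2)[rule_format, of ts N "\<lambda>n. norm (yh (ts n))"])
      show "norm (yh (ts (Suc n))) \<le> exp (- \<kappa> * (ts (Suc n) - ts n)) * norm (yh (ts n)) +
          c2 * C\<^sub>o * exp (- \<mu> * ts n) * N" for n
      proof -
        have "norm (yh (ts (Suc n))) \<le> norm (yo n (ts (Suc n))) + norm (yh (ts (Suc n)) - yo n (ts (Suc n)))"
          using norm_triangle_ineq[of "yo n (ts (Suc n))" "yh (ts (Suc n)) - yo n (ts (Suc n))"] by simp
        also have "\<dots> \<le> \<theta> * norm (yh (ts n)) + c2 * (C\<^sub>o * exp (- \<mu> * ts n) * N)"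
          using contr[of n] dev[of "ts (Suc n)" n] tmono[of n] mult_left_mono[OF zn[of n] c12(2)] by simp
        also have "\<theta> * norm (yh (ts n)) \<le> exp (- \<kappa> * (ts (Suc n) - ts n)) * norm (yh (ts n))"
          unfolding \<theta>\<kappa> using dts(2)[of n] \<kappa> by (intro mult_right_mono) auto
        finally show "norm (yh (ts (Suc n))) \<le> exp (- \<kappa> * (ts (Suc n) - ts n)) * norm (yh (ts n)) +
          c2 * C\<^sub>o * exp (- \<mu> * ts n) * N" by (simp add: mult.assoc)
      qed
    qed (use ts0 dts N0 yhN in auto)

    have "norm (y t, z t) \<le> D1 * exp (- \<mu>\<^sub>2 * t) * N" if t: "t \<ge> 0" for t
    proof -
      obtain n where n: "ts n \<le> t" "t \<le> ts (Suc n)"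
      proof -
        define m where "m = (LEAST m. t \<le> ts m)"
        have m: "t \<le> ts m" unfolding m_def by (rule LeastI_ex[OF reach])
        show ?thesis
        proof (cases m)
          case 0
          then show ?thesis using m t tmono[of 0] by (intro that[of 0]) (auto simp: ts0)
        next
          case (Suc k)
          then have "\<not> t \<le> ts k" using not_less_Least[of k "\<lambda>m. t \<le> ts m"] by (simp add: m_def)
          then show ?thesis using m Suc by (intro that[of k]) auto
        qed
      qed
      have decay: "exp (- \<mu> * ts n) \<le> exp (- \<nu> * ts n)" "exp (- \<mu> * t) \<le> exp (- \<nu> * t)"
        using \<nu> tn[of n] t by (auto intro: mult_right_mono)
      have "(norm (yo n t))\<^sup>2 \<le> C1 * (norm (yh (ts n)))\<^sup>2"
        using C1(2)[rule_format, OF tn opt] n dts(2)[of n] by auto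
      then have "sqrt ((norm (yo n t))\<^sup>2) \<le> sqrt (C1 * (norm (yh (ts n)))\<^sup>2)" by (rule real_sqrt_le_mono)
      then have yo: "norm (yo n t) \<le> c1 * norm (yh (ts n))" by (simp add: real_sqrt_mult c1_def)
      have "norm (yh t) \<le> norm (yo n t) + norm (yh t - yo n t)"
        using norm_triangle_ineq[of "yo n t" "yh t - yo n t"] by simp
      also have "\<dots> \<le> c1 * (D * exp (- \<nu> * ts n) * N) + c2 * (C\<^sub>o * exp (- \<nu> * ts n) * N)"
      proof (rule add_mono)
        show "norm (yo n t) \<le> c1 * (D * exp (- \<nu> * ts n) * N)"
          using yo mult_left_mono[OF an[of n] c12(1)] by linarith
        have "norm (yh t - yo n t) \<le> c2 * norm (z (ts n))" using dev n by simp
        also have "\<dots> \<le> c2 * (C\<^sub>o * exp (- \<mu> * ts n) * N)" by (intro mult_left_mono zn c12)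
        also have "\<dots> \<le> c2 * (C\<^sub>o * exp (- \<nu> * ts n) * N)"
          using decay(1) C\<^sub>o N0 c12 by (intro mult_left_mono mult_right_mono) auto
        finally show "norm (yh t - yo n t) \<le> c2 * (C\<^sub>o * exp (- \<nu> * ts n) * N)" .
      qed
      also have "\<dots> = E * N * exp (- \<nu> * ts n)" by (simp add: E_def algebra_simps)
      also have "\<dots> \<le> E * N * (exp (\<nu> * T) * exp (- \<nu> * t))"
      proof (intro mult_left_mono)
        have "\<nu> * (t - ts n) \<le> \<nu> * T" using \<nu> n dts(2)[of n] by (intro mult_left_mono) auto
        then show "exp (- \<nu> * ts n) \<le> exp (\<nu> * T) * exp (- \<nu> * t)"
          by (simp add: algebra_simps flip: exp_add)
      qed (use E N0 in auto)
      finally have yht: "norm (yh t) \<le> E * exp (\<nu> * T) * (exp (- \<nu> * t) * N)" by (simp add: mult_ac)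
      have zt: "norm (z t) \<le> C\<^sub>o * (exp (- \<nu> * t) * N)"
      proof -
        have "C\<^sub>o * exp (- \<mu> * t) * N \<le> C\<^sub>o * exp (- \<nu> * t) * N"
          using decay(2) C\<^sub>o N0 by (intro mult_left_mono mult_right_mono) auto
        then show ?thesis using zdecay[OF t] by (simp add: mult.assoc)
      qed
      have "norm (y t, z t) \<le> norm (y t) + norm (z t)" by (rule norm_Pair_le)
      also have "norm (y t) \<le> norm (yh t) + norm (z t)"
        using norm_triangle_ineq4[of "yh t" "z t"] by (simp add: z_def)
      finally have "norm (y t, z t) \<le> norm (yh t) + 2 * norm (z t)" by simp
      also have "\<dots> \<le> D1 * (exp (- \<nu> * t) * N)"
        using yht zt by (simp add: D1_def distrib_right)
      also have "\<dots> \<le> D1 * (exp (- \<mu>\<^sub>2 * t) * N)"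
        using \<nu>(2) t N0 D1 by (intro mult_left_mono mult_right_mono) (auto intro: mult_right_mono)
      finally show ?thesis by (simp add: mult.assoc)
    qed
    moreover have "L2_on {0<..} u \<and> (LINT r|lebesgue_on {0<..}. (norm (u r))\<^sup>2) \<le> G * N\<^sup>2"
    proof -
      have sub: "{ts n<..<ts (Suc n)} \<subseteq> {ts n<..<ts n + T}" for n using dts(2)[of n] by auto
      have uL: "L2_on {ts n<..<ts (Suc n)} u" for n
      proof (rule L2_on_cong_AE)
        show "L2_on {ts n<..<ts (Suc n)} (uo n)" by (rule L2_on_subset[OF uoL sub]) auto
        show "AE t in lebesgue_on {ts n<..<ts (Suc n)}. uo n t = u t" by (rule AE_I2) (use uuo in simp)
      qed simp
      have le: "(LINT r|lebesgue_on {ts n<..<ts (Suc n)}. (norm (u r))\<^sup>2) \<le> (C1 * D\<^sup>2 * N\<^sup>2) * exp (- (2 * \<nu>) * ts n)" for n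
      proof -
        have "(LINT r|lebesgue_on {ts n<..<ts (Suc n)}. (norm (u r))\<^sup>2) =
            (LINT r|lebesgue_on {ts n<..<ts (Suc n)}. (norm (uo n r))\<^sup>2)"
          by (rule Bochner_Integration.integral_cong) (use uuo in auto)
        also have "\<dots> \<le> (LINT r|lebesgue_on {ts n<..<ts n + T}. (norm (uo n r))\<^sup>2)"
        proof -
          note a1 = L2_on_Ioo_norm_integrable[OF L2_on_subset[OF uoL sub]]
            and a2 = L2_on_Ioo_norm_integrable[OF uoL]
          have a1': "(\<lambda>t. (norm (uo n t))\<^sup>2) absolutely_integrable_on {ts n..ts (Suc n)}" by (rule a1) auto
          show ?thesis
            unfolding integral_lebesgue_on_Ioo[OF a1'] integral_lebesgue_on_Ioo[OF a2]
            by (rule Henstock_Kurzweil_Integration.integral_subset_le)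
              (use dts(2)[of n] a1' a2[of n] in \<open>auto simp: absolutely_integrable_on_def\<close>)
        qed
        also have "\<dots> \<le> C1 * (norm (yh (ts n)))\<^sup>2" using C1(2)[rule_format, OF tn opt] by blast
        also have "\<dots> \<le> C1 * (D * exp (- \<nu> * ts n) * N)\<^sup>2"
          using an[of n] C1(1) by (intro mult_left_mono power_mono) auto
        also have "\<dots> = (C1 * D\<^sup>2 * N\<^sup>2) * exp (- (2 * \<nu>) * ts n)"
          by (simp add: power_mult_distrib exp_double[symmetric] mult_ac flip: exp_of_nat_mult)
        finally show ?thesis .
      qed
      have nn: "0 \<le> C1 * D\<^sup>2 * N\<^sup>2" and 2: "0 < 2 * \<nu>" using C1 \<nu> by auto
      show ?thesis
        using L2_on_pieces[OF ts0 dts(1) T(2) uL 2 nn le] by (simp add: G_def mult_ac)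
    qed
    moreover have "sqrt (G * N\<^sup>2) \<le> (sqrt G + 1) * N" using N0 by (simp add: real_sqrt_mult distrib_right)
    ultimately show ?thesis
      unfolding L2_norm_on_def z_def[symmetric] N_def[symmetric] by (meson order_trans real_sqrt_le_mono)
  qed
  have "sqrt G + 1 > 0" using G by (simp add: add_nonneg_pos)
  with D1 main show ?thesis by blast
qed

end
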